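(* Let $k$ be a number field and let $\mathcal E$ be the elliptic curve over $k(T)$ given by $$y^2=\mu T^2+B(x)T+C(x),$$ where $\mu\in k^\times$, $B,C\in k[x]$, $\deg(B)\le2$ and $\deg(C)=3$. Let $r_k$ be the rank of $\mathcal E(k(T))$. Then $$r_k=\begin{cases}\delta_k-1&\text{if }\mu\in k^2,\\ \delta_k&\text{if }\mu\in k\setminus k^2,\end{cases}$$ where $k^2$ denotes the set of squares in $k$.
   Context: $\overline k$ is a fixed algebraic closure of $k$. For a curve $y^2=A(x)T^2+B(x)T+C(x)$ with $A,B,C\in k[x]$, put $\Delta_{\mathrm{conic}}(x)=B(x)^2-4A(x)C(x)$. Then $\delta_k$ is the number of $\mathrm{Gal}(\overline k/k)$-orbits $[\theta]$ of elements $\theta\in\overline k$ with $\Delta_{\mathrm{conic}}(\theta)=0$ such that either $A(\theta)$ is a nonzero square in $k(\theta)$, or $A(\theta)=0$ and $C(\theta)$ is a nonzero square in $k(\theta)$. (Here $A(x)=\mu$ is constant.) *)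

theory Defs
  imports
    "HOL-Algebra.Generated_Fields"
    "HOL-Algebra.Algebraic_Closure_Type"
    "HOL-Library.Extended_Nat"
begin

definition number_field :: "'k::field_char_0 itself \<Rightarrow> bool" where
  "number_field _ \<longleftrightarrow>
     (\<exists>Basis. finite_dimensional_vector_space (\<lambda>(q::rat) (x::'k). of_rat q * x) Basis)"

definition int_independent :: "('a, 'b) monoid_scheme \<Rightarrow> 'a set \<Rightarrow> bool" where
  "int_independent G S \<longleftrightarrow> finite S \<and> S \<subseteq> carrier G \<and>
     (\<forall>n :: 'a \<Rightarrow> int.
        finprod G (\<lambda>s. s [^]\<^bsub>G\<^esub> n s) S = \<one>\<^bsub>G\<^esub> \<longrightarrow> (\<forall>s\<in>S. n s = 0))"

text \<open>Valued in \<^typ>\<open>enat\<close>, so that a group of infinite rank gets no junk value.\<close>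

definition abelian_rank :: "('a, 'b) monoid_scheme \<Rightarrow> enat" where
  "abelian_rank G = (SUP S \<in> {S. int_independent G S}. enat (card S))"

text \<open>
  Smoothness is tested on the affine part over the algebraic closure, by the Jacobian
  criterion for \<open>y\<^sup>2 - f(x)\<close>; the unique point at infinity of a cubic of this shape is
  always smooth.
\<close>

definition elliptic_curve :: "'a::field poly \<Rightarrow> bool" where
  "elliptic_curve f \<longleftrightarrow> Polynomial.degree f = 3 \<and>
     \<not> (\<exists>x y :: 'a alg_closure.
          y ^ 2 = poly (map_poly to_ac f) x \<and>
          2 * y = 0 \<and> poly (pderiv (map_poly to_ac f)) x = 0)"

datatype 'a point = Infinity | Affine 'a 'a

definition points :: "'a::field poly \<Rightarrow> 'a point set" where
  "points f = insert Infinity {Affine x y | x y. y ^ 2 = poly f x}"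

text \<open>
  Chord and tangent law, for \<open>f\<close> not necessarily monic, with origin \<open>Infinity\<close>. Substituting the line
  \<open>y = y\<^sub>1 + l (x - x\<^sub>1)\<close> into \<open>y\<^sup>2 = a x\<^sup>3 + b x\<^sup>2 + c x + d\<close> gives a cubic in \<open>x\<close> whose
  three roots have sum \<open>(l\<^sup>2 - b) / a\<close>.
\<close>

fun point_add :: "'a::field poly \<Rightarrow> 'a point \<Rightarrow> 'a point \<Rightarrow> 'a point" where
  "point_add f Infinity Q = Q"
| "point_add f P Infinity = P"
| "point_add f (Affine x1 y1) (Affine x2 y2) =
     (if x1 = x2 \<and> y1 = - y2 then Infinity
      else
        let l = (if x1 = x2 then poly (pderiv f) x1 / (2 * y1) else (y2 - y1) / (x2 - x1));
            x3 = (l ^ 2 - Polynomial.coeff f 2) / Polynomial.coeff f 3 - x1 - x2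
        in Affine x3 (- (y1 + l * (x3 - x1))))"

definition mordell_weil_group :: "'a::field poly \<Rightarrow> 'a point monoid" where
  "mordell_weil_group f =
     \<lparr>carrier = points f, monoid.mult = point_add f, one = Infinity\<rparr>"

text \<open>
  For \<open>y\<^sup>2 = A(x) T\<^sup>2 + B(x) T + C(x)\<close>: the field \<open>k(T)\<close> is \<^typ>\<open>'k poly fract\<close>. The right-hand side is a polynomial in \<open>x\<close> with
  coefficients in \<open>k(T)\<close>; the inner polynomials below are in the variable \<open>T\<close>.
\<close>

definition const_T :: "'k::field \<Rightarrow> 'k poly fract" where
  "const_T c = to_fract [:c:]"

definition var_T :: "'k::field poly fract" where
  "var_T = to_fract [:0, 1:]"

definition curve_poly :: "'k::field poly \<Rightarrow> 'k poly \<Rightarrow> 'k poly \<Rightarrow> 'k poly fract poly" where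
  "curve_poly A B C =
     smult (var_T ^ 2) (map_poly const_T A) + smult var_T (map_poly const_T B) + map_poly const_T C"

definition conic_disc :: "'k::field poly \<Rightarrow> 'k poly \<Rightarrow> 'k poly \<Rightarrow> 'k poly" where
  "conic_disc A B C = B ^ 2 - 4 * A * C"

definition absolute_galois_group :: "('k::field alg_closure \<Rightarrow> 'k alg_closure) set" where
  "absolute_galois_group =
     {\<sigma> \<in> ring_iso ring_of_type_algebra ring_of_type_algebra. \<forall>c. \<sigma> (to_ac c) = to_ac c}"

definition galois_orbit :: "'k::field alg_closure \<Rightarrow> 'k alg_closure set" where
  "galois_orbit \<theta> = {\<sigma> \<theta> | \<sigma>. \<sigma> \<in> absolute_galois_group}"

definition adjoin :: "'k::field alg_closure \<Rightarrow> 'k alg_closure set" where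
  "adjoin \<theta> = generate_field ring_of_type_algebra (insert \<theta> (range to_ac))"

definition nonzero_square_in :: "'a::field set \<Rightarrow> 'a \<Rightarrow> bool" where
  "nonzero_square_in F a \<longleftrightarrow> a \<noteq> 0 \<and> (\<exists>s\<in>F. a = s ^ 2)"

definition delta_elements ::
  "'k::field poly \<Rightarrow> 'k poly \<Rightarrow> 'k poly \<Rightarrow> 'k alg_closure set" where
  "delta_elements A B C =
     {\<theta>. poly (map_poly to_ac (conic_disc A B C)) \<theta> = 0 \<and>
         (nonzero_square_in (adjoin \<theta>) (poly (map_poly to_ac A) \<theta>) \<or>
          poly (map_poly to_ac A) \<theta> = 0 \<and>
          nonzero_square_in (adjoin \<theta>) (poly (map_poly to_ac C) \<theta>))}"

definition delta :: "'k::field poly \<Rightarrow> 'k poly \<Rightarrow> 'k poly \<Rightarrow> nat" where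
  "delta A B C = card (galois_orbit ` delta_elements A B C)"

end

theory Submission
  imports Defs "HOL-Library.Set_Algebras"
begin

text \<open>
  The surface \<open>y\<^sup>2 = \<mu> T\<^sup>2 + B(x) T + C(x)\<close> is a family of conics
  over the \<open>x\<close>-line, and the conics determine the rank. Over an algebraic closure
  \<open>K\<close> of \<open>k\<close> choose \<open>s\<close> with
  \<open>s\<^sup>2 = \<mu>\<close> and put \<open>w = s T + B / (2 s)\<close>,
  \<open>u = y - w\<close> and \<open>v = y + w\<close>. The equation becomes
  \<open>u v = D\<close> with \<open>D = C - B\<^sup>2 / (4 \<mu>)\<close>, a constant multiple
  of the discriminant of the conics, and \<open>T\<close> is a polynomial in \<open>x\<close>,
  \<open>u\<close> and \<open>v\<close>. So the functions on the surface that are regular away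
  from \<open>u = 0\<close> form the factorial ring \<open>K[x, u, 1/u]\<close>.

  A point \<open>P\<close> over \<open>K(T)\<close> traces a curve on the surface. Away from
  \<open>u = 0\<close> this curve is cut out by one irreducible polynomial in \<open>x\<close>
  and \<open>u\<close>, so \<open>P\<close> is a combination of the points
  \<open>P\<^sub>\<theta> = (\<theta>, w(\<theta>))\<close> with \<open>D(\<theta>) = 0\<close>,
  along which \<open>u\<close> vanishes (\<open>points_generated\<close>). The function
  \<open>u\<close> itself gives the relation
  \<open>\<Sum> m\<^sub>\<theta> P\<^sub>\<theta> = 0\<close>, where
  \<open>m\<^sub>\<theta>\<close> is the multiplicity of the root \<open>\<theta>\<close>. Every
  other relation is a multiple of this one (\<open>relations_between_generators\<close>): a
  function whose divisor is supported on the \<open>P\<^sub>\<theta>\<close> divides a power of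
  \<open>u\<close> up to functions of \<open>T\<close>; all fibres \<open>T = t\<close> are
  irreducible, because a cubic in \<open>x\<close> is not a square; hence unique factorization
  makes the function a power of \<open>u\<close> times a function of \<open>T\<close>. So the
  points over \<open>K(T)\<close> form the group
  \<open>\<int>\<^sup>\<Theta> / \<int> m\<close>, where \<open>\<Theta>\<close> is the set of
  roots of \<open>D\<close>.

  These statements about divisors are proved with ideals of the affine coordinate ring
  \<open>L[x, y]\<close>, where \<open>L = K(T)\<close>, and the same ideals yield the group
  axioms. The intersection of the cubic with the graph of a polynomial is a principal divisor
  (\<open>graph_principal\<close>); for lines this says that ideal classes multiply as points
  add. The norm of a generator shows that different points have different classes
  (\<open>gens_class_inj\<close>). So associativity of the chord and tangent law is inherited
  from the multiplication of ideals.

  An automorphism \<open>\<sigma>\<close> of \<open>K\<close> over \<open>k\<close> maps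
  \<open>P\<^sub>\<theta>\<close> to
  \<open>\<chi>(\<sigma>) P\<^bsub>\<sigma> \<theta>\<^esub>\<close> with
  \<open>\<chi>(\<sigma>) = \<sigma>(s) / s\<close>, and the points over \<open>k(T)\<close> are
  the invariant ones (\<open>equivariant_descends\<close>). Up to torsion they form the lattice
  of integral functions \<open>n\<close> on \<open>\<Theta>\<close> with total \<open>0\<close>
  and \<open>n(\<sigma> \<theta>) = \<chi>(\<sigma>) n(\<theta>)\<close>. Such a function
  vanishes at \<open>\<theta>\<close> unless the stabilizer of \<open>\<theta>\<close> fixes
  \<open>s\<close>, that is, unless \<open>\<mu>\<close> is a square in
  \<open>k(\<theta>)\<close> (\<open>galois_moves\<close>); on each of the remaining orbits it
  is determined by one value. If \<open>s\<close> is not in \<open>k\<close>, the total is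
  \<open>0\<close> automatically, because an automorphism that negates \<open>s\<close> negates
  it. If \<open>s\<close> is in \<open>k\<close>, the condition on the total lowers the rank by
  one.
\<close>

section \<open>Embeddings of integral domains\<close>

text \<open>The proof moves between several fields (constants, rational functions of
  \<open>T\<close>, the function field of the surface, and their extensions) along injective
  homomorphisms; here is the arithmetic that such a homomorphism preserves.\<close>

locale idom_emb =
  fixes h :: "'a::idom \<Rightarrow> 'b::idom"
  assumes hom_add: "h (x + y) = h x + h y"
    and hom_mult: "h (x * y) = h x * h y"
    and hom_one: "h 1 = 1"
    and hom_inj: "h x = 0 \<Longrightarrow> x = 0"
begin

lemma hom_zero: "h 0 = 0"
  using hom_add[of 0 0] by (metis add_0 add_cancel_right_right)

lemma hom_minus: "h (- x) = - h x"
  using hom_add[of x "- x"] hom_zero by (metis add.right_inverse minus_unique)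

lemma hom_diff: "h (x - y) = h x - h y"
  using hom_add[of x "- y"] hom_minus by simp

lemma hom_power: "h (x ^ n) = h x ^ n"
  by (induction n) (simp_all add: hom_one hom_mult)

lemma hom_0_iff: "h x = 0 \<longleftrightarrow> x = 0"
  using hom_inj hom_zero by blast

lemma hom_eq_iff: "h x = h y \<longleftrightarrow> x = y"
  using hom_inj[of "x - y"] by (auto simp: hom_diff)

lemma hom_of_nat: "h (of_nat n) = of_nat n"
  by (induction n) (simp_all add: hom_zero hom_one hom_add)

lemma hom_numeral: "h (numeral n) = numeral n"
  using hom_of_nat[of "numeral n"] by simp

lemma hom_sum: "h (sum g A) = (\<Sum>a\<in>A. h (g a))"
  by (induction A rule: infinite_finite_induct) (simp_all add: hom_zero hom_add)

lemma hom_prod_mset: "h (\<Prod>a\<in>#A. g a) = (\<Prod>a\<in>#A. h (g a))"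
  by (induction A) (simp_all add: hom_one hom_mult)

lemma coeff_map: "Polynomial.coeff (map_poly h p) n = h (Polynomial.coeff p n)"
  by (simp add: coeff_map_poly hom_zero)

lemma map_poly_emb: "idom_emb (map_poly h)"
proof
  show "map_poly h (p + q) = map_poly h p + map_poly h q" for p q
    by (intro poly_eqI) (simp add: coeff_map hom_add)
  show "map_poly h (p * q) = map_poly h p * map_poly h q" for p q
    by (intro poly_eqI) (simp add: coeff_map coeff_mult hom_sum hom_mult)
  show "map_poly h 1 = 1"
    by (simp add: hom_one)
  show "p = 0" if "map_poly h p = 0" for p
  proof (rule poly_eqI)
    fix n show "Polynomial.coeff p n = Polynomial.coeff 0 n"
      using coeff_map[of p n] that by (simp add: hom_0_iff)
  qed
qed

lemma map_poly_pCons: "map_poly h (pCons a p) = pCons (h a) (map_poly h p)"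
  by (intro poly_eqI) (simp add: coeff_map coeff_pCons split: nat.split)

lemma map_poly_smult: "map_poly h (smult a p) = smult (h a) (map_poly h p)"
  by (intro poly_eqI) (simp add: coeff_map hom_mult)

lemma degree_map: "Polynomial.degree (map_poly h p) = Polynomial.degree p"
  by (intro degree_map_poly) (auto simp: hom_0_iff)

lemma poly_map: "poly (map_poly h p) (h a) = h (poly p a)"
  by (induction p) (simp_all add: hom_zero map_poly_pCons hom_add hom_mult)

lemma map_poly_pderiv: "map_poly h (pderiv p) = pderiv (map_poly h p)"
  by (intro poly_eqI) (simp add: coeff_map coeff_pderiv hom_mult hom_add hom_of_nat hom_one)

end

lemma idom_emb_comp:
  assumes "idom_emb g" "idom_emb h"
  shows "idom_emb (\<lambda>a. g (h a))"
proof -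
  interpret g: idom_emb g by fact
  interpret h: idom_emb h by fact
  show ?thesis
    by standard (auto simp: h.hom_add h.hom_mult h.hom_one g.hom_add g.hom_mult g.hom_one
        dest: g.hom_inj h.hom_inj)
qed

locale field_emb = idom_emb h for h :: "'a::field \<Rightarrow> 'b::field"
begin

lemma hom_inverse: "h (inverse x) = inverse (h x)"
proof (cases "x = 0")
  case False
  then have "h x * h (inverse x) = 1"
    by (simp flip: hom_mult add: hom_one)
  then show ?thesis
    by (metis inverse_unique)
qed (simp add: hom_zero)

lemma hom_divide: "h (x / y) = h x / h y"
  by (simp add: divide_inverse hom_mult hom_inverse)

end

lemma to_fract_emb: "idom_emb (to_fract :: 'a::idom \<Rightarrow> 'a fract)"
  by standard auto

lemma const_poly_emb: "idom_emb (\<lambda>c::'a::idom. [:c:])"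
  by standard (auto simp: one_pCons)

lemma to_ac_emb: "field_emb to_ac"
  by standard auto

text \<open>Any representation of \<open>q\<close> gives the same value, since an embedding keeps
  denominators nonzero.\<close>

definition fract_lift :: "('a::idom \<Rightarrow> 'b::field) \<Rightarrow> 'a fract \<Rightarrow> 'b" where
  "fract_lift h q = (SOME z. \<exists>a b. b \<noteq> 0 \<and> q = Fract a b \<and> z = h a / h b)"

context
  fixes h :: "'a::idom \<Rightarrow> 'b::field"
  assumes emb: "idom_emb h"
begin

interpretation idom_emb h by (fact emb)

lemma fract_lift_Fract:
  assumes "b \<noteq> 0"
  shows "fract_lift h (Fract a b) = h a / h b"
  unfolding fract_lift_def
proof (rule someI2_ex)
  show "\<exists>z a' b'. b' \<noteq> 0 \<and> Fract a b = Fract a' b' \<and> z = h a' / h b'"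
    using assms by blast
next
  fix z assume "\<exists>a' b'. b' \<noteq> 0 \<and> Fract a b = Fract a' b' \<and> z = h a' / h b'"
  then obtain a' b' where *: "b' \<noteq> 0" "Fract a b = Fract a' b'" "z = h a' / h b'"
    by blast
  then have "a * b' = a' * b"
    using assms by (simp add: eq_fract)
  then have "h a * h b' = h a' * h b"
    by (simp flip: hom_mult)
  then have "h a / h b = h a' / h b'"
    using * assms by (simp add: frac_eq_eq hom_0_iff)
  then show "z = h a / h b"
    using * by simp
qed

lemma fract_lift_to_fract: "fract_lift h (to_fract a) = h a"
  by (simp add: to_fract_def fract_lift_Fract hom_one)

lemma fract_lift_emb: "field_emb (fract_lift h)"
proof -
  have "fract_lift h (p + q) = fract_lift h p + fract_lift h q" for p q
    by (cases p; cases q)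
      (simp add: fract_lift_Fract hom_add hom_mult hom_0_iff field_simps)
  moreover have "fract_lift h (p * q) = fract_lift h p * fract_lift h q" for p q
    by (cases p; cases q) (simp add: fract_lift_Fract hom_mult)
  moreover have "fract_lift h 1 = 1"
    using fract_lift_to_fract[of 1] by (simp add: hom_one)
  moreover have "p = 0" if "fract_lift h p = 0" for p
    using that by (cases p) (auto simp: fract_lift_Fract hom_0_iff fract_collapse)
  ultimately show ?thesis
    by unfold_locales
qed

end

section \<open>Spans over a subring of a field\<close>

text \<open>Fractional ideals of \<open>S\<close> are represented by sets of generators.
  Elementwise products make these sets a commutative monoid, so products of ideals can be written
  and rearranged with the notation for products of numbers.\<close>

locale subring_of_field =
  fixes S :: "'f::field set"
  assumes S_zero: "0 \<in> S" and S_one: "1 \<in> S"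
    and S_add: "a \<in> S \<Longrightarrow> b \<in> S \<Longrightarrow> a + b \<in> S"
    and S_mult: "a \<in> S \<Longrightarrow> b \<in> S \<Longrightarrow> a * b \<in> S"
    and S_minus: "a \<in> S \<Longrightarrow> - a \<in> S"
begin

lemma S_diff: "a \<in> S \<Longrightarrow> b \<in> S \<Longrightarrow> a - b \<in> S"
  using S_add[of a "- b"] S_minus by simp

lemma S_power: "a \<in> S \<Longrightarrow> a ^ n \<in> S"
  by (induction n) (auto simp: S_one S_mult)

text \<open>The \<open>S\<close>-submodule generated by \<open>V\<close>, built by adding one
  multiple of a generator at a time.\<close>

definition ideal_span :: "'f set \<Rightarrow> 'f set" where
  "ideal_span V = \<Inter> {M. 0 \<in> M \<and> (\<forall>s\<in>S. \<forall>a\<in>V. \<forall>z\<in>M. s * a + z \<in> M)}"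

lemma span_zero: "0 \<in> ideal_span V"
  by (simp add: ideal_span_def)

lemma span_step:
  "s \<in> S \<Longrightarrow> a \<in> V \<Longrightarrow> z \<in> ideal_span V \<Longrightarrow> s * a + z \<in> ideal_span V"
  by (auto simp: ideal_span_def)

lemma span_induct [consumes 1, case_names zero step]:
  assumes "z \<in> ideal_span V" and "P 0"
    and "\<And>s a z. s \<in> S \<Longrightarrow> a \<in> V \<Longrightarrow> z \<in> ideal_span V \<Longrightarrow> P z \<Longrightarrow> P (s * a + z)"
  shows "P z"
proof -
  have "z \<in> {z \<in> ideal_span V. P z}"
    using assms(1)
    by (rule subsetD[rotated, of _ "ideal_span V"])
      (unfold ideal_span_def[of V], rule Inter_lower,
        auto simp flip: ideal_span_def intro: assms(2,3) span_zero span_step)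
  then show ?thesis by blast
qed

lemma span_base: "a \<in> V \<Longrightarrow> a \<in> ideal_span V"
  using span_step[OF S_one _ span_zero] by simp

lemma span_add: "a \<in> ideal_span V \<Longrightarrow> b \<in> ideal_span V \<Longrightarrow> a + b \<in> ideal_span V"
  by (induction rule: span_induct) (auto simp: add.assoc intro: span_step)

lemma span_smult: "z \<in> ideal_span V \<Longrightarrow> s \<in> S \<Longrightarrow> s * z \<in> ideal_span V"
proof (induction rule: span_induct)
  case zero
  then show ?case using span_zero by simp
next
  case (step t a z)
  have "(s * t) * a + s * z \<in> ideal_span V"
    using step by (intro span_step S_mult) auto
  then show ?case
    by (simp add: algebra_simps)
qed

lemma span_smult': "z \<in> ideal_span V \<Longrightarrow> s \<in> S \<Longrightarrow> z * s \<in> ideal_span V"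
  using span_smult[of z V s] by (simp add: mult.commute)

lemma span_minus: "a \<in> ideal_span V \<Longrightarrow> - a \<in> ideal_span V"
  using span_smult[of a V "- 1"] S_minus[OF S_one] by simp

lemma span_diff: "a \<in> ideal_span V \<Longrightarrow> b \<in> ideal_span V \<Longrightarrow> a - b \<in> ideal_span V"
  using span_add[of a V "- b"] span_minus by simp

lemma span_least: "V \<subseteq> ideal_span W \<Longrightarrow> ideal_span V \<subseteq> ideal_span W"
proof
  fix z assume "V \<subseteq> ideal_span W" "z \<in> ideal_span V"
  from this(2,1) show "z \<in> ideal_span W"
    by (induction rule: span_induct) (auto intro: span_zero span_add span_smult)
qed

lemma span_eqI: "V \<subseteq> ideal_span W \<Longrightarrow> W \<subseteq> ideal_span V \<Longrightarrow> ideal_span V = ideal_span W"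
  using span_least by blast

lemma span_mono: "V \<subseteq> W \<Longrightarrow> ideal_span V \<subseteq> ideal_span W"
  by (rule span_least) (auto intro: span_base)

lemma span_subset_S: "V \<subseteq> S \<Longrightarrow> ideal_span V \<subseteq> S"
proof
  fix z assume "V \<subseteq> S" "z \<in> ideal_span V"
  from this(2,1) show "z \<in> S"
    by (induction rule: span_induct) (auto intro: S_zero S_add S_mult)
qed

lemma span_mult:
  assumes "a \<in> ideal_span V" "b \<in> ideal_span W"
  shows "a * b \<in> ideal_span (V * W)"
  using assms
proof (induction a rule: span_induct)
  case zero
  then show ?case using span_zero by simp
next
  case (step s a z)
  have "a * b \<in> ideal_span (V * W)"
    using \<open>b \<in> ideal_span W\<close>
  proof (induction b rule: span_induct)
    case zero
    then show ?case using span_zero by simp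
  next
    case (step t b w)
    have "t * (a * b) + a * w \<in> ideal_span (V * W)"
      using step \<open>a \<in> V\<close> by (intro span_step) auto
    then show ?case by (simp add: algebra_simps)
  qed
  from span_add[OF span_smult[OF this \<open>s \<in> S\<close>] step.IH[OF \<open>b \<in> ideal_span W\<close>]]
  have "s * (a * b) + z * b \<in> ideal_span (V * W)" .
  then show ?case
    by (simp add: algebra_simps)
qed

lemma span_times_mono:
  assumes "ideal_span V \<subseteq> ideal_span V'" "ideal_span W \<subseteq> ideal_span W'"
  shows "ideal_span (V * W) \<subseteq> ideal_span (V' * W')"
proof (rule span_least, rule subsetI)
  fix z assume "z \<in> V * W"
  then obtain a b where "z = a * b" "a \<in> V" "b \<in> W"
    by (auto simp: set_times_def)
  then show "z \<in> ideal_span (V' * W')"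
    using assms span_base by (auto intro!: span_mult)
qed

lemma span_times_cong: "ideal_span V = ideal_span V' \<Longrightarrow> ideal_span W = ideal_span W' \<Longrightarrow> ideal_span (V * W) = ideal_span (V' * W')"
  by (intro antisym span_times_mono) auto

lemma span_power_cong: "ideal_span V = ideal_span V' \<Longrightarrow> ideal_span (V ^ n) = ideal_span (V' ^ n)"
  by (induction n) (auto intro!: span_times_cong)

lemma span_prod_mset_cong:
  assumes "\<And>a. a \<in># A \<Longrightarrow> ideal_span (V a) = ideal_span (W a)"
  shows "ideal_span (\<Prod>a\<in>#A. V a) = ideal_span (\<Prod>a\<in>#A. W a)"
  using assms by (induction A) (auto intro!: span_times_cong)

lemma span_scale: "z \<in> ideal_span ({h} * V) \<longleftrightarrow> (\<exists>w\<in>ideal_span V. z = h * w)"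
proof
  assume "z \<in> ideal_span ({h} * V)"
  then show "\<exists>w\<in>ideal_span V. z = h * w"
  proof (induction rule: span_induct)
    case zero
    then show ?case using span_zero by force
  next
    case (step s a z)
    then obtain b w where "a = h * b" "b \<in> V" "w \<in> ideal_span V" "z = h * w"
      by (auto simp: set_times_def)
    moreover from this have "s * b + w \<in> ideal_span V"
      using \<open>s \<in> S\<close> by (intro span_step)
    ultimately have "s * a + z = h * (s * b + w)" "s * b + w \<in> ideal_span V"
      by (simp_all add: algebra_simps)
    then show ?case by blast
  qed
next
  assume "\<exists>w\<in>ideal_span V. z = h * w"
  then show "z \<in> ideal_span ({h} * V)"
    using span_mult[of h "{h}"] span_base[of h "{h}"] by auto
qed

lemma span_singleton: "z \<in> ideal_span {h} \<longleftrightarrow> (\<exists>s\<in>S. z = h * s)"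
proof -
  have "ideal_span {1} = S"
  proof
    show "ideal_span {1} \<subseteq> S" by (rule span_subset_S) (simp add: S_one)
    show "S \<subseteq> ideal_span {1}" using span_smult[OF span_base[of 1 "{1}"]] by auto
  qed
  moreover have "{h} * {1} = {h}"
    by (auto simp: set_times_def)
  ultimately show ?thesis
    using span_scale[of z h "{1}"] by simp
qed

lemma span_scale_cancel:
  assumes "h \<noteq> 0" "ideal_span ({h} * V) \<subseteq> ideal_span ({h} * W)"
  shows "ideal_span V \<subseteq> ideal_span W"
proof
  fix z assume "z \<in> ideal_span V"
  then have "h * z \<in> ideal_span ({h} * W)"
    using assms span_scale by blast
  then show "z \<in> ideal_span W"
    using assms(1) span_scale by auto
qed

text \<open>Fractional ideals in the same class differ by a principal factor.\<close>

definition same_class :: "'f set \<Rightarrow> 'f set \<Rightarrow> bool" where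
  "same_class V W \<longleftrightarrow> (\<exists>h. h \<noteq> 0 \<and> ideal_span V = ideal_span ({h} * W))"

lemma same_classI: "h \<noteq> 0 \<Longrightarrow> ideal_span V = ideal_span ({h} * W) \<Longrightarrow> same_class V W"
  unfolding same_class_def by blast

lemma same_class_span: "ideal_span V = ideal_span W \<Longrightarrow> same_class V W"
  by (rule same_classI[of 1]) (simp_all flip: set_one)

lemma same_class_refl: "same_class V V"
  by (rule same_class_span) simp

lemma same_class_sym: assumes "same_class V W" shows "same_class W V"
proof -
  obtain h where h: "h \<noteq> 0" "ideal_span V = ideal_span ({h} * W)"
    using assms unfolding same_class_def by blast
  have "ideal_span ({inverse h} * V) = ideal_span ({inverse h} * ({h} * W))"
    using h by (intro span_times_cong) auto
  also have "{inverse h} * ({h} * W) = W"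
    using h by (simp flip: mult.assoc set_one add: set_times_def[of "{inverse h}" "{h}"])
  finally show ?thesis
    using h by (intro same_classI[of "inverse h"]) auto
qed

lemma singleton_times: "{a} * {b} = {a * b :: 'f}"
  by (auto simp: set_times_def)

lemma same_class_mult:
  assumes "same_class V W" "same_class V' W'"
  shows "same_class (V * V') (W * W')"
proof -
  obtain h h' where h: "h \<noteq> 0" "ideal_span V = ideal_span ({h} * W)" "h' \<noteq> 0" "ideal_span V' = ideal_span ({h'} * W')"
    using assms unfolding same_class_def by blast
  have "ideal_span (V * V') = ideal_span (({h} * W) * ({h'} * W'))"
    using h by (intro span_times_cong) auto
  also have "({h} * W) * ({h'} * W') = {h * h'} * (W * W')"
    by (simp add: ac_simps flip: singleton_times)
  finally show ?thesis
    using h by (intro same_classI[of "h * h'"]) auto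
qed

lemma same_class_trans:
  assumes "same_class V W" "same_class W Z"
  shows "same_class V Z"
proof -
  obtain h h' where h: "h \<noteq> 0" "ideal_span V = ideal_span ({h} * W)" "h' \<noteq> 0" "ideal_span W = ideal_span ({h'} * Z)"
    using assms unfolding same_class_def by blast
  have "ideal_span V = ideal_span ({h} * ({h'} * Z))"
    using h by (simp cong: span_times_cong)
  also have "{h} * ({h'} * Z) = {h * h'} * Z"
    by (simp flip: singleton_times add: ac_simps)
  finally show ?thesis
    using h by (intro same_classI[of "h * h'"]) auto
qed

lemma same_class_singleton: "h \<noteq> 0 \<Longrightarrow> ideal_span V = ideal_span {h} \<Longrightarrow> same_class V 1"
  by (rule same_classI[of h]) (simp_all add: singleton_times)

lemma same_class_1D: "same_class V 1 \<Longrightarrow> \<exists>h. h \<noteq> 0 \<and> ideal_span V = ideal_span {h}"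
  unfolding same_class_def by (simp add: singleton_times)

end

section \<open>The coordinate ring of an affine cubic curve\<close>

text \<open>The coordinate ring of \<open>y\<^sup>2 = f(x)\<close> over \<open>'l\<close> is
  realized inside a given field \<open>'f\<close>, so that its fractional ideals are subsets of
  one type. The elements \<open>\<xi>\<close> and \<open>\<eta>\<close> are the coordinate
  functions.\<close>

locale cubic_curve = field_emb \<iota> for \<iota> :: "'l::field \<Rightarrow> 'f::field" +
  fixes f :: "'l poly" and \<xi> \<eta> :: 'f
  assumes degree_f: "Polynomial.degree f = 3"
    and two_neq_0: "(2::'l) \<noteq> 0"
    and nonsingular: "poly f a = 0 \<Longrightarrow> poly (pderiv f) a \<noteq> 0"
    and transcendental: "poly (map_poly \<iota> p) \<xi> = 0 \<Longrightarrow> p = 0"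
    and curve_eq: "\<eta> ^ 2 = poly (map_poly \<iota> f) \<xi>"
begin

definition E :: "'l poly \<Rightarrow> 'f" where
  "E p = poly (map_poly \<iota> p) \<xi>"

lemma E_emb: "idom_emb E"
proof -
  interpret m: idom_emb "map_poly \<iota>" by (rule map_poly_emb)
  show ?thesis
    by standard (auto simp: E_def m.hom_add m.hom_mult m.hom_one transcendental)
qed

sublocale E: idom_emb E by (rule E_emb)

lemma E_const: "E [:c:] = \<iota> c"
  by (simp add: E_def map_poly_pCons)

lemma E_linear: "E [:c, d:] = \<iota> c + \<iota> d * \<xi>"
  by (simp add: E_def map_poly_pCons mult.commute)

lemma E_root: "E [:- a, 1:] = \<xi> - \<iota> a"
  by (simp add: E_linear hom_minus hom_one)

lemma E_smult: "E (smult c p) = \<iota> c * E p"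
  by (simp add: E_def map_poly_smult)

lemma E_split: "p = [:c:] + [:- a, 1:] * q \<Longrightarrow> E p = \<iota> c + (\<xi> - \<iota> a) * E q"
  by (simp only: E.hom_add E.hom_mult E_const E_root)

lemma eta_square: "\<eta> ^ 2 = E f"
  by (simp add: curve_eq E_def)

definition rep :: "'l poly \<Rightarrow> 'l poly \<Rightarrow> 'f" where
  "rep p q = E p + E q * \<eta>"

lemma rep_mult: "rep p q * rep p' q' = rep (p * p' + f * q * q') (p * q' + q * p')"
proof -
  have "rep p q * rep p' q' = E p * E p' + \<eta> ^ 2 * E q * E q' + (E p * E q' + E q * E p') * \<eta>"
    by (simp add: rep_def algebra_simps power2_eq_square)
  then show ?thesis
    by (simp add: rep_def E.hom_add E.hom_mult eta_square)
qed

lemma rep_add: "rep p q + rep p' q' = rep (p + p') (q + q')"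
  by (simp add: rep_def E.hom_add algebra_simps)

lemma rep_diff: "rep p q - rep p' q' = rep (p - p') (q - q')"
  by (simp add: rep_def E.hom_diff algebra_simps)

text \<open>The degrees of \<open>p\<^sup>2\<close> and \<open>f q\<^sup>2\<close> have different
  parity, so the leading terms cannot cancel.\<close>

lemma degree_norm:
  assumes "q \<noteq> 0"
  shows "Polynomial.degree (p ^ 2 - f * q ^ 2) \<ge> 3"
proof -
  have f: "f \<noteq> 0" using degree_f by auto
  have 1: "Polynomial.degree (f * q ^ 2) = 3 + 2 * Polynomial.degree q"
    using assms f by (simp add: degree_mult_eq degree_power_eq degree_f)
  show ?thesis
  proof (cases "p = 0")
    case True
    then show ?thesis using 1 by simp
  next
    case False
    then have 2: "Polynomial.degree (p ^ 2) = 2 * Polynomial.degree p"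
      by (simp add: degree_power_eq)
    have "Polynomial.degree (p ^ 2) \<noteq> Polynomial.degree (f * q ^ 2)"
      unfolding 1 2 by presburger
    then consider "Polynomial.degree (p ^ 2) < Polynomial.degree (f * q ^ 2)"
      | "Polynomial.degree (f * q ^ 2) < Polynomial.degree (p ^ 2)"
      by linarith
    then show ?thesis
    proof cases
      case 1
      then show ?thesis
        using degree_add_eq_right[of "p ^ 2" "- (f * q ^ 2)"] \<open>Polynomial.degree (f * q ^ 2) = _\<close>
        by simp
    next
      case 2
      then show ?thesis
        using degree_add_eq_left[of "- (f * q ^ 2)" "p ^ 2"] 1 by simp
    qed
  qed
qed

lemma rep_eq_0_iff: "rep p q = 0 \<longleftrightarrow> p = 0 \<and> q = 0"
proof
  assume "rep p q = 0"
  then have "E p = - (E q * \<eta>)"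
    by (simp add: rep_def eq_neg_iff_add_eq_0)
  then have "E p ^ 2 = E q ^ 2 * \<eta> ^ 2"
    by (simp add: power_mult_distrib)
  then have "E (p ^ 2 - f * q ^ 2) = 0"
    by (simp add: E.hom_diff E.hom_mult E.hom_power eta_square)
  then have *: "p ^ 2 - f * q ^ 2 = 0"
    by (rule E.hom_inj)
  then have "q = 0"
    using degree_norm[of q p] by auto
  then show "p = 0 \<and> q = 0"
    using * by simp
qed (simp add: rep_def E.hom_zero)

lemma rep_eq_iff: "rep p q = rep p' q' \<longleftrightarrow> p = p' \<and> q = q'"
  using rep_eq_0_iff[of "p - p'" "q - q'"] by (simp flip: rep_diff)

definition S :: "'f set" where
  "S = {rep p q | p q. True}"

lemma rep_in_S: "rep p q \<in> S"
  by (auto simp: S_def)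

lemma E_rep: "E p = rep p 0" and eta_rep: "rep 0 1 = \<eta>"
  by (simp_all add: rep_def E.hom_zero E.hom_one)

sublocale subring_of_field S
proof
  show "0 \<in> S" "1 \<in> S"
    using rep_in_S[of 0 0] rep_in_S[of 1 0] by (simp_all add: rep_def E.hom_zero E.hom_one)
  fix a b assume "a \<in> S" "b \<in> S"
  then obtain p q p' q' where ab: "a = rep p q" "b = rep p' q'"
    unfolding S_def by blast
  show "a + b \<in> S" "a * b \<in> S"
    unfolding ab rep_add rep_mult by (rule rep_in_S)+
next
  fix a assume "a \<in> S"
  then obtain p q where a: "a = rep p q"
    unfolding S_def by blast
  have "- a = rep (- p) (- q)"
    by (simp add: a rep_def E.hom_minus)
  then show "- a \<in> S"
    by (simp add: rep_in_S)
qed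

lemma E_in_S: "E p \<in> S" and eta_in_S: "\<eta> \<in> S" and iota_in_S: "\<iota> c \<in> S" and xi_in_S: "\<xi> \<in> S"
  using rep_in_S[of p 0] rep_in_S[of 0 1] rep_in_S[of "[:c:]" 0] rep_in_S[of "[:0,1:]" 0]
  by (simp_all add: rep_def E.hom_zero E.hom_one E_const E_linear hom_zero hom_one)

definition coords :: "'f \<Rightarrow> 'l poly \<times> 'l poly" where
  "coords z = (THE pq. z = rep (fst pq) (snd pq))"

lemma coords_rep: "coords (rep p q) = (p, q)"
  unfolding coords_def by (rule the_equality) (auto simp: rep_eq_iff)

text \<open>The value of a function at a point with coordinates \<open>a\<close> and
  \<open>b\<close>; this is a ring homomorphism if the point lies on the curve.\<close>

definition ev :: "'l \<Rightarrow> 'l \<Rightarrow> 'f \<Rightarrow> 'l" where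
  "ev a b z = poly (fst (coords z)) a + poly (snd (coords z)) a * b"

lemma ev_rep: "ev a b (rep p q) = poly p a + poly q a * b"
  by (simp add: ev_def coords_rep)

lemma ev_E: "ev a b (E p) = poly p a" and ev_eta: "ev a b \<eta> = b"
  using ev_rep[of a b p 0] ev_rep[of a b 0 1] by (simp_all add: eta_rep flip: E_rep)

lemma ev_iota: "ev a b (\<iota> c) = c" and ev_xi: "ev a b \<xi> = a"
  using ev_E[of a b "[:c:]"] ev_E[of a b "[:0,1:]"]
  by (simp_all add: E_const E_linear hom_zero hom_one)

lemma ev_add: "z \<in> S \<Longrightarrow> w \<in> S \<Longrightarrow> ev a b (z + w) = ev a b z + ev a b w"
  by (auto simp: S_def rep_add ev_rep algebra_simps)

lemma ev_diff: "z \<in> S \<Longrightarrow> w \<in> S \<Longrightarrow> ev a b (z - w) = ev a b z - ev a b w"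
  by (auto simp: S_def rep_diff ev_rep algebra_simps)

lemma ev_mult:
  assumes "b ^ 2 = poly f a" "z \<in> S" "w \<in> S"
  shows "ev a b (z * w) = ev a b z * ev a b w"
proof -
  obtain p q p' q' where zw: "z = rep p q" "w = rep p' q'"
    using assms unfolding S_def by blast
  have "ev a b (z * w) = poly p a * poly p' a + b ^ 2 * poly q a * poly q' a
      + (poly p a * poly q' a + poly q a * poly p' a) * b"
    by (simp add: zw rep_mult ev_rep assms(1))
  then show ?thesis
    by (simp add: zw ev_rep algebra_simps power2_eq_square)
qed

text \<open>Conjugation \<open>y \<mapsto> - y\<close> of the coordinate ring, the counterpart of
  the negation of points.\<close>

definition cj :: "'f \<Rightarrow> 'f" where
  "cj z = rep (fst (coords z)) (- snd (coords z))"

lemma cj_rep: "cj (rep p q) = rep p (- q)"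
  by (simp add: cj_def coords_rep)

lemma cj_in_S: "cj z \<in> S"
  by (simp add: cj_def rep_in_S)

lemma cj_cj: "z \<in> S \<Longrightarrow> cj (cj z) = z"
  by (auto simp: S_def cj_rep)

lemma cj_add: "z \<in> S \<Longrightarrow> w \<in> S \<Longrightarrow> cj (z + w) = cj z + cj w"
  by (auto simp: S_def cj_rep rep_add)

lemma cj_mult: "z \<in> S \<Longrightarrow> w \<in> S \<Longrightarrow> cj (z * w) = cj z * cj w"
  by (auto simp: S_def cj_rep rep_mult algebra_simps)

lemma rep_times_cj: "rep p q * cj (rep p q) = E (p ^ 2 - f * q ^ 2)"
  unfolding cj_rep rep_mult E_rep by (simp add: power2_eq_square algebra_simps)

section \<open>The ideal of a point\<close>

text \<open>Generators of the ideal of functions that vanish at a point. The point at infinity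
  imposes no condition on functions on the affine curve, so it gets the unit ideal.\<close>

fun gens :: "'l point \<Rightarrow> 'f set" where
  "gens Infinity = 1"
| "gens (Affine a b) = {\<xi> - \<iota> a, \<eta> - \<iota> b}"

fun neg :: "'l point \<Rightarrow> 'l point" where
  "neg Infinity = Infinity"
| "neg (Affine a b) = Affine a (- b)"

lemma Affine_points_iff: "Affine a b \<in> points f \<longleftrightarrow> b ^ 2 = poly f a"
  by (auto simp: points_def)

lemma neg_points: "P \<in> points f \<Longrightarrow> neg P \<in> points f"
  by (cases P) (auto simp: points_def)

lemma gens_subset_S: "gens P \<subseteq> S"
  by (cases P) (auto intro: S_one S_diff xi_in_S eta_in_S iota_in_S)

lemma pair_times_pair: "{p, q} * {r, s} = {p * r, p * s, q * r, q * s :: 'f}"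
  by (auto simp: set_times_def)

lemma poly_split_root: "\<exists>r. p = [:poly p a:] + [:- a, 1:] * r" for p :: "'l poly"
proof -
  have "[:- a, 1:] dvd p - [:poly p a:]"
    by (simp flip: poly_eq_0_iff_dvd)
  then obtain r where "p - [:poly p a:] = [:- a, 1:] * r"
    by (elim dvdE)
  then show ?thesis
    by (intro exI[of _ r]) (simp add: algebra_simps)
qed

lemma span_iota_cancel:
  assumes "\<iota> c * z \<in> ideal_span M" "c \<noteq> 0"
  shows "z \<in> ideal_span M"
proof -
  have "\<iota> (inverse c) * (\<iota> c * z) = z"
    using assms(2) by (simp add: hom_inverse hom_0_iff)
  then show ?thesis
    using span_smult[OF assms(1) iota_in_S[of "inverse c"]] by metis
qed

text \<open>The product contains the vertical line \<open>x - a\<close>. If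
  \<open>b \<noteq> 0\<close>, the difference of the two mixed products of generators is
  \<open>2 b (x - a)\<close>. If \<open>b = 0\<close>, then
  \<open>y\<^sup>2 = (x - a) q(x)\<close> with \<open>q(a) = f'(a) \<noteq> 0\<close>, so
  \<open>x - a\<close> is a combination of \<open>y\<^sup>2\<close> and
  \<open>(x - a)\<^sup>2\<close>.\<close>

lemma gens_times_neg:
  assumes "b ^ 2 = poly f a"
  shows "ideal_span (gens (Affine a b) * gens (Affine a (- b))) = ideal_span {\<xi> - \<iota> a}"
    (is "ideal_span ?M = _")
proof (rule span_eqI)
  obtain q where q: "f = [:poly f a:] + [:- a, 1:] * q"
    using poly_split_root by blast
  define t where "t = \<xi> - \<iota> a"
  have M: "?M = {t * t, t * (\<eta> + \<iota> b), (\<eta> - \<iota> b) * t, (\<eta> - \<iota> b) * (\<eta> + \<iota> b)}"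
    by (simp only: gens.simps pair_times_pair t_def hom_minus diff_minus_eq_add)
  have "(\<eta> - \<iota> b) * (\<eta> + \<iota> b) = E f - \<iota> (b ^ 2)"
    by (simp add: algebra_simps hom_power flip: eta_square power2_eq_square)
  also have "\<dots> = t * E q"
    by (simp add: E_split[OF q] assms t_def)
  finally have eq: "(\<eta> - \<iota> b) * (\<eta> + \<iota> b) = t * E q" .
  have S: "t \<in> S" "\<eta> + \<iota> b \<in> S" "\<eta> - \<iota> b \<in> S"
    by (simp_all add: t_def S_diff S_add xi_in_S eta_in_S iota_in_S)
  show "?M \<subseteq> ideal_span {\<xi> - \<iota> a}"
    unfolding M eq t_def[symmetric]
    using S E_in_S by (auto intro: span_smult span_smult' span_base)
  have "t \<in> ideal_span ?M"
  proof (cases "b = 0")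
    case False
    have "t * (\<eta> + \<iota> b) - (\<eta> - \<iota> b) * t \<in> ideal_span ?M"
      unfolding M by (intro span_diff span_base) auto
    also have "t * (\<eta> + \<iota> b) - (\<eta> - \<iota> b) * t = \<iota> (2 * b) * t"
      by (simp add: algebra_simps hom_mult hom_numeral)
    finally show ?thesis
      by (rule span_iota_cancel) (use False two_neq_0 in simp)
  next
    case True
    then have fa: "poly f a = 0"
      using assms by simp
    have "poly (pderiv f) a = poly q a"
      using arg_cong[OF q, of "\<lambda>p. poly (pderiv p) a"]
      by (simp only: fa pderiv_mult pderiv_add) (simp add: pderiv_pCons)
    then have qa: "poly q a \<noteq> 0"
      using nonsingular[OF fa] by simp
    obtain r where r: "q = [:poly q a:] + [:- a, 1:] * r"
      using poly_split_root by blast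
    have "t * E q - E r * (t * t) \<in> ideal_span ?M"
      unfolding M eq using E_in_S by (intro span_diff span_base span_smult) auto
    also have "t * E q - E r * (t * t) = \<iota> (poly q a) * t"
      by (simp add: E_split[OF r] t_def algebra_simps)
    finally show ?thesis
      by (rule span_iota_cancel) (use qa in simp)
  qed
  then show "{\<xi> - \<iota> a} \<subseteq> ideal_span ?M"
    by (simp add: t_def)
qed

text \<open>Expanding a function around the point writes it as a combination of the two generators
  plus its value.\<close>

lemma mem_ideal_iff:
  assumes "b ^ 2 = poly f a"
  shows "z \<in> ideal_span (gens (Affine a b)) \<longleftrightarrow> z \<in> S \<and> ev a b z = 0"
proof
  assume z: "z \<in> ideal_span (gens (Affine a b))"
  then have "z \<in> S"
    using span_subset_S[OF gens_subset_S] by blast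
  moreover from z have "ev a b z = 0"
  proof (induction rule: span_induct)
    case zero
    then show ?case using ev_iota[of a b 0] by (simp add: hom_zero)
  next
    case (step s w z)
    then have "w \<in> S" "z \<in> S"
      using gens_subset_S span_subset_S[OF gens_subset_S] by blast+
    moreover have "ev a b w = 0"
      using \<open>w \<in> gens _\<close> by (auto simp: ev_diff xi_in_S eta_in_S iota_in_S ev_xi ev_eta ev_iota)
    ultimately show ?case
      using step assms by (simp add: ev_add S_mult ev_mult)
  qed
  ultimately show "z \<in> S \<and> ev a b z = 0" ..
next
  assume z: "z \<in> S \<and> ev a b z = 0"
  then obtain p q where pq: "z = rep p q"
    unfolding S_def by blast
  obtain p' q' where r: "p = [:poly p a:] + [:- a, 1:] * p'" "q = [:poly q a:] + [:- a, 1:] * q'"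
    using poly_split_root by meson
  have pa: "poly p a = - (poly q a * b)"
    using z by (simp add: pq ev_rep eq_neg_iff_add_eq_0)
  have "E p = \<iota> (poly p a) + (\<xi> - \<iota> a) * E p'" "E q = \<iota> (poly q a) + (\<xi> - \<iota> a) * E q'"
    by (rule E_split[OF r(1)], rule E_split[OF r(2)])
  then have "z = (\<iota> (poly p a) + (\<xi> - \<iota> a) * E p') + (\<iota> (poly q a) + (\<xi> - \<iota> a) * E q') * \<eta>"
    by (simp only: pq rep_def)
  then have "z = rep p' q' * (\<xi> - \<iota> a) + \<iota> (poly q a) * (\<eta> - \<iota> b)"
    by (simp add: rep_def algebra_simps pa hom_minus hom_mult)
  then show "z \<in> ideal_span (gens (Affine a b))"
    by (simp add: span_add span_smult rep_in_S iota_in_S span_base)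
qed

lemma ideal_span_one: "ideal_span 1 = S"
  using span_singleton[of _ 1] by auto

text \<open>On the graph of \<open>l\<close>, the ideal of a point with abscissa \<open>a\<close>
  is generated by \<open>x - a\<close> and \<open>y - l(x)\<close>.\<close>

lemma graph_ideal_subset:
  "ideal_span (\<Prod>a\<in>#A. gens (Affine a (poly l a)))
    \<subseteq> ideal_span {E (\<Prod>a\<in>#A. [:- a, 1:]), \<eta> - E l}"
proof (induction A)
  case empty
  show ?case
    by (rule span_mono) (simp add: E.hom_one)
next
  case (add a A)
  define h where "h = \<eta> - E l"
  define m where "m = E (\<Prod>a\<in>#A. [:- a, 1:])"
  have S: "h \<in> S" "m \<in> S" "\<xi> - \<iota> a \<in> S"
    by (simp_all add: h_def m_def S_diff eta_in_S xi_in_S iota_in_S E_in_S)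
  obtain r where "l = [:poly l a:] + [:- a, 1:] * r"
    using poly_split_root by blast
  then have "E l = \<iota> (poly l a) + (\<xi> - \<iota> a) * E r"
    by (rule E_split)
  then have "\<eta> - \<iota> (poly l a) = h + E r * (\<xi> - \<iota> a)"
    by (simp add: h_def algebra_simps)
  then have "ideal_span (gens (Affine a (poly l a))) \<subseteq> ideal_span {\<xi> - \<iota> a, h}"
    by (intro span_least) (simp add: span_base span_add span_smult E_in_S)
  from span_times_mono[OF this add.IH]
  have "ideal_span (\<Prod>a\<in>#add_mset a A. gens (Affine a (poly l a)))
      \<subseteq> ideal_span ({\<xi> - \<iota> a, h} * {m, h})"
    by (simp add: h_def m_def)
  also have "\<dots> \<subseteq> ideal_span {(\<xi> - \<iota> a) * m, h}"
    unfolding pair_times_pair using S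
    by (intro span_least) (auto intro: span_smult span_smult' span_base)
  also have "(\<xi> - \<iota> a) * m = E (\<Prod>a\<in>#add_mset a A. [:- a, 1:])"
    by (simp only: m_def image_mset_add_mset prod_mset.add_mset E.hom_mult E_root)
  finally show ?case
    by (simp only: h_def)
qed

text \<open>The intersection of the curve with the graph of a polynomial \<open>l\<close> is the
  divisor of \<open>y - l(x)\<close>. The product of the ideals is contained in the principal
  ideal, and the same holds for the conjugates. The product of both products is generated by
  \<open>f - l\<^sup>2\<close>, the norm of \<open>y - l(x)\<close> up to sign, which leaves no
  room for a proper inclusion. This lemma is used for the lines of the group law and for the
  function \<open>u\<close>.\<close>

lemma graph_principal:
  assumes c: "c \<noteq> 0" and fl: "f - l ^ 2 = smult c (\<Prod>a\<in>#A. [:- a, 1:])"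
  shows "ideal_span (\<Prod>a\<in>#A. gens (Affine a (poly l a))) = ideal_span {\<eta> - E l}"
proof -
  define P where "P = (\<Prod>a\<in>#A. [:- a, 1:])"
  define M where "M = (\<lambda>l. \<Prod>a\<in>#A. gens (Affine a (poly l a)))"
  have sub: "ideal_span (M l') \<subseteq> ideal_span {\<eta> - E l'}" if "l' = l \<or> l' = - l" for l'
  proof -
    have "f - l' ^ 2 = smult c P"
      using fl that by (auto simp: P_def)
    then have "\<iota> c * E P = \<eta> ^ 2 - E l' ^ 2"
      by (metis E_smult E.hom_diff E.hom_power eta_square)
    also have "\<dots> = (\<eta> + E l') * (\<eta> - E l')"
      by (simp add: algebra_simps power2_eq_square)
    also have "\<dots> \<in> ideal_span {\<eta> - E l'}"
      by (simp add: span_smult S_add eta_in_S E_in_S span_base)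
    finally have "E P \<in> ideal_span {\<eta> - E l'}"
      using c by (rule span_iota_cancel)
    then have "ideal_span {E P, \<eta> - E l'} \<subseteq> ideal_span {\<eta> - E l'}"
      by (intro span_least) (auto intro: span_base)
    with graph_ideal_subset[of l' A] show ?thesis
      by (simp add: P_def M_def)
  qed
  have on_curve: "poly l a ^ 2 = poly f a" if "a \<in># A" for a
  proof -
    have "[:- a, 1:] dvd P"
      unfolding P_def using that by (intro dvd_prod_mset) auto
    then have "poly P a = 0"
      by (simp add: poly_eq_0_iff_dvd)
    then have "poly (f - l ^ 2) a = 0"
      by (simp add: fl P_def)
    then show ?thesis by simp
  qed
  define h where "h = \<eta> - E l"
  define h' where "h' = \<eta> - E (- l)"
  have h0: "h \<noteq> 0" "h' \<noteq> 0"
    using rep_eq_0_iff[of "- l" 1] rep_eq_0_iff[of l 1]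
    by (auto simp: h_def h'_def rep_def E.hom_minus E.hom_one add.commute)
  have "M l * M (- l) = (\<Prod>a\<in>#A. gens (Affine a (poly l a)) * gens (Affine a (- poly l a)))"
    by (simp add: M_def prod_mset.distrib)
  also have "ideal_span \<dots> = ideal_span (\<Prod>a\<in>#A. {\<xi> - \<iota> a})"
    using on_curve by (intro span_prod_mset_cong gens_times_neg) auto
  also have "(\<Prod>a\<in>#A. {\<xi> - \<iota> a}) = {E P}"
    unfolding P_def
    by (induction A) (simp_all only: image_mset_empty prod_mset.empty image_mset_add_mset
        prod_mset.add_mset E.hom_one E.hom_mult E_root singleton_times set_one)
  finally have MM: "ideal_span (M l * M (- l)) = ideal_span {E P}" .
  have "\<iota> c * E P = h * h'"
    using fl by (metis (no_types, lifting) E.hom_diff E.hom_minus E.hom_power E_smult P_def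
        eta_square h_def h'_def diff_minus_eq_add power2_eq_square square_diff_square_factored
        mult.commute)
  then have "h * h' \<in> ideal_span {E P}"
    using span_smult[OF span_base[of "E P" "{E P}"] iota_in_S[of c]] by simp
  then have hh: "h * h' \<in> ideal_span (M l * M (- l))"
    by (simp add: MM)
  have "ideal_span (M l * M (- l)) \<subseteq> ideal_span (M l * {h'})"
    using sub[of "- l"] by (intro span_times_mono) (auto simp: h'_def)
  with hh have "h * h' \<in> ideal_span ({h'} * M l)"
    by (auto simp: mult.commute)
  then obtain w where "w \<in> ideal_span (M l)" "h * h' = h' * w"
    by (auto simp: span_scale)
  then have "h \<in> ideal_span (M l)"
    using h0 by simp
  then show ?thesis
    using sub[of l] span_least[of "{h}" "M l"] by (auto simp: h_def M_def)
qed

end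

section \<open>The group law\<close>

(* The unit ideal stays in the form 1, which cancels in products. *)
declare set_one [simp del]

lemma cubic_eq_coeffs:
  fixes f :: "'a::comm_ring_1 poly"
  assumes "Polynomial.degree f = 3"
  shows "f = [:Polynomial.coeff f 0, Polynomial.coeff f 1, Polynomial.coeff f 2, Polynomial.coeff f 3:]"
proof (rule poly_eqI)
  fix n :: nat
  consider "n = 0" | "n = 1" | "n = 2" | "n = 3" | "n > 3"
    by linarith
  then show "Polynomial.coeff f n = Polynomial.coeff [:Polynomial.coeff f 0, Polynomial.coeff f 1,
      Polynomial.coeff f 2, Polynomial.coeff f 3:] n"
    by cases (use assms in \<open>simp_all add: coeff_eq_0 coeff_pCons numeral_2_eq_2 numeral_3_eq_3 split: nat.split\<close>)
qed

text \<open>The chord, or the tangent if the points coincide, meets the cubic at the abscissas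
  \<open>x1\<close>, \<open>x2\<close> and \<open>x3\<close>. Two equations determine the
  coefficients in both cases: the value at \<open>x1\<close>, and the divided difference at
  \<open>x1\<close> and \<open>x2\<close>, which for \<open>x1 = x2\<close> is the
  derivative.\<close>

lemma chord_identity:
  fixes f :: "'a::field poly"
  assumes deg: "Polynomial.degree f = 3" and two: "(2::'a) \<noteq> 0"
    and on_curve: "y1 ^ 2 = poly f x1" "y2 ^ 2 = poly f x2"
    and not_opposite: "\<not> (x1 = x2 \<and> y1 = - y2)"
    and l: "l = (if x1 = x2 then poly (pderiv f) x1 / (2 * y1) else (y2 - y1) / (x2 - x1))"
    and x3: "x3 = (l ^ 2 - Polynomial.coeff f 2) / Polynomial.coeff f 3 - x1 - x2"
  shows "y1 + l * (x2 - x1) = y2"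
    and "f - [:y1 - l * x1, l:] ^ 2
       = smult (Polynomial.coeff f 3) (\<Prod>a\<in>#{#x1, x2, x3#}. [:- a, 1:])"
proof -
  obtain d0 d1 d2 d3 where f: "f = [:d0, d1, d2, d3:]"
    using cubic_eq_coeffs[OF deg] by blast
  have d3: "d3 \<noteq> 0"
    using deg unfolding f by (auto split: if_splits)
  have c: "Polynomial.coeff f 2 = d2" "Polynomial.coeff f 3 = d3"
    by (simp_all add: f numeral_2_eq_2 numeral_3_eq_3)
  define m where "m = y1 - l * x1"
  have y12: "y1 = y2" if "x1 = x2"
  proof -
    have "(y1 - y2) * (y1 + y2) = 0"
      using on_curve that by (simp add: algebra_simps power2_eq_square)
    then show ?thesis
      using not_opposite that by (auto simp: eq_neg_iff_add_eq_0)
  qed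
  show y2: "y1 + l * (x2 - x1) = y2"
    using y12 by (cases "x1 = x2") (simp_all add: l)
  have g1: "d0 - m ^ 2 + (d1 - 2 * l * m) * x1 + (d2 - l ^ 2) * x1 ^ 2 + d3 * x1 ^ 3 = 0"
    using on_curve(1) by (simp add: f m_def algebra_simps power2_eq_square power3_eq_cube)
  have e1: "(d1 - 2 * l * m) + (d2 - l ^ 2) * (x1 + x2) + d3 * (x1 ^ 2 + x1 * x2 + x2 ^ 2) = 0"
  proof (cases "x1 = x2")
    case True
    then have "y1 \<noteq> 0"
      using not_opposite y12 by auto
    then have "2 * l * y1 = poly (pderiv f) x1"
      using True two by (simp add: l)
    then show ?thesis
      using True by (simp add: f m_def pderiv_pCons algebra_simps power2_eq_square)
  next
    case False
    have "y2 = m + l * x2"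
      using y2 by (simp add: m_def algebra_simps)
    then have g2: "d0 - m ^ 2 + (d1 - 2 * l * m) * x2 + (d2 - l ^ 2) * x2 ^ 2 + d3 * x2 ^ 3 = 0"
      using on_curve(2) by (simp add: f algebra_simps power2_eq_square power3_eq_cube)
    have "(x2 - x1) * ((d1 - 2 * l * m) + (d2 - l ^ 2) * (x1 + x2)
        + d3 * (x1 ^ 2 + x1 * x2 + x2 ^ 2))
      = (d0 - m ^ 2 + (d1 - 2 * l * m) * x2 + (d2 - l ^ 2) * x2 ^ 2 + d3 * x2 ^ 3)
      - (d0 - m ^ 2 + (d1 - 2 * l * m) * x1 + (d2 - l ^ 2) * x1 ^ 2 + d3 * x1 ^ 3)"
      by (simp add: algebra_simps power2_eq_square power3_eq_cube)
    then show ?thesis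
      using g1 g2 False by simp
  qed
  have x3': "d3 * x3 = - (d2 - l ^ 2) - d3 * x1 - d3 * x2"
    using d3 by (simp add: x3 c field_simps)
  have "(d1 - 2 * l * m) - (d3 * x1 * x2 + (x1 + x2) * (- (d2 - l ^ 2) - d3 * x1 - d3 * x2))
      = (d1 - 2 * l * m) + (d2 - l ^ 2) * (x1 + x2) + d3 * (x1 ^ 2 + x1 * x2 + x2 ^ 2)"
    by (simp add: algebra_simps power2_eq_square)
  then have E1: "d1 - 2 * l * m = d3 * x1 * x2 + (x1 + x2) * (d3 * x3)"
    unfolding x3' e1 by simp
  have "(d0 - m ^ 2) - - (x1 * x2 * (- (d2 - l ^ 2) - d3 * x1 - d3 * x2))
      = (d0 - m ^ 2 + (d1 - 2 * l * m) * x1 + (d2 - l ^ 2) * x1 ^ 2 + d3 * x1 ^ 3)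
      - x1 * ((d1 - 2 * l * m) + (d2 - l ^ 2) * (x1 + x2) + d3 * (x1 ^ 2 + x1 * x2 + x2 ^ 2))"
    by (simp add: algebra_simps power2_eq_square power3_eq_cube)
  then have E0: "d0 - m ^ 2 = - (x1 * x2 * (d3 * x3))"
    unfolding x3' e1 g1 by (simp only: mult_zero_right diff_zero right_minus_eq)
  have E2: "d2 - l ^ 2 = - (d3 * x1) - d3 * x2 - d3 * x3"
    unfolding x3' by simp
  have "f - [:m, l:] ^ 2 = [:d0 - m ^ 2, d1 - 2 * l * m, d2 - l ^ 2, d3:]"
    by (simp add: f power2_eq_square algebra_simps)
  also have "\<dots> = smult d3 ([:- x1, 1:] * ([:- x2, 1:] * [:- x3, 1:]))"
    unfolding E0 E1 E2 by (simp add: algebra_simps)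
  finally show "f - [:y1 - l * x1, l:] ^ 2
       = smult (Polynomial.coeff f 3) (\<Prod>a\<in>#{#x1, x2, x3#}. [:- a, 1:])"
    by (simp add: c m_def mult.assoc)
qed

context cubic_curve
begin

definition cj_maps :: "'f set \<Rightarrow> 'f set \<Rightarrow> bool" where
  "cj_maps V V' \<longleftrightarrow> V \<subseteq> S \<and> (\<forall>z\<in>ideal_span V. cj z \<in> ideal_span V')"

lemma cj_mapsI:
  assumes "V \<subseteq> S" "\<And>v. v \<in> V \<Longrightarrow> cj v \<in> ideal_span V'"
  shows "cj_maps V V'"
  unfolding cj_maps_def
proof (intro conjI ballI)
  fix z assume "z \<in> ideal_span V"
  then show "cj z \<in> ideal_span V'"
  proof (induction rule: span_induct)
    case zero
    have "cj 0 = 0"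
      using cj_rep[of 0 0] by (simp add: rep_def E.hom_zero)
    then show ?case by (simp add: span_zero)
  next
    case (step s a z)
    then have "a \<in> S" "z \<in> S"
      using assms(1) span_subset_S by blast+
    then show ?case
      using step assms by (auto simp: cj_add cj_mult S_mult intro!: span_add span_smult cj_in_S)
  qed
qed fact

lemma cj_maps_times:
  assumes "cj_maps V V'" "cj_maps W W'"
  shows "cj_maps (V * W) (V' * W')"
proof (rule cj_mapsI)
  show "V * W \<subseteq> S"
    using assms by (auto simp: cj_maps_def set_times_def intro: S_mult)
  fix z assume "z \<in> V * W"
  then obtain a b where ab: "z = a * b" "a \<in> V" "b \<in> W"
    by (auto simp: set_times_def)
  then have "a \<in> S" "b \<in> S"
    using assms by (auto simp: cj_maps_def)
  then show "cj z \<in> ideal_span (V' * W')"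
    using assms ab by (simp add: cj_maps_def cj_mult span_mult span_base)
qed

lemma ev_cj: "z \<in> S \<Longrightarrow> ev a (- b) (cj z) = ev a b z"
  by (auto simp: S_def cj_rep ev_rep)

lemma cj_maps_points:
  assumes "\<And>z. z \<in># A \<Longrightarrow> snd z ^ 2 = poly f (fst z)"
  shows "cj_maps (\<Prod>z\<in>#A. gens (Affine (fst z) (snd z))) (\<Prod>z\<in>#A. gens (Affine (fst z) (- snd z)))"
  using assms
proof (induction A)
  case empty
  show ?case
    by (rule cj_mapsI) (auto simp: set_one S_one ideal_span_one[unfolded set_one] cj_in_S)
next
  case (add z A)
  have "cj_maps (gens (Affine (fst z) (snd z))) (gens (Affine (fst z) (- snd z)))"
    using add.prems[of z] gens_subset_S[of "Affine (fst z) (snd z)"]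
    by (auto simp: cj_maps_def mem_ideal_iff ev_cj cj_in_S simp del: gens.simps)
  with add show ?case
    by (auto intro!: cj_maps_times simp del: gens.simps)
qed

text \<open>The product of the ideal with its conjugate is generated both by the norm of the
  generator and by the product of the vertical lines through the points.\<close>

lemma norm_of_generator:
  assumes on_curve: "\<And>z. z \<in># A \<Longrightarrow> snd z ^ 2 = poly f (fst z)"
    and gen: "ideal_span (\<Prod>z\<in>#A. gens (Affine (fst z) (snd z))) = ideal_span {rep p q}"
  shows "\<exists>c. c \<noteq> 0 \<and> p ^ 2 - f * q ^ 2 = smult c (\<Prod>z\<in>#A. [:- fst z, 1:])"
proof -
  let ?M = "\<Prod>z\<in>#A. gens (Affine (fst z) (snd z))"
  let ?M' = "\<Prod>z\<in>#A. gens (Affine (fst z) (- snd z))"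
  define P where "P = (\<Prod>z\<in>#A. [:- fst z, 1:])"
  define h where "h = rep p q"
  have hS: "h \<in> S" by (simp add: h_def rep_in_S)
  have m: "cj_maps ?M ?M'"
    using on_curve by (rule cj_maps_points)
  have "snd z ^ 2 = poly f (fst z)" if "z \<in># image_mset (\<lambda>z. (fst z, - snd z)) A" for z
    using that on_curve by fastforce
  from cj_maps_points[of "image_mset (\<lambda>z. (fst z, - snd z)) A", OF this] have m': "cj_maps ?M' ?M"
    by (simp add: multiset.map_comp comp_def del: gens.simps)
  have "ideal_span ?M' = ideal_span {cj h}"
  proof
    show "ideal_span {cj h} \<subseteq> ideal_span ?M'"
      using m span_base[of h "{h}"] gen by (intro span_least) (auto simp: cj_maps_def h_def)
    show "ideal_span ?M' \<subseteq> ideal_span {cj h}"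
    proof
      fix z assume z: "z \<in> ideal_span ?M'"
      then have "cj z \<in> ideal_span {h}"
        using m' gen by (simp add: cj_maps_def h_def)
      then obtain s where s: "s \<in> S" "cj z = h * s"
        by (auto simp: span_singleton)
      have "z \<in> S"
        using z m' span_subset_S by (auto simp: cj_maps_def)
      then have "z = cj h * cj s"
        using s hS cj_cj by (metis cj_mult)
      then show "z \<in> ideal_span {cj h}"
        by (auto simp: span_singleton cj_in_S)
    qed
  qed
  with gen have "ideal_span (?M * ?M') = ideal_span ({h} * {cj h})"
    by (intro span_times_cong) (simp_all add: h_def)
  also have "{h} * {cj h} = {E (p ^ 2 - f * q ^ 2)}"
    by (simp add: h_def singleton_times rep_times_cj)
  finally have 1: "ideal_span (?M * ?M') = ideal_span {E (p ^ 2 - f * q ^ 2)}" .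
  have "?M * ?M' = (\<Prod>z\<in>#A. gens (Affine (fst z) (snd z)) * gens (Affine (fst z) (- snd z)))"
    by (simp add: prod_mset.distrib)
  also have "ideal_span \<dots> = ideal_span (\<Prod>z\<in>#A. {\<xi> - \<iota> (fst z)})"
    using on_curve by (intro span_prod_mset_cong gens_times_neg) auto
  also have "(\<Prod>z\<in>#A. {\<xi> - \<iota> (fst z)}) = {E P}"
    unfolding P_def
    by (induction A) (simp_all only: image_mset_empty prod_mset.empty image_mset_add_mset
        prod_mset.add_mset E.hom_one E.hom_mult E_root singleton_times set_one)
  finally have 2: "ideal_span {E P} = ideal_span {E (p ^ 2 - f * q ^ 2)}"
    using 1 by simp
  have dvd: "m dvd n" if "ideal_span {E n} \<subseteq> ideal_span {E m}" for m n
  proof -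
    have "E n \<in> ideal_span {E m}"
      using that span_base[of "E n" "{E n}"] by auto
    then obtain w where w: "w \<in> S" "E n = E m * w"
      by (auto simp: span_singleton)
    from w(1) obtain a b where "w = rep a b"
      unfolding S_def by blast
    with w(2) have "rep n 0 = rep (m * a) (m * b)"
      by (simp add: rep_def E.hom_mult E.hom_zero algebra_simps)
    then show ?thesis
      by (simp add: rep_eq_iff)
  qed
  have P0: "P \<noteq> 0"
    unfolding P_def by (auto simp: prod_mset_zero_iff)
  from dvd 2 have "P dvd p ^ 2 - f * q ^ 2" "p ^ 2 - f * q ^ 2 dvd P"
    by auto
  then obtain r r' where r: "p ^ 2 - f * q ^ 2 = P * r" "P = (p ^ 2 - f * q ^ 2) * r'"
    by (elim dvdE)
  then have "P * (r * r') = P * 1"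
    by (simp only: mult.assoc[symmetric] mult_1_right)
  then have "r * r' = 1"
    using P0 unfolding mult_cancel_left by blast
  then have "is_unit r"
    by (metis dvd_triv_left)
  then obtain c where "r = [:c:]" "c \<noteq> 0"
    by (force simp: is_unit_poly_iff)
  then show ?thesis
    using r by (intro exI[of _ c]) (simp add: P_def)
qed

text \<open>The norm of a generator would have degree one, but norms have even degree or degree at
  least three.\<close>

lemma point_ideal_not_principal:
  assumes "b ^ 2 = poly f a"
  shows "ideal_span (gens (Affine a b)) \<noteq> ideal_span {h}"
proof
  assume *: "ideal_span (gens (Affine a b)) = ideal_span {h}"
  then have "h \<in> S"
    using span_base[of h "{h}"] mem_ideal_iff[OF assms] by blast
  then obtain p q where h: "h = rep p q"
    unfolding S_def by blast
  have "\<exists>c. c \<noteq> 0 \<and> p ^ 2 - f * q ^ 2 = smult c (\<Prod>z\<in>#{#(a, b)#}. [:- fst z, 1:])"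
    by (rule norm_of_generator) (use assms * h in simp_all)
  then obtain c where c: "c \<noteq> 0" "p ^ 2 - f * q ^ 2 = smult c [:- a, 1:]"
    by auto
  then have deg: "Polynomial.degree (p ^ 2 - f * q ^ 2) = 1"
    by simp
  then have "q = 0"
    using degree_norm[of q p] by fastforce
  then have "2 * Polynomial.degree p = 1"
    using deg by (cases "p = 0") (auto simp: degree_power_eq)
  then show False by presburger
qed

text \<open>The norm of a generator has degree two, so the generator is a vertical line up to a
  constant, and both points lie on it. If they were equal, cancelling the ideal of the point would
  identify it with the ideal of the opposite point, so the point would be its own
  opposite.\<close>

lemma two_point_ideal_principal:
  assumes on_curve: "b ^ 2 = poly f a" "b' ^ 2 = poly f a'"
    and gen: "ideal_span (gens (Affine a b) * gens (Affine a' b')) = ideal_span {h}"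
  shows "a' = a \<and> b' = - b"
proof -
  have "h \<in> ideal_span (gens (Affine a b) * gens (Affine a' b'))"
    using gen span_base by auto
  also have "\<dots> \<subseteq> S"
    by (rule span_subset_S) (use gens_subset_S S_mult in \<open>force simp: set_times_def simp del: gens.simps\<close>)
  finally obtain p q where h: "h = rep p q"
    unfolding S_def by blast
  have "\<exists>c. c \<noteq> 0 \<and> p ^ 2 - f * q ^ 2 = smult c (\<Prod>z\<in>#{#(a, b), (a', b')#}. [:- fst z, 1:])"
    by (rule norm_of_generator) (use assms gen h in auto)
  then obtain c where c: "c \<noteq> 0" "p ^ 2 - f * q ^ 2 = smult c ([:- a, 1:] * [:- a', 1:])"
    by auto
  then have deg: "Polynomial.degree (p ^ 2 - f * q ^ 2) = 2"
    by simp
  then have q: "q = 0"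
    using degree_norm[of q p] by fastforce
  then have "2 * Polynomial.degree p = 2"
    using deg by (cases "p = 0") (auto simp: degree_power_eq)
  then have "Polynomial.degree p = 1"
    by simp
  moreover obtain u p' where p': "p = pCons u p'"
    by (cases p)
  ultimately have "Polynomial.degree p' = 0" "p' \<noteq> 0"
    by (auto split: if_splits)
  then obtain v where p: "p = [:u, v:]" "v \<noteq> 0"
    using p' by (metis degree_eq_zeroE pCons_0_0)
  define e where "e = - u / v"
  have pe: "p = smult v [:- e, 1:]"
    using p by (simp add: e_def)
  have eq: "p ^ 2 = smult c ([:- a, 1:] * [:- a', 1:])"
    using c q by simp
  have "poly (p ^ 2) a = 0" "poly (p ^ 2) a' = 0"
    by (simp_all only: eq poly_smult poly_mult) simp_all
  then have a: "a = e" "a' = e"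
    using p by (simp_all add: pe)
  show ?thesis
  proof (cases "b' = - b")
    case False
    have "(b' - b) * (b' + b) = 0"
      using on_curve a by (simp add: algebra_simps power2_eq_square)
    then have b: "b' = b"
      using False by (simp add: eq_neg_iff_add_eq_0)
    have "h = \<iota> v * (\<xi> - \<iota> a)"
      by (simp add: h q rep_def E.hom_zero pe E_smult E_root a del: smult_pCons)
    then have "ideal_span {h} = ideal_span {\<xi> - \<iota> a}"
      using p(2) by (intro span_eqI) (auto intro!: span_iota_cancel[of v "\<xi> - \<iota> a"] 
          simp: span_base span_smult iota_in_S)
    then have "ideal_span (gens (Affine a b) * gens (Affine a b))
        = ideal_span (gens (Affine a b) * gens (Affine a (- b)))"
      using gen b a gens_times_neg[OF on_curve(1)] by simp
    then have "ideal_span (gens (Affine a (- b)) * (gens (Affine a b) * gens (Affine a b)))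
        = ideal_span (gens (Affine a (- b)) * (gens (Affine a b) * gens (Affine a (- b))))"
      by (rule span_times_cong[OF refl])
    then have *: "ideal_span ((gens (Affine a b) * gens (Affine a (- b))) * gens (Affine a b))
        = ideal_span ((gens (Affine a b) * gens (Affine a (- b))) * gens (Affine a (- b)))"
      by (simp only: ac_simps)
    have **: "ideal_span ((gens (Affine a b) * gens (Affine a (- b))) * V) = ideal_span ({\<xi> - \<iota> a} * V)" for V
      by (rule span_times_cong[OF gens_times_neg[OF on_curve(1)] refl])
    have "\<xi> - \<iota> a \<noteq> 0"
      using E.hom_0_iff[of "[:- a, 1:]"] by (simp add: E_root)
    from span_scale_cancel[OF this equalityD2[OF *[unfolded **]]]
    have "ideal_span (gens (Affine a (- b))) \<subseteq> ideal_span (gens (Affine a b))" .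
    moreover have "\<eta> - \<iota> (- b) \<in> ideal_span (gens (Affine a (- b)))"
      by (rule span_base) simp
    ultimately have "\<eta> - \<iota> (- b) \<in> ideal_span (gens (Affine a b))"
      by blast
    then have "ev a b (\<eta> - \<iota> (- b)) = 0"
      by (simp only: mem_ideal_iff[OF on_curve(1)])
    then have "2 * b = 0"
      by (simp add: ev_diff eta_in_S iota_in_S ev_eta ev_iota)
    then have "b = 0"
      using two_neq_0 by simp
    then show ?thesis using a b by simp
  qed (simp add: a)
qed

lemma gens_neg_class:
  assumes "P \<in> points f"
  shows "same_class (gens P * gens (neg P)) 1"
proof (cases P)
  case (Affine a b)
  have "\<xi> - \<iota> a \<noteq> 0"
    using E.hom_0_iff[of "[:- a, 1:]"] by (simp add: E_root)
  then show ?thesis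
    using gens_times_neg[of b a] assms unfolding Affine
    by (intro same_class_singleton) (auto simp: Affine_points_iff simp del: gens.simps)
qed (simp add: same_class_refl)

text \<open>If \<open>P\<close> and \<open>Q\<close> have the same class, then the ideal of
  \<open>P + (- Q)\<close> is principal.\<close>

lemma gens_class_inj:
  assumes PQ: "P \<in> points f" "Q \<in> points f" and "same_class (gens P) (gens Q)"
  shows "P = Q"
proof -
  have "same_class (gens P * gens (neg Q)) (gens Q * gens (neg Q))"
    by (intro same_class_mult assms same_class_refl)
  then have "same_class (gens P * gens (neg Q)) 1"
    using gens_neg_class[OF PQ(2)] same_class_trans by blast
  then obtain h where h: "ideal_span (gens P * gens (neg Q)) = ideal_span {h}"
    using same_class_1D by blast
  show ?thesis
  proof (cases P; cases Q)
    fix a b assume "P = Affine a b" "Q = Infinity"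
    then show ?thesis
      using h PQ point_ideal_not_principal[of b a h] by (simp add: Affine_points_iff)
  next
    fix a b assume "P = Infinity" "Q = Affine a b"
    then show ?thesis
      using h PQ point_ideal_not_principal[of "- b" a h] by (simp add: Affine_points_iff)
  next
    fix a b a' b' assume "P = Affine a b" "Q = Affine a' b'"
    then show ?thesis
      using h PQ two_point_ideal_principal[of b a "- b'" a' h] by (auto simp: Affine_points_iff)
  qed auto
qed

text \<open>The opposite of the sum is the third point on the chord; multiplying by the ideal of
  the sum removes it from the product.\<close>

lemma point_add_aux:
  assumes PQ: "P \<in> points f" "Q \<in> points f"
  shows "point_add f P Q \<in> points f \<and> same_class (gens P * gens Q) (gens (point_add f P Q))"
proof (cases P; cases Q)
  fix x1 y1 x2 y2 assume P: "P = Affine x1 y1" and Q: "Q = Affine x2 y2"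
  show ?thesis
  proof (cases "x1 = x2 \<and> y1 = - y2")
    case True
    then show ?thesis
      using gens_neg_class[OF PQ(1)] P Q by (auto simp: points_def simp del: gens.simps(2))
  next
    case False
    define l where "l = (if x1 = x2 then poly (pderiv f) x1 / (2 * y1) else (y2 - y1) / (x2 - x1))"
    define x3 where "x3 = (l ^ 2 - Polynomial.coeff f 2) / Polynomial.coeff f 3 - x1 - x2"
    define L where "L = [:y1 - l * x1, l:]"
    have on: "y1 ^ 2 = poly f x1" "y2 ^ 2 = poly f x2"
      using PQ by (simp_all add: P Q Affine_points_iff)
    note ci = chord_identity[OF degree_f two_neq_0 on False l_def x3_def]
    have L: "poly L x1 = y1" "poly L x2 = y2"
      using ci(1) by (simp_all add: L_def algebra_simps)
    define y3 where "y3 = poly L x3"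
    have "y3 = y1 + l * (x3 - x1)"
      by (simp add: y3_def L_def algebra_simps)
    then have sum: "point_add f P Q = Affine x3 (- y3)"
      using False unfolding P Q point_add.simps x3_def l_def Let_def by (simp only: if_False)
    have c3: "Polynomial.coeff f 3 \<noteq> 0"
      using degree_f by (metis leading_coeff_0_iff zero_neq_numeral degree_0)
    have "poly (f - L ^ 2) x3 = 0"
      by (simp only: L_def ci(2) poly_smult image_mset_add_mset prod_mset.add_mset poly_mult) simp
    then have on3: "y3 ^ 2 = poly f x3"
      by (simp add: y3_def)
    then have R: "Affine x3 (- y3) \<in> points f"
      by (simp add: Affine_points_iff)
    have "\<eta> - E L \<noteq> 0"
      using rep_eq_0_iff[of "- L" 1] by (simp add: rep_def E.hom_minus E.hom_one)
    moreover have "ideal_span (gens P * (gens Q * gens (Affine x3 y3))) = ideal_span {\<eta> - E L}"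
      using graph_principal[OF c3 ci(2)[folded L_def]] by (simp add: P Q L y3_def del: gens.simps)
    ultimately have "same_class (gens P * (gens Q * gens (Affine x3 y3))) 1"
      by (rule same_class_singleton)
    then have "same_class (gens P * (gens Q * gens (Affine x3 y3)) * gens (Affine x3 (- y3))) (1 * gens (Affine x3 (- y3)))"
      by (intro same_class_mult same_class_refl)
    then have 1: "same_class ((gens P * gens Q) * (gens (Affine x3 (- y3)) * gens (Affine x3 y3))) (gens (Affine x3 (- y3)))"
      by (simp only: ac_simps mult_1_left)
    have "same_class ((gens P * gens Q) * (gens (Affine x3 (- y3)) * gens (Affine x3 y3))) ((gens P * gens Q) * 1)"
      using gens_neg_class[OF R] by (intro same_class_mult same_class_refl) simp
    then have "same_class (gens P * gens Q) (gens (Affine x3 (- y3)))"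
      using 1 same_class_sym same_class_trans by (metis mult_1_right)
    then show ?thesis
      using R by (simp add: sum)
  qed
qed (use PQ in \<open>auto intro: same_class_refl simp del: gens.simps(2)\<close>)

lemma point_add_points: "P \<in> points f \<Longrightarrow> Q \<in> points f \<Longrightarrow> point_add f P Q \<in> points f"
  and point_add_class:
    "P \<in> points f \<Longrightarrow> Q \<in> points f \<Longrightarrow> same_class (gens P * gens Q) (gens (point_add f P Q))"
  using point_add_aux by auto

lemma point_add_assoc:
  assumes P: "P \<in> points f" and Q: "Q \<in> points f" and R: "R \<in> points f"
  shows "point_add f (point_add f P Q) R = point_add f P (point_add f Q R)"
proof (rule gens_class_inj)
  have "same_class (gens (point_add f P Q) * gens R) (gens (point_add f (point_add f P Q) R))"
    "same_class (gens P * gens (point_add f Q R)) (gens (point_add f P (point_add f Q R)))"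
    using assms by (auto intro: point_add_class point_add_points)
  moreover have "same_class (gens P * gens Q * gens R) (gens (point_add f P Q) * gens R)"
    "same_class (gens P * (gens Q * gens R)) (gens P * gens (point_add f Q R))"
    using assms by (auto intro!: same_class_mult point_add_class same_class_refl)
  ultimately show "same_class (gens (point_add f (point_add f P Q) R)) (gens (point_add f P (point_add f Q R)))"
    using same_class_sym same_class_trans by (metis mult.assoc)
qed (use assms in \<open>auto intro: point_add_points\<close>)

lemma point_add_commute:
  assumes P: "P \<in> points f" and Q: "Q \<in> points f"
  shows "point_add f P Q = point_add f Q P"
proof (rule gens_class_inj)
  show "same_class (gens (point_add f P Q)) (gens (point_add f Q P))"
    using point_add_class[OF P Q] point_add_class[OF Q P] same_class_sym same_class_trans
    by (metis mult.commute)
qed (use assms in \<open>auto intro: point_add_points\<close>)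

lemma point_add_neg: "point_add f (neg P) P = Infinity"
  by (cases P) auto

theorem mordell_weil_comm_group: "comm_group (mordell_weil_group f)"
proof (rule comm_groupI)
  fix P Q assume "P \<in> carrier (mordell_weil_group f)" "Q \<in> carrier (mordell_weil_group f)"
  then show "P \<otimes>\<^bsub>mordell_weil_group f\<^esub> Q \<in> carrier (mordell_weil_group f)"
    "P \<otimes>\<^bsub>mordell_weil_group f\<^esub> Q = Q \<otimes>\<^bsub>mordell_weil_group f\<^esub> P"
    by (auto simp: mordell_weil_group_def intro: point_add_points point_add_commute)
next
  fix P assume "P \<in> carrier (mordell_weil_group f)"
  then show "\<exists>Q\<in>carrier (mordell_weil_group f). Q \<otimes>\<^bsub>mordell_weil_group f\<^esub> P = \<one>\<^bsub>mordell_weil_group f\<^esub>"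
    by (intro bexI[of _ "neg P"]) (auto simp: mordell_weil_group_def point_add_neg intro: neg_points)
qed (auto simp: mordell_weil_group_def point_add_assoc points_def)

end

section \<open>The function field of a conic bundle with a section\<close>

instance alg_closure :: (field) field_gcd ..

text \<open>The conic bundle \<open>y\<^sup>2 = s\<^sup>2 T\<^sup>2 + B T + C\<close> over an
  algebraically closed field of constants. Since its equation is \<open>u v = D\<close>, its
  function field is the field of rational functions in \<open>x\<close> and \<open>u\<close>. It
  is represented by fractions of polynomials in \<open>u\<close> whose coefficients are
  polynomials in \<open>x\<close>.\<close>

locale split_conic =
  fixes s :: "'a::{alg_closed_field,field_char_0,field_gcd}" and B C :: "'a poly"
  assumes s_neq_0: "s \<noteq> 0"
    and degree_B: "Polynomial.degree B \<le> 2"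
    and degree_C: "Polynomial.degree C = 3"
    and curve_nonsingular: "poly (curve_poly [:s ^ 2:] B C) a = 0 \<Longrightarrow>
          poly (pderiv (curve_poly [:s ^ 2:] B C)) a \<noteq> 0"
begin

definition D :: "'a poly" where
  "D = C - smult (1 / (4 * s ^ 2)) (B ^ 2)"

definition cx :: "'a poly \<Rightarrow> 'a poly poly fract" where
  "cx p = to_fract [:p:]"

definition U :: "'a poly poly fract" where
  "U = to_fract [:0, 1:]"

definition xF :: "'a poly poly fract" where
  "xF = cx [:0, 1:]"

text \<open>The function \<open>T\<close>, from the equations \<open>v = D / u\<close> and
  \<open>v - u = 2 s T + B / s\<close>.\<close>

definition tau :: "'a poly poly fract" where
  "tau = (cx D / U - U - cx (smult (1 / s) B)) / cx [:2 * s:]"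

text \<open>The function \<open>y = (u + v) / 2\<close>.\<close>

definition eta :: "'a poly poly fract" where
  "eta = (U + cx D / U) / 2"

text \<open>The product \<open>u T\<close> as a polynomial in \<open>x\<close> and
  \<open>u\<close>.\<close>

definition tau_num :: "'a poly poly" where
  "tau_num = [: smult (1 / (2 * s)) D, - smult (1 / (2 * s ^ 2)) B, [:- 1 / (2 * s):] :]"

definition tau_ev :: "'a poly \<Rightarrow> 'a poly poly fract" where
  "tau_ev p = poly (map_poly (\<lambda>c. cx [:c:]) p) tau"

lemma cx_emb: "idom_emb cx"
  unfolding cx_def by (rule idom_emb_comp[OF to_fract_emb const_poly_emb])

sublocale cx: idom_emb cx by (rule cx_emb)

lemma cc_emb: "field_emb (\<lambda>c. cx [:c:])"
  unfolding field_emb_def by (rule idom_emb_comp[OF cx_emb const_poly_emb])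

sublocale cc: field_emb "\<lambda>c. cx [:c:]" by (rule cc_emb)

lemma U_neq_0: "U \<noteq> 0"
  by (simp add: U_def)

lemma two_F: "(2 :: 'a poly poly fract) \<noteq> 0"
  using cx.hom_0_iff[of 2] by (simp add: cx.hom_numeral)

lemma cc_neq_0: "c \<noteq> 0 \<Longrightarrow> cx [:c:] \<noteq> 0"
  by (simp add: cx.hom_0_iff)

lemma cx_smult: "cx (smult c p) = cx [:c:] * cx p"
  by (simp flip: cx.hom_mult)

lemma tau_U: "U * tau = to_fract tau_num"
proof -
  have "to_fract tau_num = cx (smult (1 / (2 * s)) D) + U * (- cx (smult (1 / (2 * s ^ 2)) B)
      + U * (cx [:- 1 / (2 * s):]))"
    by (simp add: cx_def U_def tau_num_def flip: to_fract_add to_fract_mult to_fract_uminus)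
  also have "\<dots> = cx [:1 / (2 * s):] * (cx D - U * cx (smult (1 / s) B) - U * U)"
  proof -
    have "cx (smult (1 / (2 * s ^ 2)) B) = cx [:1 / (2 * s):] * cx (smult (1 / s) B)"
      by (simp add: power2_eq_square ac_simps flip: cx.hom_mult)
    moreover have "cx [:- 1 / (2 * s):] = - cx [:1 / (2 * s):]"
      by (simp flip: cx.hom_minus)
    moreover have "cx (smult (1 / (2 * s)) D) = cx [:1 / (2 * s):] * cx D"
      by (rule cx_smult)
    ultimately show ?thesis
      by (simp only:) (simp add: algebra_simps)
  qed
  also have "cx [:1 / (2 * s):] = 1 / cx [:2 * s:]"
    using cc.hom_divide[of 1 "2 * s"] cc.hom_one by simp
  also have "1 / cx [:2 * s:] * (cx D - U * cx (smult (1 / s) B) - U * U) = U * tau"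
  proof -
    have "U * (cx D / U - U - cx (smult (1 / s) B)) = cx D - U * cx (smult (1 / s) B) - U * U"
      using U_neq_0 by (simp add: algebra_simps)
    then show ?thesis
      unfolding tau_def times_divide_eq_right by simp
  qed
  finally show ?thesis ..
qed

lemma degree_tau_num: "Polynomial.degree tau_num = 2"
  using s_neq_0 by (simp add: tau_num_def)

text \<open>As \<open>u T\<close> has degree two in \<open>u\<close>, the product of
  \<open>u\<^sup>n\<close> and a polynomial of degree \<open>n\<close> in \<open>T\<close> is a
  polynomial in \<open>u\<close> of degree exactly \<open>2 n\<close>: the term of degree
  \<open>i\<close> in \<open>T\<close> only reaches degree \<open>n + i\<close>.\<close>

lemma tau_transcendental:
  assumes "p \<noteq> 0"
  shows "poly (map_poly cx p) tau \<noteq> 0"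
proof -
  define n where "n = Polynomial.degree p"
  define t where "t = (\<lambda>i. [:Polynomial.coeff p i:] * (tau_num ^ i * [:0, 1:] ^ (n - i)))"
  have X: "([:0, 1:] :: 'a poly poly) ^ k \<noteq> 0" for k
    by simp
  have t0: "tau_num \<noteq> 0"
    using degree_tau_num by auto
  have deg: "Polynomial.degree (tau_num ^ i * [:0, 1:] ^ (n - i)) = 2 * i + (n - i)" for i
    using t0 X by (simp add: degree_mult_eq degree_power_eq degree_tau_num)
  have "U ^ n * poly (map_poly cx p) tau = (\<Sum>i\<le>n. U ^ n * (cx (Polynomial.coeff p i) * tau ^ i))"
    by (simp add: poly_altdef cx.degree_map cx.coeff_map n_def sum_distrib_left)
  also have "\<dots> = (\<Sum>i\<le>n. to_fract (t i))"
  proof (intro sum.cong refl)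
    fix i assume "i \<in> {..n}"
    then have "U ^ n = U ^ i * U ^ (n - i)"
      by (simp flip: power_add)
    then have "U ^ n * (cx (Polynomial.coeff p i) * tau ^ i)
        = cx (Polynomial.coeff p i) * ((U * tau) ^ i * U ^ (n - i))"
      by (simp add: power_mult_distrib)
    also have "\<dots> = to_fract (t i)"
      unfolding tau_U unfolding t_def cx_def U_def to_fract_mult idom_emb.hom_power[OF to_fract_emb] ..
    finally show "U ^ n * (cx (Polynomial.coeff p i) * tau ^ i) = to_fract (t i)" .
  qed
  also have "\<dots> = to_fract (\<Sum>i\<le>n. t i)"
    by simp
  also have "(\<Sum>i\<le>n. t i) = (\<Sum>i<n. t i) + t n"
    by (simp add: lessThan_Suc_atMost[symmetric])
  finally have eq: "U ^ n * poly (map_poly cx p) tau = to_fract ((\<Sum>i<n. t i) + t n)" .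
  have "Polynomial.coeff (t i) (2 * n) = 0" if "i < n" for i
  proof (rule coeff_eq_0)
    have "Polynomial.degree (t i) \<le> 2 * i + (n - i)"
      using degree_mult_le[of "[:Polynomial.coeff p i:]" "tau_num ^ i * [:0, 1:] ^ (n - i)"]
      by (simp add: t_def deg del: mult_pCons_left)
    then show "Polynomial.degree (t i) < 2 * n"
      using that by simp
  qed
  moreover have "Polynomial.coeff (t n) (2 * n) \<noteq> 0"
  proof -
    have "Polynomial.coeff p n \<noteq> 0"
      using assms by (simp add: n_def)
    moreover have "Polynomial.coeff (tau_num ^ n) (2 * n) \<noteq> 0"
      using t0 deg[of n] leading_coeff_0_iff[of "tau_num ^ n"] by simp
    ultimately show ?thesis
      by (simp add: t_def)
  qed
  ultimately have "Polynomial.coeff ((\<Sum>i<n. t i) + t n) (2 * n) \<noteq> 0"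
    by (simp add: coeff_sum)
  then have "(\<Sum>i<n. t i) + t n \<noteq> 0"
    by (metis coeff_0)
  then have "to_fract ((\<Sum>i<n. t i) + t n) \<noteq> 0"
    unfolding to_fract_eq_0_iff .
  then show ?thesis
    unfolding eq[symmetric] by auto
qed

lemma map_cx_emb: "idom_emb (\<lambda>p. poly (map_poly cx p) tau)"
proof -
  interpret m: idom_emb "map_poly cx" by (rule cx.map_poly_emb)
  show ?thesis
    using tau_transcendental by unfold_locales (auto simp: m.hom_add m.hom_mult m.hom_one)
qed

lemma tau_ev_cx: "tau_ev p = poly (map_poly cx (map_poly (\<lambda>c. [:c:]) p)) tau"
  by (simp add: tau_ev_def map_poly_map_poly comp_def cx.hom_zero)

lemma tau_ev_emb: "idom_emb tau_ev"
proof -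
  have "tau_ev = (\<lambda>p. poly (map_poly cx (map_poly (\<lambda>c. [:c:]) p)) tau)"
    by (rule ext) (rule tau_ev_cx)
  then show ?thesis
    using idom_emb_comp[OF map_cx_emb idom_emb.map_poly_emb[OF const_poly_emb]] by simp
qed

sublocale te: idom_emb tau_ev by (rule tau_ev_emb)

abbreviation iota :: "'a poly fract \<Rightarrow> 'a poly poly fract" where
  "iota \<equiv> fract_lift tau_ev"

sublocale io: field_emb iota by (rule fract_lift_emb[OF tau_ev_emb])

lemma iota_to_fract: "iota (to_fract p) = tau_ev p"
  by (rule fract_lift_to_fract[OF tau_ev_emb])

lemma iota_const: "iota (const_T c) = cx [:c:]"
  by (simp add: const_T_def iota_to_fract tau_ev_def cc.map_poly_pCons cx.hom_zero)

lemma iota_var: "iota var_T = tau"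
  by (simp add: var_T_def iota_to_fract tau_ev_def cc.map_poly_pCons cx.hom_zero cc.hom_one)

text \<open>Polynomials in \<open>x\<close> over polynomials in \<open>T\<close>, rewritten as
  polynomials in \<open>T\<close> over polynomials in \<open>x\<close>. This turns the
  transcendence of \<open>T\<close> over rational functions of \<open>x\<close> into that of
  \<open>x\<close> over rational functions of \<open>T\<close>.\<close>

definition swap :: "'a poly poly \<Rightarrow> 'a poly poly" where
  "swap p = poly (map_poly (map_poly (\<lambda>c. [:c:])) p) [:[:0, 1:]:]"

lemma swap_pCons: "swap (pCons q p) = map_poly (\<lambda>c. [:c:]) q + [:[:0, 1:]:] * swap p"
  by (simp add: swap_def map_poly_pCons)

lemma swap_0: "swap 0 = 0"
  by (simp add: swap_def)

lemma coeff_swap: "Polynomial.coeff (Polynomial.coeff (swap p) j) i = Polynomial.coeff (Polynomial.coeff p i) j"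
proof (induction p arbitrary: i)
  case (pCons q p)
  then show ?case
    by (cases i) (simp_all add: swap_pCons coeff_map_poly)
qed (simp add: swap_0)

lemma swap_inj: "swap p = 0 \<Longrightarrow> p = 0"
  by (intro poly_eqI) (simp flip: coeff_swap)

lemma poly_tau_ev_swap: "poly (map_poly tau_ev p) xF = poly (map_poly cx (swap p)) tau"
proof (induction p)
  case (pCons q p)
  interpret m: idom_emb "\<lambda>p. poly (map_poly cx p) tau" by (rule map_cx_emb)
  have "poly (map_poly cx [:[:0, 1:]:]) tau = xF"
    by (simp add: xF_def cx.map_poly_pCons)
  with pCons show ?case
    by (simp only: swap_pCons te.map_poly_pCons poly_pCons m.hom_add m.hom_mult flip: tau_ev_cx)
qed (simp add: swap_0)

lemma xF_transcendental:
  assumes "poly (map_poly iota p) xF = 0"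
  shows "p = 0"
proof -
  interpret m: idom_emb "\<lambda>p. poly (map_poly cx p) tau" by (rule map_cx_emb)
  obtain c p' where p: "p = smult c (map_poly to_fract p')"
    using content_decompose_fract by blast
  have "poly (map_poly iota p) xF = iota c * poly (map_poly tau_ev p') xF"
    by (simp add: p io.map_poly_smult map_poly_map_poly comp_def io.hom_zero iota_to_fract te.hom_zero)
  then have "c = 0 \<or> poly (map_poly cx (swap p')) tau = 0"
    using assms by (simp add: io.hom_0_iff poly_tau_ev_swap)
  then show ?thesis
    using m.hom_inj swap_inj p by auto
qed

abbreviation fL :: "'a poly fract poly" where
  "fL \<equiv> curve_poly [:s ^ 2:] B C"

lemma const_T_emb: "field_emb (const_T :: 'a \<Rightarrow> 'a poly fract)"
  unfolding field_emb_def const_T_def[abs_def]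
  by (rule idom_emb_comp[OF to_fract_emb const_poly_emb])

sublocale ct: field_emb "const_T :: 'a \<Rightarrow> 'a poly fract" by (rule const_T_emb)

lemma curve_poly_eq: "curve_poly [:m:] B C =
    [:var_T ^ 2 * const_T m:] + smult var_T (map_poly const_T B) + map_poly const_T C"
  by (simp add: curve_poly_def ct.map_poly_pCons)

lemma degree_fL: "Polynomial.degree fL = 3"
proof -
  have "Polynomial.degree ([:var_T ^ 2 * const_T (s ^ 2):] + smult var_T (map_poly const_T B)) < 3"
    using degree_B by (intro degree_add_less) (auto simp: ct.degree_map intro: le_less_trans[OF degree_smult_le])
  then show ?thesis
    unfolding curve_poly_eq using degree_C by (subst degree_add_eq_right) (auto simp: ct.degree_map)
qed

lemma poly_iota_const: "poly (map_poly iota (map_poly const_T p)) xF = cx p"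
proof (induction p)
  case (pCons c p)
  have "cx (pCons c p) = cx ([:c:] + [:0, 1:] * p)"
    by simp
  also have "\<dots> = cx [:c:] + xF * cx p"
    by (simp only: cx.hom_add cx.hom_mult xF_def)
  finally show ?case
    using pCons by (simp add: ct.map_poly_pCons io.map_poly_pCons iota_const)
qed (simp add: cx.hom_zero)

text \<open>The polynomial \<open>w = s T + B / (2 s)\<close> in \<open>x\<close>; the function
  \<open>u\<close> vanishes on its graph.\<close>

definition W :: "'a poly fract poly" where
  "W = map_poly const_T (smult (1 / (2 * s)) B) + [:const_T s * var_T:]"

lemma four_sq: "const_T s * const_T (1 / (2 * s)) * 2 = (1 :: 'a poly fract)"
proof -
  have "const_T (s * (1 / (2 * s)) * 2) = (const_T 1 :: 'a poly fract)"
    using s_neq_0 by simp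
  then show ?thesis
    by (simp only: ct.hom_mult ct.hom_one ct.hom_numeral)
qed

lemma fL_W: "fL - W ^ 2 = map_poly const_T D"
proof -
  interpret mc: idom_emb "map_poly const_T :: 'a poly \<Rightarrow> 'a poly fract poly"
    by (rule ct.map_poly_emb)
  define b :: "'a poly fract poly" where "b = map_poly const_T B"
  define h :: "'a poly fract" where "h = const_T (1 / (2 * s))"
  define k :: "'a poly fract" where "k = const_T s * var_T"
  have W: "W = smult h b + [:k:]"
    by (simp add: W_def ct.map_poly_smult b_def k_def h_def)
  have "(1 / (4 * s ^ 2)) = (1 / (2 * s)) ^ 2"
    by (simp add: power_divide power_mult_distrib)
  then have D: "map_poly const_T D = map_poly const_T C - smult (h ^ 2) (b ^ 2)"
    by (simp add: D_def mc.hom_diff ct.map_poly_smult mc.hom_power h_def b_def ct.hom_power)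
  have "h * k + h * k = const_T s * h * 2 * var_T"
    by (simp add: k_def algebra_simps)
  then have hk: "h * k + h * k = var_T"
    using four_sq by (simp add: h_def)
  have "W ^ 2 = smult h b * smult h b + (smult h b * [:k:] + [:k:] * smult h b) + [:k:] * [:k:]"
    by (simp only: W power2_eq_square distrib_left distrib_right ac_simps)
  also have "smult h b * smult h b = smult (h ^ 2) (b ^ 2)"
    by (simp add: power2_eq_square)
  also have "smult h b * [:k:] + [:k:] * smult h b = smult (h * k + h * k) b"
    unfolding smult_add_left by (simp add: mult.commute)
  also have "[:k:] * [:k:] = [:var_T ^ 2 * const_T (s ^ 2):]"
    by (simp add: k_def power2_eq_square ct.hom_mult ac_simps)
  finally have "W ^ 2 = smult (h ^ 2) (b ^ 2) + smult var_T b + [:var_T ^ 2 * const_T (s ^ 2):]"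
    unfolding hk .
  moreover have "p + q + r - (t + q + p) = r - t" for p q r t :: "'a poly fract poly"
    by (simp add: algebra_simps)
  ultimately show ?thesis
    unfolding curve_poly_eq D b_def[symmetric] by metis
qed

lemma eta_W: "eta - poly (map_poly iota W) xF = U"
proof -
  have "poly (map_poly iota W) xF = cx (smult (1 / (2 * s)) B) + cx [:s:] * tau"
  proof -
    interpret m: idom_emb "map_poly iota" by (rule io.map_poly_emb)
    show ?thesis
      by (simp add: W_def m.hom_add poly_iota_const io.map_poly_pCons io.hom_mult iota_const iota_var)
  qed
  also have "cx (smult (1 / (2 * s)) B) = cx (smult (1 / s) B) / 2"
  proof -
    have "cx [:2:] * cx (smult (1 / (2 * s)) B) = cx (smult (1 / s) B)"
      by (simp flip: cx_smult)
    then show ?thesis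
      using two_F cc.hom_numeral by (simp add: field_simps)
  qed
  also have "cx [:s:] * tau = (cx D / U - U - cx (smult (1 / s) B)) / 2"
  proof -
    have "cx [:2 * s:] = 2 * cx [:s:]"
      using cc.hom_mult[of 2 s] cc.hom_numeral by simp
    then show ?thesis
      using s_neq_0 by (simp add: tau_def cc_neq_0)
  qed
  finally show ?thesis
    using two_F U_neq_0 by (simp add: eta_def field_simps)
qed

lemma eta_curve: "eta ^ 2 = poly (map_poly iota fL) xF"
proof -
  interpret m: idom_emb "map_poly iota" by (rule io.map_poly_emb)
  define w where "w = poly (map_poly iota W) xF"
  have "fL = W ^ 2 + map_poly const_T D"
    by (simp flip: fL_W)
  then have "poly (map_poly iota fL) xF = w ^ 2 + cx D"
    by (simp add: m.hom_add m.hom_power poly_iota_const w_def)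
  moreover have "w = eta - U"
    using eta_W by (simp add: w_def algebra_simps)
  moreover have "2 * eta * U = U ^ 2 + cx D"
    using two_F U_neq_0 by (simp add: eta_def field_simps power2_eq_square)
  ultimately show ?thesis
    by (simp add: power2_eq_square algebra_simps)
qed

sublocale cubic_curve iota fL xF eta
proof
  show "(2 :: 'a poly fract) \<noteq> 0"
    using ct.hom_0_iff[of 2] by (simp add: ct.hom_numeral)
qed (use degree_fL curve_nonsingular xF_transcendental eta_curve in auto)

lemma E_const_poly: "E (map_poly const_T p) = cx p"
  by (simp add: E_def poly_iota_const)

lemma U_eq: "U = eta - E W"
  using eta_W by (simp add: E_def)

lemma U_rep: "U = rep (- W) 1"
  by (simp add: U_eq rep_def E.hom_minus E.hom_one)

lemma U_in_S: "U \<in> S"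
  unfolding U_rep by (rule rep_in_S)

lemma to_fract_pCons: "to_fract (pCons p H) = cx p + U * to_fract H"
  by (simp add: cx_def U_def flip: to_fract_mult to_fract_add)

lemma to_fract_in_S: "to_fract H \<in> S"
proof (induction H)
  case 0
  then show ?case by (simp add: S_zero)
next
  case (pCons p H)
  moreover have "cx p \<in> S"
    using E_in_S[of "map_poly const_T p"] by (simp add: E_const_poly)
  ultimately show ?case
    by (simp add: to_fract_pCons S_add S_mult U_in_S)
qed

section \<open>Clearing denominators\<close>

text \<open>The ring \<open>K[x, u, 1/u]\<close>.\<close>

definition R_u :: "'a poly poly fract set" where
  "R_u = {z. \<exists>n H. U ^ n * z = to_fract H}"

text \<open>The localization of \<open>K[x, u, 1/u]\<close> at the nonzero polynomials in
  \<open>T\<close>.\<close>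

definition R_uT :: "'a poly poly fract set" where
  "R_uT = {z. \<exists>c. c \<noteq> 0 \<and> tau_ev c * z \<in> R_u}"

lemma R_u_to_fract: "to_fract H \<in> R_u"
  unfolding R_u_def by (intro CollectI exI[of _ 0] exI[of _ H]) simp

lemma R_u_divU: "U * z = to_fract H \<Longrightarrow> z \<in> R_u"
  unfolding R_u_def by (intro CollectI exI[of _ 1] exI[of _ H]) simp

lemma R_u_add: assumes "z \<in> R_u" "w \<in> R_u" shows "z + w \<in> R_u"
proof -
  obtain n H m H' where *: "U ^ n * z = to_fract H" "U ^ m * w = to_fract H'"
    using assms unfolding R_u_def by blast
  have "U ^ (n + m) * (z + w) = U ^ m * (U ^ n * z) + U ^ n * (U ^ m * w)"
    by (simp add: power_add algebra_simps)
  also have "\<dots> = U ^ m * to_fract H + U ^ n * to_fract H'"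
    by (simp only: *)
  also have "\<dots> = to_fract ([:0, 1:] ^ m * H + [:0, 1:] ^ n * H')"
    by (simp only: U_def to_fract_mult to_fract_add idom_emb.hom_power[OF to_fract_emb])
  finally show ?thesis
    unfolding R_u_def by blast
qed

lemma R_u_mult: assumes "z \<in> R_u" "w \<in> R_u" shows "z * w \<in> R_u"
proof -
  obtain n H m H' where *: "U ^ n * z = to_fract H" "U ^ m * w = to_fract H'"
    using assms unfolding R_u_def by blast
  have "U ^ (n + m) * (z * w) = (U ^ n * z) * (U ^ m * w)"
    by (simp add: power_add algebra_simps)
  also have "\<dots> = to_fract H * to_fract H'"
    by (simp only: *)
  also have "\<dots> = to_fract (H * H')"
    by simp
  finally show ?thesis
    unfolding R_u_def by blast
qed

lemma R_u_cx: "cx p \<in> R_u"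
  unfolding cx_def by (rule R_u_to_fract)

lemma R_u_tau_ev: "tau_ev p \<in> R_u"
proof (induction p)
  case (pCons c p)
  then show ?case
    using R_u_divU[OF tau_U] by (auto simp: tau_ev_def cc.map_poly_pCons intro!: R_u_add R_u_mult R_u_cx)
qed (use R_u_cx[of 0] in \<open>simp add: tau_ev_def cx.hom_zero\<close>)

lemma R_uT_Q1: "z \<in> R_u \<Longrightarrow> z \<in> R_uT"
  unfolding R_uT_def by (intro CollectI exI[of _ 1]) (simp add: te.hom_one)

lemma R_uT_add: assumes "z \<in> R_uT" "w \<in> R_uT" shows "z + w \<in> R_uT"
proof -
  obtain c d where "c \<noteq> 0" "tau_ev c * z \<in> R_u" "d \<noteq> 0" "tau_ev d * w \<in> R_u"
    using assms unfolding R_uT_def by blast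
  moreover have "tau_ev (c * d) * (z + w) = tau_ev d * (tau_ev c * z) + tau_ev c * (tau_ev d * w)"
    by (simp add: te.hom_mult algebra_simps)
  ultimately show ?thesis
    unfolding R_uT_def by (intro CollectI exI[of _ "c * d"]) (simp add: R_u_add R_u_mult R_u_tau_ev)
qed

lemma R_uT_mult: assumes "z \<in> R_uT" "w \<in> R_uT" shows "z * w \<in> R_uT"
proof -
  obtain c d where "c \<noteq> 0" "tau_ev c * z \<in> R_u" "d \<noteq> 0" "tau_ev d * w \<in> R_u"
    using assms unfolding R_uT_def by blast
  moreover have "(tau_ev c * z) * (tau_ev d * w) = tau_ev (c * d) * (z * w)"
    by (simp add: te.hom_mult algebra_simps)
  ultimately show ?thesis
    unfolding R_uT_def by (metis (mono_tags, lifting) R_u_mult mem_Collect_eq mult_eq_0_iff)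
qed

lemma R_uT_iota: "iota q \<in> R_uT"
proof (cases q)
  case (Fract a b)
  then have "tau_ev b * iota q = tau_ev a"
    by (simp add: fract_lift_Fract[OF tau_ev_emb] te.hom_0_iff)
  then show ?thesis
    using Fract R_u_tau_ev unfolding R_uT_def by (intro CollectI exI[of _ b]) auto
qed

lemma R_uT_S: "z \<in> S \<Longrightarrow> z \<in> R_uT"
proof -
  have E: "E p \<in> R_uT" for p
  proof (induction p)
    case 0
    then show ?case using R_uT_iota[of 0] by (simp add: E.hom_zero io.hom_zero)
  next
    case (pCons c p)
    have "E (pCons c p) = iota c + xF * E p"
      by (simp add: E_def io.map_poly_pCons)
    then show ?case
      using pCons by (auto simp: xF_def intro: R_uT_add R_uT_mult R_uT_iota R_uT_Q1 R_u_cx)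
  qed
  have "U * eta = cx [:1/2:] * (U * U + cx D)"
  proof -
    have "cx [:1/2:] = 1 / 2"
      using cc.hom_divide[of 1 2] cc.hom_one cc.hom_numeral by simp
    then show ?thesis
      using two_F U_neq_0 by (simp add: eta_def field_simps)
  qed
  also have "\<dots> = to_fract ([:[:1/2:]:] * ([:0,1:] * [:0,1:] + [:D:]))"
    by (simp only: cx_def U_def to_fract_mult to_fract_add)
  finally have "eta \<in> R_u"
    by (rule R_u_divU)
  then have "rep p q \<in> R_uT" for p q
    unfolding rep_def by (simp add: R_uT_add R_uT_mult E R_uT_Q1)
  then show "z \<in> S \<Longrightarrow> z \<in> R_uT"
    by (auto simp: S_def)
qed

text \<open>Every function on the affine curve over \<open>K(T)\<close> becomes a polynomial in
  \<open>x\<close> and \<open>u\<close> after multiplication by a polynomial in \<open>T\<close>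
  and a power of \<open>u\<close>. This transfers questions about the curve to the factorial ring
  \<open>K[x, u]\<close>.\<close>

lemma clear_denominators:
  assumes "z \<in> S"
  obtains c n H where "c \<noteq> 0" "tau_ev c * U ^ n * z = to_fract H"
proof -
  obtain c where c: "c \<noteq> 0" "tau_ev c * z \<in> R_u"
    using R_uT_S[OF assms] unfolding R_uT_def by blast
  then obtain n H where "U ^ n * (tau_ev c * z) = to_fract H"
    unfolding R_u_def by blast
  then show ?thesis
    using that[of c n H] c by (simp add: ac_simps)
qed

end

section \<open>Divisors of products of point ideals\<close>

lemma subset_add_mset: "M \<subseteq># A \<Longrightarrow> M \<subseteq># add_mset q A"
  by (auto simp: subseteq_mset_def intro: le_SucI)

lemma prod_linear_neq_0: "(\<Prod>a\<in>#A. [:- a, 1:]) \<noteq> (0 :: 'a::idom poly)"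
  by (auto simp: prod_mset_zero_iff)

lemma proots_prod_linear: "proots (\<Prod>a\<in>#A. [:- a, 1:]) = (A :: 'a::idom multiset)"
proof (induction A)
  case (add x A)
  have "proots ([:- x, 1:] * (\<Prod>a\<in>#A. [:- a, 1:])) = {#x#} + proots (\<Prod>a\<in>#A. [:- a, 1:])"
    using prod_linear_neq_0[of A] by (subst proots_mult) auto
  then show ?case
    using add by (simp del: mult_pCons_left)
qed simp

lemma dvd_prime_product:
  fixes H :: "'a::algebraic_semidom"
  assumes "\<forall>q\<in>#Q. prime_elem q" "is_unit k" "H dvd k * prod_mset Q"
  shows "\<exists>Q' k'. Q' \<subseteq># Q \<and> is_unit k' \<and> H = k' * prod_mset Q'"
  using assms
proof (induction Q arbitrary: H)
  case empty
  then have "is_unit H"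
    using dvd_unit_imp_unit by auto
  then show ?case
    by (intro exI[of _ "{#}"] exI[of _ H]) simp
next
  case (add q Q)
  have q: "prime_elem q"
    using add.prems by simp
  then have q0: "q \<noteq> 0" by (simp add: prime_elem_def)
  obtain R where "k * prod_mset (add_mset q Q) = H * R"
    using add.prems(3) by (elim dvdE)
  then have R: "q * (k * prod_mset Q) = H * R"
    by (simp add: mult.left_commute)
  then have "q dvd H * R"
    by (simp flip: R)
  have prems: "\<forall>q\<in>#Q. prime_elem q"
    using add.prems(1) by simp
  from \<open>q dvd H * R\<close> have "q dvd H \<or> q dvd R"
    using prime_elem_dvd_multD[OF q] by blast
  then show ?case
  proof (elim disjE)
    assume "q dvd H"
    then obtain H' where H': "H = q * H'" by (elim dvdE)
    have "q * (k * prod_mset Q) = q * (H' * R)"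
      using R unfolding H' mult.assoc .
    then have "k * prod_mset Q = H' * R"
      using q0 mult_left_cancel by blast
    then have "H' dvd k * prod_mset Q"
      by (rule dvdI)
    from add.IH[OF prems add.prems(2) this]
    obtain Q' k' where "Q' \<subseteq># Q" "is_unit k'" "H' = k' * prod_mset Q'"
      by blast
    then show ?thesis
      unfolding H' by (intro exI[of _ "add_mset q Q'"] exI[of _ k']) (simp add: mult.left_commute)
  next
    assume "q dvd R"
    then obtain R' where R': "R = q * R'" by (elim dvdE)
    have "q * (k * prod_mset Q) = q * (H * R')"
      using R unfolding R' by (simp only: mult.left_commute)
    then have "k * prod_mset Q = H * R'"
      using q0 mult_left_cancel by blast
    then have "H dvd k * prod_mset Q"
      by (rule dvdI)
    from add.IH[OF prems add.prems(2) this]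
    obtain Q' k' where "Q' \<subseteq># Q" "is_unit k'" "H = k' * prod_mset Q'"
      by blast
    then show ?thesis
      by (intro exI[of _ Q'] exI[of _ k']) (simp add: subset_add_mset)
  qed
qed

context cubic_curve
begin

text \<open>A generator of the product of the ideals of \<open>P\<close> and
  \<open>- P\<close>.\<close>

definition vert :: "'l point \<Rightarrow> 'f" where
  "vert P = (case P of Infinity \<Rightarrow> 1 | Affine a b \<Rightarrow> \<xi> - \<iota> a)"

lemma vert: assumes "P \<in> points f"
  shows "vert P \<noteq> 0" "ideal_span (gens P * gens (neg P)) = ideal_span {vert P}"
proof -
  show "vert P \<noteq> 0"
    using E.hom_0_iff[of "[:- a, 1:]" for a] by (auto simp: vert_def E_root split: point.split)
  show "ideal_span (gens P * gens (neg P)) = ideal_span {vert P}"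
    using assms
    by (cases P) (simp_all add: vert_def Affine_points_iff gens_times_neg del: gens.simps(2) flip: set_one)
qed

lemma span_S_subset: "V \<subseteq> S \<Longrightarrow> W \<subseteq> S \<Longrightarrow> V * W \<subseteq> S"
  by (auto simp: set_times_def intro: S_mult)

text \<open>If \<open>P\<close> is affine, the residue field of its ideal is the base field of the
  curve, so \<open>J\<close> contains an element that is congruent to a nonzero constant
  \<open>e\<close>. For \<open>z\<close> in \<open>V\<close>, the product \<open>e z\<close>
  differs from a multiple of this element by an element of the product ideal.\<close>

lemma drop_point:
  assumes P: "P \<in> points f" and J: "ideal_span J \<subseteq> S" "\<not> ideal_span J \<subseteq> ideal_span (gens P)"
    and V: "V \<subseteq> S" "ideal_span (gens P * V) \<subseteq> ideal_span J"
  shows "ideal_span V \<subseteq> ideal_span J"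
proof (cases P)
  case Infinity
  then show ?thesis using J by (simp add: ideal_span_one)
next
  case (Affine a b)
  then have on: "b ^ 2 = poly f a"
    using P by (simp add: Affine_points_iff)
  obtain j where j: "j \<in> ideal_span J" "j \<notin> ideal_span (gens P)"
    using J by blast
  then have jS: "j \<in> S" using J by blast
  define e where "e = ev a b j"
  have e: "e \<noteq> 0"
    using j(2) jS mem_ideal_iff[OF on, of j] unfolding Affine e_def by blast
  have m: "j - \<iota> e \<in> ideal_span (gens P)"
    unfolding Affine mem_ideal_iff[OF on]
    by (simp only: S_diff jS iota_in_S ev_diff ev_iota e_def diff_self simp_thms)
  show ?thesis
  proof (rule span_least, rule subsetI)
    fix z assume z: "z \<in> V"
    have "(j - \<iota> e) * z \<in> ideal_span J"
      using span_mult[OF m span_base[OF z]] V by blast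
    moreover have "z * j \<in> ideal_span J"
      using z V j by (intro span_smult) auto
    ultimately have "z * j - (j - \<iota> e) * z \<in> ideal_span J"
      by (intro span_diff)
    also have "z * j - (j - \<iota> e) * z = \<iota> e * z"
      by (simp add: algebra_simps)
    finally show "z \<in> ideal_span J"
      using e by (rule span_iota_cancel)
  qed
qed

text \<open>The ideal of \<open>P\<close> is invertible; its inverse is the ideal of
  \<open>- P\<close> divided by the vertical line through \<open>P\<close>.\<close>

lemma cancel_point:
  assumes "P \<in> points f"
  shows "ideal_span ({inverse (vert P)} * (gens (neg P) * (gens P * V))) = ideal_span V"
proof -
  note t = vert[OF assms]
  have "ideal_span ({inverse (vert P)} * (gens (neg P) * (gens P * V)))
      = ideal_span ((gens P * gens (neg P)) * ({inverse (vert P)} * V))"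
    by (simp only: ac_simps)
  also have "\<dots> = ideal_span ({vert P} * ({inverse (vert P)} * V))"
    by (rule span_times_cong[OF t(2) refl])
  also have "{vert P} * ({inverse (vert P)} * V) = V"
    using t(1) by (simp add: singleton_times flip: mult.assoc set_one)
  finally show ?thesis .
qed

text \<open>If \<open>J\<close> lies in the ideal of the first point, this ideal can be cancelled
  on both sides; otherwise it can be dropped from the product.\<close>

lemma subproduct:
  assumes "\<And>P. P \<in># A \<Longrightarrow> P \<in> points f"
    and "ideal_span (\<Prod>P\<in>#A. gens P) \<subseteq> ideal_span J" "ideal_span J \<subseteq> S"
  shows "\<exists>M. M \<subseteq># A \<and> ideal_span J = ideal_span (\<Prod>P\<in>#M. gens P)"
  using assms
proof (induction A arbitrary: J)
  case empty
  then show ?case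
    by (intro exI[of _ "{#}"]) (auto simp: ideal_span_one)
next
  case (add P A)
  let ?V = "\<Prod>P\<in>#A. gens P"
  have P: "P \<in> points f"
    using add.prems(1) by simp
  have VS: "?V \<subseteq> S"
    by (induction A) (simp_all add: S_one span_S_subset gens_subset_S, simp add: set_one S_one)
  have sub: "ideal_span (gens P * ?V) \<subseteq> ideal_span J"
    using add.prems(2) by simp
  show ?case
  proof (cases "ideal_span J \<subseteq> ideal_span (gens P)")
    case False
    then have "ideal_span ?V \<subseteq> ideal_span J"
      using drop_point[OF P add.prems(3) _ VS sub] by blast
    from add.IH[OF _ this add.prems(3)] add.prems(1)
    obtain M where "M \<subseteq># A" "ideal_span J = ideal_span (\<Prod>P\<in>#M. gens P)"
      by auto
    then show ?thesis
      by (intro exI[of _ M]) (auto intro: subset_add_mset)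
  next
    case True
    define t where "t = vert P"
    note t = vert[OF P, folded t_def]
    \<comment> \<open>This is \<open>J\<close> divided by the ideal of \<open>P\<close>.\<close>
    define J' where "J' = {inverse t} * (gens (neg P) * J)"
    have inv: "{t} * ({inverse t} * V) = V" for V
      using t(1) by (simp add: singleton_times flip: mult.assoc set_one)
    have "ideal_span (gens P * J') = ideal_span ((gens P * gens (neg P)) * ({inverse t} * J))"
      unfolding J'_def by (simp only: ac_simps)
    also have "\<dots> = ideal_span ({t} * ({inverse t} * J))"
      by (rule span_times_cong[OF t(2) refl])
    finally have PJ': "ideal_span (gens P * J') = ideal_span J"
      by (simp only: inv)
    have scale: "ideal_span ({inverse t} * (gens (neg P) * V)) \<subseteq> ideal_span ({inverse t} * (gens (neg P) * W))"
      if "ideal_span V \<subseteq> ideal_span W" for V W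
      using that by (intro span_times_mono) auto
    note unscale = cancel_point[OF P, folded t_def]
    have "ideal_span J' \<subseteq> ideal_span ({inverse t} * (gens (neg P) * (gens P * 1)))"
      unfolding J'_def by (rule scale) (simp add: True)
    then have "ideal_span J' \<subseteq> S"
      by (simp only: unscale ideal_span_one)
    moreover have "ideal_span ?V \<subseteq> ideal_span J'"
      using scale[OF sub] unfolding unscale J'_def .
    ultimately have "\<exists>M. M \<subseteq># A \<and> ideal_span J' = ideal_span (\<Prod>P\<in>#M. gens P)"
      using add.prems(1) by (intro add.IH) auto
    then obtain M where M: "M \<subseteq># A" "ideal_span J' = ideal_span (\<Prod>P\<in>#M. gens P)"
      by blast
    have "ideal_span (\<Prod>P\<in>#add_mset P M. gens P) = ideal_span (gens P * J')"
      by (simp add: M(2) span_times_cong[OF refl M(2)])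
    then show ?thesis
      using M(1) PJ' by (intro exI[of _ "add_mset P M"]) simp
  qed
qed

end

section \<open>Generators of the group of points\<close>

context split_conic
begin

definition roots_D :: "'a multiset" where
  "roots_D = proots D"

definition Pt :: "'a \<Rightarrow> 'a poly fract point" where
  "Pt a = Affine (const_T a) (poly W (const_T a))"

lemma degree_D: "Polynomial.degree D \<ge> 3" and D_neq_0: "D \<noteq> 0"
proof -
  have 1: "Polynomial.degree (smult (1 / (4 * s ^ 2)) (B ^ 2)) = 2 * Polynomial.degree B"
    using s_neq_0 by (cases "B = 0") (auto simp: degree_power_eq)
  show *: "Polynomial.degree D \<ge> 3"
  proof (cases "Polynomial.degree B = 2")
    case True
    then have "Polynomial.degree D = 4"
      unfolding D_def diff_conv_add_uminus using 1 degree_C by (subst degree_add_eq_right) auto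
    then show ?thesis by simp
  next
    case False
    then have "Polynomial.degree D = 3"
      unfolding D_def diff_conv_add_uminus using 1 degree_C degree_B
      by (subst degree_add_eq_left) auto
    then show ?thesis by simp
  qed
  show "D \<noteq> 0"
    using * by auto
qed

lemma D_factor: "D = smult (lead_coeff D) (\<Prod>a\<in>#roots_D. [:- a, 1:])"
proof -
  obtain A where A: "D = smult (lead_coeff D) (\<Prod>a\<in>#A. [:- a, 1:])"
    using alg_closed_imp_factorization[OF D_neq_0] by blast
  have "proots (\<Prod>a\<in>#A. [:- a, 1:]) = A"
    by (rule proots_prod_linear)
  then have "roots_D = A"
    unfolding roots_D_def using D_neq_0 by (subst A) simp
  then show ?thesis
    using A by simp
qed

lemma set_roots_D: "a \<in># roots_D \<longleftrightarrow> poly D a = 0"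
  using D_neq_0 by (simp add: roots_D_def)

lemma fL_W_factor:
  "fL - W ^ 2 = smult (const_T (lead_coeff D)) (\<Prod>a\<in>#image_mset const_T roots_D. [:- a, 1:])"
proof -
  interpret mc: idom_emb "map_poly const_T :: 'a poly \<Rightarrow> 'a poly fract poly"
    by (rule ct.map_poly_emb)
  have "map_poly const_T (smult (lead_coeff D) (\<Prod>a\<in>#roots_D. [:- a, 1:]))
      = smult (const_T (lead_coeff D)) (\<Prod>a\<in>#image_mset const_T roots_D. [:- a, 1:])"
    by (simp add: ct.map_poly_smult mc.hom_prod_mset multiset.map_comp comp_def
        ct.map_poly_pCons ct.hom_minus ct.hom_one ct.hom_zero)
  then show ?thesis
    using fL_W D_factor by simp
qed

text \<open>The points over the roots of \<open>D\<close> are the intersection of the curve with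
  the graph of \<open>w\<close>.\<close>

lemma span_roots_D: "ideal_span (\<Prod>a\<in>#roots_D. gens (Pt a)) = ideal_span {U}"
proof -
  have "const_T (lead_coeff D) \<noteq> 0"
    using D_neq_0 by (simp add: ct.hom_0_iff)
  from graph_principal[OF this fL_W_factor] show ?thesis
    by (simp add: multiset.map_comp comp_def Pt_def U_eq del: gens.simps)
qed

lemma Pt_points: "a \<in># roots_D \<Longrightarrow> Pt a \<in> points fL"
proof -
  assume "a \<in># roots_D"
  then have "poly (fL - W ^ 2) (const_T a) = 0"
    unfolding fL_W ct.poly_map by (simp add: set_roots_D ct.hom_zero)
  then show ?thesis
    by (simp add: Pt_def Affine_points_iff)
qed

lemma span_roots_D_power: "ideal_span (\<Prod>P\<in>#image_mset Pt (repeat_mset n roots_D). gens P) = ideal_span {U ^ n}"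
proof -
  have "(\<Prod>P\<in>#image_mset Pt (repeat_mset n roots_D). gens P) = (\<Prod>a\<in>#roots_D. gens (Pt a)) ^ n"
    by (induction n) (simp_all add: multiset.map_comp comp_def)
  moreover have "{U} ^ n = {U ^ n}"
    by (induction n) (simp_all add: set_one singleton_times)
  ultimately show ?thesis
    using span_power_cong[OF span_roots_D, of n] by simp
qed

lemma ev_cx: "ev a b (cx p) = poly (map_poly const_T p) a"
  using ev_E[of a b "map_poly const_T p"] by (simp add: E_const_poly)

lemma ev_U: "ev a b U = b - poly W a"
  by (simp add: U_rep ev_rep)

text \<open>The polynomial splits into linear factors over the constants.\<close>

lemma root_is_const:
  fixes p :: "'a poly"
  assumes "p \<noteq> 0" "poly (map_poly const_T p) a = 0"
  shows "\<exists>e. a = const_T e \<and> poly p e = 0"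
proof -
  interpret mc: idom_emb "map_poly const_T :: 'a poly \<Rightarrow> 'a poly fract poly"
    by (rule ct.map_poly_emb)
  obtain A where A: "p = smult (lead_coeff p) (\<Prod>a\<in>#A. [:- a, 1:])"
    using alg_closed_imp_factorization[OF assms(1)] by blast
  have "poly (map_poly const_T (\<Prod>a\<in>#A. [:- a, 1:])) a = 0"
    using assms arg_cong[OF A, of "\<lambda>p. poly (map_poly const_T p) a"]
    by (simp add: ct.map_poly_smult ct.hom_0_iff)
  moreover have "poly (map_poly const_T (\<Prod>a\<in>#A. [:- a, 1:])) a = (\<Prod>e\<in>#A. a - const_T e)" for A
    by (induction A) (simp_all add: mc.hom_mult mc.hom_one ct.map_poly_pCons ct.hom_minus
        ct.hom_one ct.hom_zero del: mult_pCons_left)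
  ultimately obtain e where e: "e \<in># A" "a = const_T e"
    by (auto simp: prod_mset_zero_iff)
  then have "poly p e = 0"
  proof -
    have "[:- e, 1:] dvd (\<Prod>a\<in>#A. [:- a, 1:])"
      using e by (intro dvd_prod_mset) auto
    then have "[:- e, 1:] dvd p"
      by (subst A) (rule dvd_smult)
    then show ?thesis
      by (simp add: poly_eq_0_iff_dvd)
  qed
  then show ?thesis
    using e by blast
qed

lemma ev_to_fract_mult:
  "b ^ 2 = poly fL a \<Longrightarrow> ev a b (to_fract (G * H)) = ev a b (to_fract G) * ev a b (to_fract H)"
  by (simp add: ev_mult to_fract_in_S)

lemma ev_to_fract_add: "ev a b (to_fract (G + H)) = ev a b (to_fract G) + ev a b (to_fract H)"
  by (simp add: ev_add to_fract_in_S)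

lemma var_T_not_const: "var_T \<noteq> const_T c"
  by (simp add: var_T_def const_T_def)

text \<open>The polynomials in \<open>x\<close> and \<open>u\<close> that vanish at a point
  outside \<open>u = 0\<close> form a prime ideal, which contains a nonzero element obtained from
  \<open>x - a\<close> by clearing denominators. Take an element of least degree in
  \<open>u\<close>. If the degree is positive, its primitive part generates the ideal, by
  pseudo-division and Gauss's lemma. If it is zero, then \<open>a\<close> is a constant
  \<open>e\<close>, and \<open>x - e\<close> generates the ideal: any further equation would make
  the value of \<open>u\<close> constant too, and with it \<open>T\<close>.\<close>

lemma kernel_principal:
  assumes on: "b ^ 2 = poly fL a" and uP: "ev a b U \<noteq> 0"
  shows "\<exists>G. G \<noteq> 0 \<and> ev a b (to_fract G) = 0 \<and> (\<forall>H. ev a b (to_fract H) = 0 \<longrightarrow> G dvd H)"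
proof -
  define \<phi> where "\<phi> H = ev a b (to_fract H)" for H
  have \<phi>_mult: "\<phi> (G * H) = \<phi> G * \<phi> H" and \<phi>_add: "\<phi> (G + H) = \<phi> G + \<phi> H" for G H
    by (simp_all only: \<phi>_def ev_to_fract_mult[OF on] ev_to_fract_add)
  have \<phi>_const: "\<phi> [:p:] = poly (map_poly const_T p) a" for p
    by (simp add: \<phi>_def ev_cx flip: cx_def)
  have \<phi>_0: "\<phi> 0 = 0"
    using \<phi>_const[of 0] by simp
  have \<phi>_pCons: "\<phi> (pCons p H) = poly (map_poly const_T p) a + ev a b U * \<phi> H" for p H
    using \<phi>_add[of "[:p:]" "[:0, 1:] * H"] \<phi>_mult[of "[:0, 1:]" H] \<phi>_const
    by (simp add: \<phi>_def U_def)
  have "xF - iota a \<in> S"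
    by (intro S_diff xi_in_S iota_in_S)
  then obtain c n H where H: "c \<noteq> 0" "tau_ev c * U ^ n * (xF - iota a) = to_fract H"
    using clear_denominators by blast
  have "xF - iota a \<noteq> 0"
    using E.hom_0_iff[of "[:- a, 1:]"] by (simp add: E_root)
  then have "to_fract H \<noteq> 0"
    using H U_neq_0 by (metis mult_eq_0_iff power_not_zero te.hom_0_iff)
  then have H0: "H \<noteq> 0"
    by auto
  have "ev a b (tau_ev c * U ^ n * (xF - iota a)) = 0"
  proof -
    have 1: "tau_ev c * U ^ n \<in> S"
      using iota_in_S[of "to_fract c"] by (simp add: iota_to_fract S_mult S_power U_in_S)
    have "ev a b (xF - iota a) = 0"
      by (simp only: ev_diff xi_in_S iota_in_S ev_xi ev_iota diff_self)
    then show ?thesis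
      by (simp only: ev_mult[OF on 1 \<open>xF - iota a \<in> S\<close>] mult_zero_right)
  qed
  then have "\<phi> H = 0"
    by (simp add: H \<phi>_def)
  with H0 obtain G where G: "G \<noteq> 0" "\<phi> G = 0"
    and min: "\<And>G'. G' \<noteq> 0 \<Longrightarrow> \<phi> G' = 0 \<Longrightarrow> Polynomial.degree G \<le> Polynomial.degree G'"
    using ex_has_least_nat[of "\<lambda>G. G \<noteq> 0 \<and> \<phi> G = 0" H Polynomial.degree] by blast
  have "\<exists>G. G \<noteq> 0 \<and> \<phi> G = 0 \<and> (\<forall>H. \<phi> H = 0 \<longrightarrow> G dvd H)"
  proof (cases "Polynomial.degree G = 0")
    case True
    then obtain p where p: "G = [:p:]"
      by (elim degree_eq_zeroE)
    with G obtain e where e: "a = const_T e"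
      using root_is_const[of p a] \<phi>_const by auto
    show ?thesis
    proof (intro exI[of _ "[:[:- e, 1:]:]"] conjI allI impI)
      show "\<phi> [:[:- e, 1:]:] = 0"
        by (simp add: \<phi>_const e ct.map_poly_pCons ct.hom_minus ct.hom_one)
    next
      fix H assume H: "\<phi> H = 0"
      define h where "h = map_poly (\<lambda>p. poly p e) H"
      have "\<phi> K = poly (map_poly const_T (map_poly (\<lambda>p. poly p e) K)) (ev a b U)" for K
        by (induction K) (simp_all add: \<phi>_0 \<phi>_pCons e ct.poly_map map_poly_pCons ct.map_poly_pCons)
      then have h: "poly (map_poly const_T h) (ev a b U) = 0"
        using H by (simp add: h_def)
      have "h = 0"
      proof (rule ccontr)
        assume "h \<noteq> 0"
        then obtain d where d: "ev a b U = const_T d"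
          using root_is_const h by blast
        have "ev a b (U * tau) = const_T d * var_T"
        proof -
          have "ev a b tau = var_T"
            using ev_iota[of a b var_T] by (simp add: iota_var)
          then show ?thesis
            using ev_mult[OF on U_in_S, of tau] iota_in_S[of var_T] d by (simp add: iota_var)
        qed
        also have "ev a b (U * tau) = \<phi> tau_num"
          by (simp add: tau_U \<phi>_def)
        finally have "const_T d * var_T = \<phi> tau_num" ..
        moreover obtain k where "\<phi> tau_num = const_T k"
          unfolding tau_num_def \<phi>_pCons \<phi>_0 d unfolding e ct.poly_map mult_zero_right add_0_right
          by (simp only: flip: ct.hom_add ct.hom_mult)
        ultimately have "const_T d * var_T = const_T k"
          by simp
        moreover have "d \<noteq> 0"
          using uP d by (auto simp: ct.hom_zero)
        ultimately have "var_T = const_T (k / d)"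
          by (simp add: ct.hom_divide ct.hom_0_iff field_simps)
        then show False
          using var_T_not_const by blast
      qed
      then have "poly (Polynomial.coeff H n) e = 0" for n
        using coeff_map_poly[of "\<lambda>p. poly p e" H n] by (simp add: h_def)
      then show "[:[:- e, 1:]:] dvd H"
        by (simp add: const_poly_dvd_iff flip: poly_eq_0_iff_dvd)
    qed simp
  next
    case False
    define P where "P = primitive_part G"
    have GP: "G = [:content G:] * P"
      by (simp add: P_def)
    have P0: "P \<noteq> 0"
      using G by (simp add: P_def)
    have "\<phi> [:content G:] \<noteq> 0"
    proof
      assume *: "\<phi> [:content G:] = 0"
      have "[:content G:] \<noteq> 0"
        using G by simp
      from min[OF this *] show False
        using False by simp
    qed
    then have \<phi>P: "\<phi> P = 0"
      using G GP \<phi>_mult by (metis mult_eq_0_iff)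
    have degP: "Polynomial.degree P = Polynomial.degree G"
      by (simp add: P_def)
    show ?thesis
    proof (intro exI[of _ P] conjI allI impI P0 \<phi>P)
      fix H assume H: "\<phi> H = 0"
      obtain q r where qr: "pseudo_divmod H P = (q, r)"
        by (cases "pseudo_divmod H P")
      define l where "l = Polynomial.coeff P (Polynomial.degree P) ^ (Suc (Polynomial.degree H) - Polynomial.degree P)"
      have div: "[:l:] * H = P * q + r"
        using pseudo_divmod(1)[OF P0 qr] by (simp add: l_def)
      have "\<phi> (P * q + r) = 0"
        unfolding div[symmetric] \<phi>_mult H by simp
      then have "\<phi> r = 0"
        by (simp add: \<phi>_add \<phi>_mult \<phi>P)
      then have "r = 0"
        using pseudo_divmod(2)[OF P0 qr] min[of r] degP by fastforce
      then have "P dvd smult l H"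
        using div by simp
      then have "map_poly to_fract P dvd map_poly to_fract (smult l H)"
        by (rule fract_poly_dvd)
      then have "map_poly to_fract P dvd smult (to_fract l) (map_poly to_fract H)"
        by simp
      moreover have "l \<noteq> 0"
        using P0 by (simp add: l_def)
      ultimately have "map_poly to_fract P dvd map_poly to_fract H"
        using dvd_smult_cancel by (metis to_fract_eq_0_iff)
      moreover have "content P = 1"
        using G by (simp add: P_def)
      ultimately show "P dvd H"
        by (rule fract_poly_dvdD)
    qed
  qed
  then show ?thesis
    by (simp add: \<phi>_def)
qed

end

context split_conic
begin

lemma repeat_mset_memD: "a \<in># repeat_mset n A \<Longrightarrow> a \<in># A"
  by (induction n) auto

lemma subset_image_msetD: "M' \<subseteq># image_mset g A \<Longrightarrow> \<exists>M. M \<subseteq># A \<and> M' = image_mset g M"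
  by (metis image_mset_eq_plusD mset_subset_eq_add_left subset_mset.add_diff_inverse)

text \<open>Away from \<open>u = 0\<close>, the ideal of the point is generated by
  \<open>G\<close> alone.\<close>

lemma vanishing_in_generator:
  assumes on: "b ^ 2 = poly fL a" and G: "\<And>H. ev a b (to_fract H) = 0 \<Longrightarrow> G dvd H"
    and z: "z \<in> S" "ev a b z = 0"
  shows "\<exists>n. U ^ n * z \<in> ideal_span {to_fract G}"
proof -
  obtain c n H where H: "c \<noteq> 0" "tau_ev c * U ^ n * z = to_fract H"
    using clear_denominators[OF z(1)] by blast
  have 1: "tau_ev c * U ^ n \<in> S"
    using iota_in_S[of "to_fract c"] by (simp add: iota_to_fract S_mult S_power U_in_S)
  have "ev a b (to_fract H) = 0"
    by (simp only: H(2)[symmetric] ev_mult[OF on 1 z(1)] z(2) mult_zero_right)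
  then obtain K where "H = G * K"
    using G by blast
  then have "to_fract H \<in> ideal_span {to_fract G}"
    using to_fract_in_S by (auto simp: span_singleton)
  then have "iota (to_fract c) * (U ^ n * z) \<in> ideal_span {to_fract G}"
    by (simp add: iota_to_fract mult.assoc flip: H(2))
  then have "U ^ n * z \<in> ideal_span {to_fract G}"
    by (rule span_iota_cancel) (simp add: H(1))
  then show ?thesis ..
qed

text \<open>Away from \<open>u = 0\<close>, the divisor of the generator \<open>g\<close> of the
  kernel is \<open>P\<close>. So the complementary ideal \<open>J\<close> contains a power of
  \<open>u\<close>, and is a product of ideals of points over roots of \<open>D\<close>.\<close>

theorem points_generated:
  assumes P: "P \<in> points fL"
  shows "\<exists>M. set_mset M \<subseteq> set_mset roots_D \<and> same_class (gens P * (\<Prod>a\<in>#M. gens (Pt a))) 1"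
proof (cases P)
  case Infinity
  then show ?thesis
    by (intro exI[of _ "{#}"]) (simp add: same_class_refl)
next
  case (Affine a b)
  then have on: "b ^ 2 = poly fL a"
    using P by (simp add: Affine_points_iff)
  show ?thesis
  proof (cases "ev a b U = 0")
    case True
    then have b: "b = poly W a"
      by (simp add: ev_U)
    then have "poly (fL - W ^ 2) a = 0"
      using on by simp
    then obtain e where e: "a = const_T e" "poly D e = 0"
      unfolding fL_W using root_is_const[OF D_neq_0] by blast
    then have "P = Pt e" "e \<in># roots_D"
      by (simp_all add: Affine Pt_def b set_roots_D)
    have "(\<Prod>a\<in>#roots_D. gens (Pt a)) = (\<Prod>a\<in>#add_mset e (roots_D - {#e#}). gens (Pt a))"
      using \<open>e \<in># roots_D\<close> by (simp only: insert_DiffM)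
    also have "\<dots> = gens P * (\<Prod>a\<in>#roots_D - {#e#}. gens (Pt a))"
      by (simp add: \<open>P = Pt e\<close>)
    finally have "same_class (gens P * (\<Prod>a\<in>#roots_D - {#e#}. gens (Pt a))) 1"
      using same_class_singleton[OF U_neq_0 span_roots_D] by simp
    then show ?thesis
      by (intro exI[of _ "roots_D - {#e#}"]) (auto dest: in_diffD)
  next
    case False
    obtain G where G: "G \<noteq> 0" "ev a b (to_fract G) = 0" "\<And>H. ev a b (to_fract H) = 0 \<Longrightarrow> G dvd H"
      using kernel_principal[OF on False] by blast
    define g where "g = to_fract G"
    have g0: "g \<noteq> 0" using G by (simp add: g_def)
    have gP: "g \<in> ideal_span (gens P)"
      unfolding Affine mem_ideal_iff[OF on] using G(2) to_fract_in_S by (simp add: g_def)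
    have in_g: "\<exists>n. U ^ n * z \<in> ideal_span {g}" if "z \<in> ideal_span (gens P)" for z
      using that vanishing_in_generator[OF on G(3)] unfolding Affine mem_ideal_iff[OF on] g_def by blast
    obtain n1 n2 where n: "U ^ n1 * (xF - iota a) \<in> ideal_span {g}" "U ^ n2 * (eta - iota b) \<in> ideal_span {g}"
      using in_g[of "xF - iota a"] in_g[of "eta - iota b"] span_base[of _ "gens P"] by (auto simp: Affine)
    define n where "n = n1 + n2"
    have "U ^ n2 * (U ^ n1 * (xF - iota a)) \<in> ideal_span {g}"
      "U ^ n1 * (U ^ n2 * (eta - iota b)) \<in> ideal_span {g}"
      by (intro span_smult S_power U_in_S n)+
    then have "U ^ n * (xF - iota a) \<in> ideal_span {g}" "U ^ n * (eta - iota b) \<in> ideal_span {g}"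
      by (simp_all only: n_def power_add ac_simps)
    then have "U ^ n * v \<in> ideal_span {g}" if "v \<in> gens P" for v
      using that by (auto simp only: Affine gens.simps insert_iff empty_iff)
    then have Un: "ideal_span ({U ^ n} * gens P) \<subseteq> ideal_span {g}"
      by (intro span_least) (auto simp: set_times_def)
    define t where "t = vert P"
    note t = vert[OF P, folded t_def]
    \<comment> \<open>This is the ideal generated by \<open>g\<close>, divided by the ideal of \<open>P\<close>.\<close>
    define J where "J = {inverse t} * (gens (neg P) * {g})"
    have scale: "ideal_span ({inverse t} * (gens (neg P) * V)) \<subseteq> ideal_span ({inverse t} * (gens (neg P) * V'))"
      if "ideal_span V \<subseteq> ideal_span V'" for V V'
      using that by (intro span_times_mono) auto
    have "ideal_span J \<subseteq> ideal_span ({inverse t} * (gens (neg P) * (gens P * 1)))"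
      unfolding J_def using gP by (intro scale span_least) simp
    then have JS: "ideal_span J \<subseteq> S"
      unfolding t_def cancel_point[OF P] by (simp add: ideal_span_one)
    have "ideal_span {U ^ n} = ideal_span ({inverse t} * (gens (neg P) * (gens P * {U ^ n})))"
      unfolding t_def cancel_point[OF P] ..
    also have "\<dots> \<subseteq> ideal_span J"
      unfolding J_def using Un by (intro scale) (simp add: mult.commute)
    finally have "ideal_span (\<Prod>Q\<in>#image_mset Pt (repeat_mset n roots_D). gens Q) \<subseteq> ideal_span J"
      by (simp only: span_roots_D_power)
    moreover have "Q \<in> points fL" if "Q \<in># image_mset Pt (repeat_mset n roots_D)" for Q
      using that Pt_points repeat_mset_memD by fastforce
    ultimately obtain M' where M': "M' \<subseteq># image_mset Pt (repeat_mset n roots_D)"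
      "ideal_span J = ideal_span (\<Prod>Q\<in>#M'. gens Q)"
      using subproduct[of "image_mset Pt (repeat_mset n roots_D)" J] JS by blast
    obtain M where M: "M \<subseteq># repeat_mset n roots_D" "M' = image_mset Pt M"
      using subset_image_msetD[OF M'(1)] by blast
    have "ideal_span (gens P * (\<Prod>a\<in>#M. gens (Pt a))) = ideal_span (gens P * J)"
      using M' by (intro span_times_cong) (simp_all add: M(2) multiset.map_comp comp_def)
    also have "\<dots> = ideal_span ((gens P * gens (neg P)) * ({inverse t} * {g}))"
      unfolding J_def by (simp only: ac_simps)
    also have "\<dots> = ideal_span ({t} * ({inverse t} * {g}))"
      by (rule span_times_cong[OF t(2) refl])
    also have "{t} * ({inverse t} * {g}) = {g}"
      using t(1) by (simp add: singleton_times)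
    finally have "same_class (gens P * (\<Prod>a\<in>#M. gens (Pt a))) 1"
      by (rule same_class_singleton[OF g0])
    moreover have "set_mset M \<subseteq> set_mset roots_D"
      using set_mset_mono[OF M(1)] repeat_mset_memD by fastforce
    ultimately show ?thesis
      by blast
  qed
qed

section \<open>Relations between the generators\<close>

text \<open>The polynomial \<open>u (T - t)\<close> in \<open>x\<close> and \<open>u\<close>,
  normalized to be monic in \<open>u\<close>.\<close>

definition pi_poly :: "'a \<Rightarrow> 'a poly poly" where
  "pi_poly t = [:- D, smult (1 / s) B + [:2 * s * t:], 1:]"

lemma to_fract_pi: "to_fract (pi_poly t) = - cx [:2 * s:] * (U * (tau - cx [:t:]))"
proof -
  have "U * tau * cx [:2 * s:] = cx D - U * U - U * cx (smult (1 / s) B)"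
    using U_neq_0 s_neq_0 by (simp add: tau_def field_simps cc_neq_0)
  then have "cx D = U * tau * cx [:2 * s:] + U * U + U * cx (smult (1 / s) B)"
    by (simp add: algebra_simps)
  moreover have "cx [:2 * s * t:] = cx [:2 * s:] * cx [:t:]"
    by (simp add: ac_simps flip: cx.hom_mult)
  moreover have "to_fract (pi_poly t) = - cx D + U * (cx (smult (1 / s) B) + cx [:2 * s * t:] + U)"
    by (simp add: pi_poly_def to_fract_pCons cx.hom_minus cx.hom_add cx.hom_one cx.hom_zero)
  ultimately show ?thesis
    by (simp only:) (simp add: algebra_simps)
qed

text \<open>This is the irreducibility of the fibre \<open>T = t\<close>. A root \<open>r\<close>
  of this quadratic polynomial in \<open>u\<close> would make its discriminant
  \<open>4 (s\<^sup>2 t\<^sup>2 + t B + C)\<close> a square, but the discriminant has degree three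
  in \<open>x\<close>.\<close>

lemma irreducible_pi: "irreducible (pi_poly t)"
proof (rule irreducibleI)
  show "pi_poly t \<noteq> 0"
    by (simp add: pi_poly_def)
  show "\<not> pi_poly t dvd 1"
    by (auto simp: pi_poly_def is_unit_poly_iff)
  fix p q assume pq: "pi_poly t = p * q"
  have nz: "p \<noteq> 0" "q \<noteq> 0"
    using pq by (auto simp: pi_poly_def)
  have deg: "Polynomial.degree p + Polynomial.degree q = 2"
  proof -
    have "Polynomial.degree (pi_poly t) = 2"
      by (simp add: pi_poly_def)
    then show ?thesis
      using degree_mult_eq[OF nz] pq by simp
  qed
  have lc: "lead_coeff p * lead_coeff q = 1"
  proof -
    have "lead_coeff (pi_poly t) = 1"
      by (simp add: pi_poly_def)
    then show ?thesis
      using lead_coeff_mult[of p q] pq by simp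
  qed
  have no_root: "poly (pi_poly t) r \<noteq> 0" for r
  proof
    assume r: "poly (pi_poly t) r = 0"
    define \<beta> where "\<beta> = smult (1 / s) B + [:2 * s * t:]"
    define f where "f = C + (smult t B + [:s ^ 2 * t ^ 2:])"
    have eq: "r ^ 2 + \<beta> * r = D"
      using r by (simp add: pi_poly_def \<beta>_def algebra_simps power2_eq_square)
    have b2: "\<beta> ^ 2 = smult (1 / s ^ 2) (B ^ 2) + smult (4 * t) B + [:4 * s ^ 2 * t ^ 2:]"
    proof -
      have "\<beta> ^ 2 = smult (1 / s) B * smult (1 / s) B
          + (smult (1 / s) B * [:2 * s * t:] + [:2 * s * t:] * smult (1 / s) B) + [:2 * s * t:] * [:2 * s * t:]"
        by (simp only: \<beta>_def power2_eq_square distrib_left distrib_right ac_simps)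
      also have "smult (1 / s) B * [:2 * s * t:] + [:2 * s * t:] * smult (1 / s) B = smult (2 * t + 2 * t) B"
        unfolding smult_add_left using s_neq_0 by simp
      finally show ?thesis
        by (simp add: power2_eq_square ac_simps)
    qed
    have "(2 * r + \<beta>) ^ 2 = 4 * (r ^ 2 + \<beta> * r) + \<beta> ^ 2"
      by (simp add: power2_eq_square algebra_simps)
    also have "\<dots> = smult 4 D + (smult (1 / s ^ 2) (B ^ 2) + smult (4 * t) B + [:4 * s ^ 2 * t ^ 2:])"
      unfolding eq b2 by (simp add: numeral_poly)
    also have "\<dots> = smult 4 f"
      by (simp add: D_def f_def smult_diff_right smult_add_right)
    finally have sq: "(2 * r + \<beta>) ^ 2 = smult 4 f" .
    have "Polynomial.degree (smult t B + [:s ^ 2 * t ^ 2:]) \<le> 2"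
      using degree_B by (intro degree_add_le) (auto intro: order_trans[OF degree_smult_le])
    then have "Polynomial.degree f = 3"
      unfolding f_def using degree_C by (subst degree_add_eq_left) auto
    then have "Polynomial.degree ((2 * r + \<beta>) ^ 2) = 3"
      by (simp add: sq)
    then have "2 * Polynomial.degree (2 * r + \<beta>) = 3"
      by (cases "2 * r + \<beta> = 0") (simp_all add: degree_power_eq)
    then show False
      by presburger
  qed
  have no_linear: False if "Polynomial.degree p = 1" "pi_poly t = p * q" "lead_coeff p * lead_coeff q = 1" for p q
  proof -
    obtain p0 p' where p': "p = pCons p0 p'" by (cases p)
    then have "Polynomial.degree p' = 0"
      using that by (auto split: if_splits)
    then obtain p1 where "p' = [:p1:]"
      by (elim degree_eq_zeroE)
    then have p: "p = [:p0, p1:]" "p1 \<noteq> 0"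
      using p' that(1) by (auto split: if_splits)
    define r where "r = - p0 * lead_coeff q"
    have "poly p r = p0 - (p1 * lead_coeff q) * p0"
      by (simp add: p r_def algebra_simps)
    also have "p1 * lead_coeff q = 1"
      using that p by simp
    finally have "poly p r = 0"
      by simp
    then show False
      using no_root[of r] that by simp
  qed
  have unit: "p dvd 1" if "Polynomial.degree p = 0" "lead_coeff p dvd 1" for p :: "'a poly poly"
    using that by (auto elim!: degree_eq_zeroE simp: is_unit_const_poly_iff)
  consider "Polynomial.degree p = 0" | "Polynomial.degree q = 0" | "Polynomial.degree p = 1"
    using deg by linarith
  then show "p dvd 1 \<or> q dvd 1"
  proof cases
    case 1
    then show ?thesis using unit[of p] lc by (metis dvd_triv_left)
  next
    case 2
    then show ?thesis using unit[of q] lc by (metis dvd_triv_right)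
  next
    case 3
    then show ?thesis using no_linear[of p q] pq lc by blast
  qed
qed

lemma prime_pi: "prime_elem (pi_poly t)"
  by (rule irreducible_imp_prime_poly[OF irreducible_pi])

lemma prime_u: "prime_elem ([:0, 1:] :: 'a poly poly)"
proof (rule prime_elemI)
  have dvd_iff: "[:0, 1:] dvd p \<longleftrightarrow> poly p 0 = 0" for p :: "'a poly poly"
    using poly_eq_0_iff_dvd[of p 0] by simp
  show "[:0, 1:] dvd p \<or> [:0, 1:] dvd q" if "[:0, 1:] dvd p * q" for p q :: "'a poly poly"
    using that unfolding dvd_iff by simp
qed (auto simp: is_unit_poly_iff)

text \<open>Functions of the form \<open>c(T) u\<^sup>j\<close> with an integral exponent
  \<open>j\<close>.\<close>

definition mono :: "'a poly poly fract \<Rightarrow> bool" where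
  "mono z \<longleftrightarrow> (\<exists>l i j. l \<noteq> 0 \<and> z * U ^ i = iota l * U ^ j)"

lemma monoI: "l \<noteq> 0 \<Longrightarrow> z * U ^ i = iota l * U ^ j \<Longrightarrow> mono z"
  unfolding mono_def by blast

lemma mono_mult: assumes "mono z" "mono w" shows "mono (z * w)"
proof -
  obtain l i j l' i' j' where *: "l \<noteq> 0" "l' \<noteq> 0" "z * U ^ i = iota l * U ^ j" "w * U ^ i' = iota l' * U ^ j'"
    using assms unfolding mono_def by blast
  have "(z * w) * U ^ (i + i') = (z * U ^ i) * (w * U ^ i')"
    by (simp add: power_add)
  also have "\<dots> = iota (l * l') * U ^ (j + j')"
    unfolding * by (simp add: power_add io.hom_mult)
  finally show ?thesis
    using * by (intro monoI[of "l * l'"]) auto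
qed

lemma mono_prod_mset: "(\<And>q. q \<in># Q \<Longrightarrow> mono (to_fract q)) \<Longrightarrow> mono (to_fract (prod_mset Q))"
proof (induction Q)
  case empty
  show ?case by (rule monoI[of 1 _ 0 0]) (simp_all add: io.hom_one)
qed (simp add: mono_mult)

lemma mono_pi: "mono (to_fract (pi_poly t))"
proof (rule monoI[of "- const_T (2 * s) * (var_T - const_T t)" _ 0 1])
  show "- const_T (2 * s) * (var_T - const_T t) \<noteq> 0"
    using var_T_not_const[of t] s_neq_0 by (simp add: ct.hom_0_iff)
qed (simp add: to_fract_pi io.hom_mult io.hom_minus io.hom_diff iota_const iota_var)

lemma mono_u: "mono (to_fract [:0, 1:])"
  by (rule monoI[of 1 _ 0 1]) (simp_all add: io.hom_one U_def)

lemma mono_unit: assumes "k dvd 1" shows "mono (to_fract k)"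
proof -
  obtain c where c: "k = [:[:c:]:]" "c \<noteq> 0"
    using assms by (force simp: is_unit_poly_iff)
  then show ?thesis
    by (intro monoI[of "const_T c" _ 0 0]) (simp_all add: iota_const ct.hom_0_iff flip: cx_def)
qed

text \<open>After clearing denominators, \<open>h\<close> is a polynomial that divides a product
  of a power of \<open>u\<close> and polynomials \<open>u (T - t)\<close>. These are prime
  elements, so \<open>h\<close> is itself such a product up to a constant.\<close>

lemma divisor_of_U_power:
  assumes h: "h \<in> S" "h' \<in> S" "h * h' = U ^ N"
  shows "mono h"
proof -
  obtain c n H where H: "c \<noteq> 0" "tau_ev c * U ^ n * h = to_fract H"
    using clear_denominators[OF h(1)] by blast
  obtain c' n' H' where H': "c' \<noteq> 0" "tau_ev c' * U ^ n' * h' = to_fract H'"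
    using clear_denominators[OF h(2)] by blast
  define e where "e = c * c'"
  have e0: "e \<noteq> 0" using H H' by (simp add: e_def)
  obtain R where R: "e = smult (lead_coeff e) (\<Prod>t\<in>#R. [:- t, 1:])"
    using alg_closed_imp_factorization[OF e0] by blast
  define k where "k = lead_coeff e"
  have k0: "k \<noteq> 0" using e0 by (simp add: k_def)
  define m where "m = n + n' + N"
  \<comment> \<open>The factor that turns \<open>T - t\<close> into the polynomial \<open>pi_poly t\<close>.\<close>
  define d where "d = - cx [:2 * s:] * U"
  have tau_lin: "tau_ev [:- t, 1:] = tau - cx [:t:]" for t
    by (simp add: tau_ev_def cc.map_poly_pCons cx.hom_zero cc.hom_one cc.hom_minus)
  have "tau_ev e = cx [:k:] * (\<Prod>t\<in>#R. tau - cx [:t:])"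
  proof -
    have "tau_ev [:k:] = cx [:k:]"
      by (simp add: tau_ev_def cc.map_poly_pCons)
    moreover have "e = [:k:] * (\<Prod>t\<in>#R. [:- t, 1:])"
      using R by (simp add: k_def)
    ultimately show ?thesis
      by (simp only: te.hom_mult te.hom_prod_mset tau_lin)
  qed
  moreover have "d ^ size R * (\<Prod>t\<in>#R. tau - cx [:t:]) = to_fract (\<Prod>t\<in>#R. pi_poly t)"
  proof (induction R)
    case (add t R)
    have "d ^ size (add_mset t R) * (\<Prod>t\<in>#add_mset t R. tau - cx [:t:])
        = (d * (tau - cx [:t:])) * (d ^ size R * (\<Prod>t\<in>#R. tau - cx [:t:]))"
      by (simp add: ac_simps)
    also have "d * (tau - cx [:t:]) = to_fract (pi_poly t)"
      by (simp add: d_def to_fract_pi mult.assoc)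
    finally show ?case
      using add by simp
  qed simp
  ultimately have de: "d ^ size R * tau_ev e = cx [:k:] * to_fract (\<Prod>t\<in>#R. pi_poly t)"
    by (simp add: ac_simps)
  have "to_fract (H * H') = (tau_ev c * U ^ n * h) * (tau_ev c' * U ^ n' * h')"
    using H H' by simp
  also have "\<dots> = tau_ev e * U ^ (n + n') * (h * h')"
    by (simp add: e_def te.hom_mult power_add ac_simps)
  also have "\<dots> = tau_ev e * U ^ m"
    by (simp add: h m_def power_add)
  finally have "d ^ size R * to_fract (H * H') = cx [:k:] * to_fract (\<Prod>t\<in>#R. pi_poly t) * U ^ m"
    using de by (simp flip: mult.assoc)
  also have "d = to_fract ([:[:- (2 * s):]:] * [:0, 1:])"
    by (simp add: d_def U_def cx_def flip: to_fract_mult to_fract_uminus)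
  also have "U ^ m = to_fract ([:0, 1:] ^ m)"
    by (simp only: U_def idom_emb.hom_power[OF to_fract_emb])
  finally have "to_fract (([:[:- (2 * s):]:] * [:0, 1:]) ^ size R * (H * H'))
      = to_fract ([:[:k:]:] * ((\<Prod>t\<in>#R. pi_poly t) * [:0, 1:] ^ m))"
    by (simp only: cx_def mult.assoc to_fract_mult idom_emb.hom_power[OF to_fract_emb])
  then have *: "([:[:- (2 * s):]:] * [:0, 1:]) ^ size R * (H * H')
      = [:[:k:]:] * ((\<Prod>t\<in>#R. pi_poly t) * [:0, 1:] ^ m)"
    by (simp only: to_fract_eq_iff)
  define Q where "Q = image_mset pi_poly R + replicate_mset m [:0, 1:]"
  have "prod_mset Q = (\<Prod>t\<in>#R. pi_poly t) * [:0, 1:] ^ m"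
    by (simp add: Q_def)
  then have "H dvd [:[:k:]:] * prod_mset Q"
    using * by (metis dvd_triv_left dvd_mult mult.left_commute)
  moreover have "\<forall>q\<in>#Q. prime_elem q"
    using prime_pi prime_u by (auto simp: Q_def split: if_splits)
  moreover have "is_unit [:[:k:]:]"
    using k0 by (simp add: is_unit_const_poly_iff dvd_field_iff)
  ultimately obtain Q' k' where Q': "Q' \<subseteq># Q" "is_unit k'" "H = k' * prod_mset Q'"
    using dvd_prime_product[of Q "[:[:k:]:]" H] by blast
  have "mono (to_fract q)" if "q \<in># Q'" for q
    using mset_subset_eqD[OF Q'(1) that] mono_pi mono_u by (auto simp: Q_def split: if_splits)
  then have "mono (to_fract H)"
    using mono_mult[OF mono_unit[OF Q'(2)] mono_prod_mset[of Q']] Q'(3) by simp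
  then obtain l i j where l: "l \<noteq> 0" "to_fract H * U ^ i = iota l * U ^ j"
    unfolding mono_def by blast
  have c: "tau_ev c \<noteq> 0"
    using H by (simp add: te.hom_0_iff)
  have "tau_ev c * (h * U ^ (n + i)) = iota l * U ^ j"
    using l(2) by (simp add: power_add ac_simps flip: H(2))
  then have "h * U ^ (n + i) = iota (l / to_fract c) * U ^ j"
    using c by (simp add: io.hom_divide iota_to_fract field_simps)
  then show ?thesis
    using l H by (intro monoI[of "l / to_fract c"]) auto
qed

lemma cj_one: "cj 1 = 1"
  using cj_rep[of 1 0] by (simp add: rep_def E.hom_one E.hom_zero)

lemma cj_power: "z \<in> S \<Longrightarrow> cj (z ^ n) = cj z ^ n"
  by (induction n) (simp_all add: cj_one cj_mult S_power)

text \<open>A generator \<open>h\<close> of the product divides a power of \<open>u\<close>, so it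
  has the form \<open>c(T) u\<^sup>j\<close>. The norms of \<open>h\<close> and of
  \<open>u\<^sup>j\<close> therefore have the same roots; these are \<open>M\<close> and
  \<open>j\<close> copies of the roots of \<open>D\<close>.\<close>

theorem relations_between_generators:
  assumes M: "set_mset M \<subseteq> set_mset roots_D" and "same_class (\<Prod>a\<in>#M. gens (Pt a)) 1"
  shows "\<exists>j. M = repeat_mset j roots_D"
proof -
  obtain h where h0: "h \<noteq> 0" and h: "ideal_span (\<Prod>a\<in>#M. gens (Pt a)) = ideal_span {h}"
    using same_class_1D[OF assms(2)] by blast
  have "(\<Prod>a\<in>#M. gens (Pt a)) \<subseteq> S" for M
    by (induction M) (simp_all add: S_one span_S_subset gens_subset_S, simp add: set_one S_one)
  then have sub_S: "ideal_span (\<Prod>a\<in>#M. gens (Pt a)) \<subseteq> S" for M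
    by (rule span_subset_S)
  have hS: "h \<in> S"
    using sub_S[of M] h span_base[of h "{h}"] by auto
  then obtain p q where pq: "h = rep p q"
    unfolding S_def by blast
  \<comment> \<open>Every root of \<open>D\<close> has multiplicity at least one, so \<open>size M\<close> copies of the roots contain \<open>M\<close>.\<close>
  have "M \<subseteq># repeat_mset (size M) roots_D"
  proof (rule mset_subset_eqI)
    fix a
    show "count M a \<le> count (repeat_mset (size M) roots_D) a"
    proof (cases "a \<in># M")
      case True
      then have "count roots_D a \<ge> 1"
        using M by (auto simp: Suc_le_eq)
      then have "size M * 1 \<le> size M * count roots_D a"
        by (rule mult_le_mono2)
      then show ?thesis
        by (metis count_le_size count_repeat_mset le_trans mult.right_neutral)
    qed (simp add: not_in_iff)
  qed
  then obtain M' where M': "repeat_mset (size M) roots_D = M + M'"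
    by (metis subset_mset.add_diff_inverse)
  have "ideal_span {U ^ size M} = ideal_span ((\<Prod>a\<in>#M. gens (Pt a)) * (\<Prod>a\<in>#M'. gens (Pt a)))"
    unfolding span_roots_D_power[symmetric] M' by (simp add: multiset.map_comp comp_def)
  also have "\<dots> \<subseteq> ideal_span ({h} * 1)"
    using h sub_S[of M'] by (intro span_times_mono) (auto simp: ideal_span_one)
  finally have "U ^ size M \<in> ideal_span {h}"
    using span_base[of "U ^ size M" "{U ^ size M}"] by auto
  then obtain h' where h': "h' \<in> S" "h * h' = U ^ size M"
    by (auto simp: span_singleton)
  obtain l i j where l: "l \<noteq> 0" "h * U ^ i = iota l * U ^ j"
    using divisor_of_U_power[OF hS h'] unfolding mono_def by blast
  define md where "md = map_poly const_T D"
  have "U * cj U = E ((- W) ^ 2 - fL * 1 ^ 2)"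
    unfolding U_rep by (rule rep_times_cj)
  also have "(- W) ^ 2 - fL * 1 ^ 2 = - md"
    by (simp add: md_def flip: fL_W)
  finally have UU: "U * cj U = E (- md)" .
  have ll: "iota l * cj (iota l) = E [:l ^ 2:]"
  proof -
    have "iota l = rep [:l:] 0"
      by (simp add: rep_def E_const E.hom_zero)
    then have "iota l * cj (iota l) = E ([:l:] ^ 2 - fL * 0 ^ 2)"
      using rep_times_cj[of "[:l:]" 0] by simp
    then show ?thesis
      by (simp add: power2_eq_square)
  qed
  have "E (p ^ 2 - fL * q ^ 2) * (U * cj U) ^ i = (h * U ^ i) * cj (h * U ^ i)"
  proof -
    have "E (p ^ 2 - fL * q ^ 2) = h * cj h"
      by (simp only: pq rep_times_cj)
    then show ?thesis
      using hS by (simp only:) (simp add: cj_mult cj_power S_power U_in_S power_mult_distrib ac_simps)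
  qed
  also have "\<dots> = (iota l * cj (iota l)) * (U * cj U) ^ j"
    unfolding l(2) by (simp add: cj_mult cj_power S_power U_in_S iota_in_S power_mult_distrib ac_simps)
  finally have "E ((p ^ 2 - fL * q ^ 2) * (- md) ^ i) = E ([:l ^ 2:] * (- md) ^ j)"
    by (simp only: UU ll E.hom_mult E.hom_power)
  then have eq: "(p ^ 2 - fL * q ^ 2) * (- md) ^ i = [:l ^ 2:] * (- md) ^ j"
    by (simp only: E.hom_eq_iff)
  define A where "A = image_mset (\<lambda>a. (const_T a, poly W (const_T a))) M"
  have "\<exists>c. c \<noteq> 0 \<and> p ^ 2 - fL * q ^ 2 = smult c (\<Prod>z\<in>#A. [:- fst z, 1:])"
  proof (rule norm_of_generator)
    show "snd z ^ 2 = poly fL (fst z)" if "z \<in># A" for z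
      using that M Pt_points by (force simp: A_def Pt_def Affine_points_iff)
    show "ideal_span (\<Prod>z\<in>#A. gens (Affine (fst z) (snd z))) = ideal_span {rep p q}"
      using h by (simp add: A_def pq Pt_def multiset.map_comp comp_def del: gens.simps)
  qed
  then obtain c where c: "c \<noteq> 0" "p ^ 2 - fL * q ^ 2 = smult c (\<Prod>b\<in>#image_mset const_T M. [:- b, 1:])"
    by (auto simp: A_def multiset.map_comp comp_def)
  have roots1: "proots (p ^ 2 - fL * q ^ 2) = image_mset const_T M" "p ^ 2 - fL * q ^ 2 \<noteq> 0"
    using c proots_prod_linear[of "image_mset const_T M"] prod_linear_neq_0[of "image_mset const_T M"]
    by simp_all
  have md: "md = smult (const_T (lead_coeff D)) (\<Prod>b\<in>#image_mset const_T roots_D. [:- b, 1:])"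
    using fL_W fL_W_factor by (simp add: md_def)
  have lc: "const_T (lead_coeff D) \<noteq> 0"
    using D_neq_0 by (simp add: ct.hom_0_iff)
  have roots2: "proots (- md) = image_mset const_T roots_D" "- md \<noteq> 0"
    using md lc proots_prod_linear[of "image_mset const_T roots_D"] prod_linear_neq_0[of "image_mset const_T roots_D"]
    by simp_all
  have "proots ((p ^ 2 - fL * q ^ 2) * (- md) ^ i)
      = image_mset const_T M + repeat_mset i (image_mset const_T roots_D)"
    using roots1 roots2 by (subst proots_mult) (simp_all add: proots_power)
  moreover have "proots ([:l ^ 2:] * (- md) ^ j) = repeat_mset j (image_mset const_T roots_D)"
    using l(1) roots2 by (subst proots_mult) (simp_all add: proots_power)
  ultimately have "image_mset const_T M + repeat_mset i (image_mset const_T roots_D)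
      = repeat_mset j (image_mset const_T roots_D)"
    unfolding eq by simp
  moreover have "repeat_mset n (image_mset const_T roots_D) = image_mset const_T (repeat_mset n roots_D)" for n
    by (induction n) simp_all
  ultimately have "image_mset const_T (M + repeat_mset i roots_D) = (image_mset const_T (repeat_mset j roots_D) :: 'a poly fract multiset)"
    by simp
  moreover have "inj (const_T :: 'a \<Rightarrow> 'a poly fract)"
    by (rule injI) (simp add: ct.hom_eq_iff)
  ultimately have "M + repeat_mset i roots_D = repeat_mset j roots_D"
    by (metis multiset.inj_map injD)
  then have "count M a + i * count roots_D a = j * count roots_D a" for a
    by (metis count_union count_repeat_mset)
  then have "count M a = (j - i) * count roots_D a" for a
    by (metis add_diff_cancel_right' diff_mult_distrib)
  then have "M = repeat_mset (j - i) roots_D"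
    by (intro multiset_eqI) simp
  then show ?thesis ..
qed

end

section \<open>Automorphisms of the algebraic closure\<close>

text \<open>The graph of a homomorphism over the base field from a subring of the algebraic
  closure. All elements are algebraic, so such a subring is a field and the homomorphism is
  injective. As graphs are sets, they can be extended by Zorn's lemma.\<close>

definition partial_hom :: "('k::field alg_closure \<times> 'k alg_closure) set \<Rightarrow> bool" where
  "partial_hom \<Gamma> \<longleftrightarrow> (\<forall>c. (to_ac c, to_ac c) \<in> \<Gamma>)
     \<and> (\<forall>a b a' b'. (a, b) \<in> \<Gamma> \<longrightarrow> (a', b') \<in> \<Gamma> \<longrightarrow> (a + a', b + b') \<in> \<Gamma> \<and> (a * a', b * b') \<in> \<Gamma>)
     \<and> (\<forall>a b b'. (a, b) \<in> \<Gamma> \<longrightarrow> (a, b') \<in> \<Gamma> \<longrightarrow> b = b')"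

definition poly_rel :: "('k::field alg_closure \<times> 'k alg_closure) set \<Rightarrow> 'k alg_closure poly \<Rightarrow> 'k alg_closure poly \<Rightarrow> bool" where
  "poly_rel \<Gamma> p q \<longleftrightarrow> (\<forall>i. (Polynomial.coeff p i, Polynomial.coeff q i) \<in> \<Gamma>)"

text \<open>Take an algebraic equation for \<open>a\<close>, divide it by the largest possible
  power of \<open>a\<close>, and solve for the constant term.\<close>

lemma inverse_is_polynomial:
  fixes a :: "'k::field alg_closure"
  assumes "a \<noteq> 0"
  shows "\<exists>r. a * poly (map_poly to_ac r) a = 1"
proof -
  obtain p where p: "p \<noteq> 0" "poly (map_poly to_ac p) a = 0"
    using alg_closure_algebraic by blast
  from p show ?thesis
  proof (induction p)
    case 0
    then show ?case by simp
  next
    case (pCons c p)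
    have eq: "to_ac c + a * poly (map_poly to_ac p) a = 0"
      using pCons.prems by (simp add: idom_emb.map_poly_pCons[OF field_emb.axioms[OF to_ac_emb]])
    show ?case
    proof (cases "c = 0")
      case True
      then have "poly (map_poly to_ac p) a = 0" "p \<noteq> 0"
        using eq assms pCons.prems by auto
      then show ?thesis
        using pCons.IH by blast
    next
      case False
      have "a * poly (map_poly to_ac (smult (- inverse c) p)) a
          = - to_ac (inverse c) * (a * poly (map_poly to_ac p) a)"
        by (simp only: idom_emb.map_poly_smult[OF field_emb.axioms[OF to_ac_emb]]) simp
      also have "a * poly (map_poly to_ac p) a = - to_ac c"
        using eq by (simp add: eq_neg_iff_add_eq_0 add.commute)
      also have "- to_ac (inverse c) * - to_ac c = 1"
        using False by simp
      finally show ?thesis by blast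
    qed
  qed
qed

context
  fixes \<Gamma> :: "('k::field alg_closure \<times> 'k alg_closure) set"
  assumes \<Gamma>: "partial_hom \<Gamma>"
begin

lemma ph_const: "(to_ac c, to_ac c) \<in> \<Gamma>"
  and ph_add: "(a, b) \<in> \<Gamma> \<Longrightarrow> (a', b') \<in> \<Gamma> \<Longrightarrow> (a + a', b + b') \<in> \<Gamma>"
  and ph_mult: "(a, b) \<in> \<Gamma> \<Longrightarrow> (a', b') \<in> \<Gamma> \<Longrightarrow> (a * a', b * b') \<in> \<Gamma>"
  and ph_unique: "(a, b) \<in> \<Gamma> \<Longrightarrow> (a, b') \<in> \<Gamma> \<Longrightarrow> b = b'"
  using \<Gamma> unfolding partial_hom_def by blast+

lemma ph_0: "(0, 0) \<in> \<Gamma>" and ph_1: "(1, 1) \<in> \<Gamma>"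
  using ph_const[of 0] ph_const[of 1] by simp_all

lemma ph_minus: "(a, b) \<in> \<Gamma> \<Longrightarrow> (- a, - b) \<in> \<Gamma>"
  using ph_mult[OF ph_const[of "- 1"], of a b] by simp

lemma ph_diff: "(a, b) \<in> \<Gamma> \<Longrightarrow> (a', b') \<in> \<Gamma> \<Longrightarrow> (a - a', b - b') \<in> \<Gamma>"
  using ph_add[of a b "- a'" "- b'"] ph_minus[of a' b'] by simp

lemma ph_poly: "(a, b) \<in> \<Gamma> \<Longrightarrow> (poly (map_poly to_ac r) a, poly (map_poly to_ac r) b) \<in> \<Gamma>"
  by (induction r)
    (simp_all add: ph_0 ph_add ph_mult ph_const idom_emb.map_poly_pCons[OF field_emb.axioms[OF to_ac_emb]])

lemma ph_inj: assumes "(a, 0) \<in> \<Gamma>" shows "a = 0"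
proof (rule ccontr)
  assume "a \<noteq> 0"
  then obtain r where "a * poly (map_poly to_ac r) a = 1"
    using inverse_is_polynomial by blast
  then have "(1, 0) \<in> \<Gamma>"
    using ph_mult[OF assms ph_poly[OF assms, of r]] by simp
  then show False
    using ph_unique[OF ph_1] by fastforce
qed

lemma pr_diff: "poly_rel \<Gamma> p q \<Longrightarrow> poly_rel \<Gamma> p' q' \<Longrightarrow> poly_rel \<Gamma> (p - p') (q - q')"
  and pr_add: "poly_rel \<Gamma> p q \<Longrightarrow> poly_rel \<Gamma> p' q' \<Longrightarrow> poly_rel \<Gamma> (p + p') (q + q')"
  by (auto simp: poly_rel_def intro: ph_diff ph_add)

lemma ph_sum: "finite A \<Longrightarrow> (\<And>i. i \<in> A \<Longrightarrow> (g i, h i) \<in> \<Gamma>) \<Longrightarrow> (sum g A, sum h A) \<in> \<Gamma>"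
  by (induction A rule: finite_induct) (auto intro: ph_0 ph_add)

lemma pr_mult: "poly_rel \<Gamma> p q \<Longrightarrow> poly_rel \<Gamma> p' q' \<Longrightarrow> poly_rel \<Gamma> (p * p') (q * q')"
  by (auto simp: poly_rel_def coeff_mult intro!: ph_sum ph_mult)

lemma pr_const: "(a, b) \<in> \<Gamma> \<Longrightarrow> poly_rel \<Gamma> [:a:] [:b:]"
  by (auto simp: poly_rel_def coeff_pCons ph_0 split: nat.split)

lemma pr_X: "poly_rel \<Gamma> [:0, 1:] [:0, 1:]"
  by (auto simp: poly_rel_def coeff_pCons ph_0 ph_1 split: nat.split)

lemma pr_monom: "(a, b) \<in> \<Gamma> \<Longrightarrow> poly_rel \<Gamma> (Polynomial.monom a n) (Polynomial.monom b n)"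
  by (auto simp: poly_rel_def coeff_monom ph_0)

lemma pr_degree: assumes "poly_rel \<Gamma> p q" shows "Polynomial.degree q = Polynomial.degree p"
proof -
  have "Polynomial.coeff q i = 0 \<longleftrightarrow> Polynomial.coeff p i = 0" for i
    using assms ph_inj ph_unique[OF ph_0] unfolding poly_rel_def by metis
  then show ?thesis
    by (simp add: degree_def)
qed

lemma pr_coeff_0_iff: assumes "poly_rel \<Gamma> p q"
  shows "Polynomial.coeff q i = 0 \<longleftrightarrow> Polynomial.coeff p i = 0"
  using assms ph_inj ph_unique[OF ph_0] unfolding poly_rel_def by metis

text \<open>Divide \<open>p'\<close> by \<open>p\<close> and \<open>q'\<close> by \<open>q\<close>
  in parallel: eliminating the leading terms preserves the relation, and a polynomial of degree
  less than that of \<open>p\<close> that vanishes at \<open>z\<close> is zero by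
  minimality.\<close>

lemma pr_root:
  assumes pq: "poly_rel \<Gamma> p q" "p \<noteq> 0" "poly p z = 0" "poly q w = 0"
    and min: "\<And>p' q'. poly_rel \<Gamma> p' q' \<Longrightarrow> p' \<noteq> 0 \<Longrightarrow> poly p' z = 0 \<Longrightarrow>
      Polynomial.degree p \<le> Polynomial.degree p'"
    and p': "poly_rel \<Gamma> p' q'" "poly p' z = 0"
  shows "poly q' w = 0"
  using p'
proof (induction "Polynomial.degree p'" arbitrary: p' q' rule: less_induct)
  case less
  note lessp = \<open>poly_rel \<Gamma> p' q'\<close> \<open>poly p' z = 0\<close>
  show ?case
  proof (cases "p' = 0")
    case True
    then have "q' = 0"
      using pr_coeff_0_iff[OF lessp(1)] by (intro poly_eqI) simp
    then show ?thesis by simp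
  next
    case False
    define n where "n = Polynomial.degree p'"
    define m where "m = Polynomial.degree p"
    have mn: "m \<le> n"
      using min[OF lessp(1) False lessp(2)] by (simp add: m_def n_def)
    define a where "a = Polynomial.coeff p m"
    define b where "b = Polynomial.coeff q m"
    define a' where "a' = Polynomial.coeff p' n"
    define b' where "b' = Polynomial.coeff q' n"
    have ab: "(a, b) \<in> \<Gamma>" "(a', b') \<in> \<Gamma>"
      using pq(1) lessp(1) by (auto simp: poly_rel_def a_def b_def a'_def b'_def)
    have a0: "a \<noteq> 0"
      using pq(2) by (simp add: a_def m_def)
    then have b0: "b \<noteq> 0"
      using pr_coeff_0_iff[OF pq(1)] by (simp add: a_def b_def)
    define p2 where "p2 = [:a:] * p' - Polynomial.monom a' (n - m) * p"
    define q2 where "q2 = [:b:] * q' - Polynomial.monom b' (n - m) * q"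
    have pr2: "poly_rel \<Gamma> p2 q2"
      unfolding p2_def q2_def by (intro pr_diff pr_mult pr_const pr_monom ab pq(1) lessp(1))
    have z2: "poly p2 z = 0"
      using lessp(2) pq(3) by (simp add: p2_def)
    have "poly q2 w = 0"
    proof (cases "p2 = 0")
      case True
      then have "q2 = 0"
        using pr_coeff_0_iff[OF pr2] by (intro poly_eqI) simp
      then show ?thesis by simp
    next
      case nz: False
      have "Polynomial.coeff p2 i = 0" if "i \<ge> n" for i
      proof (cases "i = n")
        case True
        then show ?thesis
          using mn by (simp add: p2_def coeff_monom_mult a_def a'_def)
      next
        case False
        then have "i > n" "i - (n - m) > m"
          using that mn by auto
        then show ?thesis
          by (simp add: p2_def coeff_monom_mult coeff_eq_0 m_def n_def)
      qed
      then have "Polynomial.degree p2 < n"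
        using nz by (metis leading_coeff_0_iff not_le_imp_less)
      then show ?thesis
        using less.hyps[OF _ pr2 z2] by (simp add: n_def)
    qed
    then have "b * poly q' w = 0"
      using pq(4) by (simp add: q2_def)
    then show ?thesis
      using b0 by simp
  qed
qed

text \<open>Send \<open>p'(z)\<close> to \<open>q'(w)\<close> for related polynomials
  \<open>p'\<close> and \<open>q'\<close>; this is well defined by the previous lemma.\<close>

lemma partial_hom_extend:
  assumes pq: "poly_rel \<Gamma> p q" "p \<noteq> 0" "poly p z = 0" "poly q w = 0"
    and min: "\<And>p' q'. poly_rel \<Gamma> p' q' \<Longrightarrow> p' \<noteq> 0 \<Longrightarrow> poly p' z = 0 \<Longrightarrow>
      Polynomial.degree p \<le> Polynomial.degree p'"
  shows "\<exists>\<Gamma>'. partial_hom \<Gamma>' \<and> \<Gamma> \<subseteq> \<Gamma>' \<and> (z, w) \<in> \<Gamma>'"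
proof (intro exI conjI)
  define \<Gamma>' where "\<Gamma>' = {(poly p' z, poly q' w) | p' q'. poly_rel \<Gamma> p' q'}"
  have I: "(poly p' z, poly q' w) \<in> \<Gamma>'" if "poly_rel \<Gamma> p' q'" for p' q'
    using that by (auto simp: \<Gamma>'_def)
  show sub: "\<Gamma> \<subseteq> \<Gamma>'"
  proof (rule subrelI)
    fix a b assume "(a, b) \<in> \<Gamma>"
    then show "(a, b) \<in> \<Gamma>'"
      using I[OF pr_const] by simp
  qed
  show "(z, w) \<in> \<Gamma>'"
    using I[OF pr_X] by simp
  show "partial_hom \<Gamma>'"
    unfolding partial_hom_def
  proof (intro conjI allI impI)
    show "(to_ac c, to_ac c) \<in> \<Gamma>'" for c
      using sub ph_const by blast
  next
    fix a b a' b' assume "(a, b) \<in> \<Gamma>'" "(a', b') \<in> \<Gamma>'"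
    then obtain p1 q1 p2 q2 where *: "poly_rel \<Gamma> p1 q1" "poly_rel \<Gamma> p2 q2"
      "a = poly p1 z" "b = poly q1 w" "a' = poly p2 z" "b' = poly q2 w"
      by (auto simp: \<Gamma>'_def)
    show "(a + a', b + b') \<in> \<Gamma>'" "(a * a', b * b') \<in> \<Gamma>'"
      using I[OF pr_add[OF *(1,2)]] I[OF pr_mult[OF *(1,2)]] * by simp_all
  next
    fix a b b' assume "(a, b) \<in> \<Gamma>'" "(a, b') \<in> \<Gamma>'"
    then obtain p1 q1 p2 q2 where *: "poly_rel \<Gamma> p1 q1" "poly_rel \<Gamma> p2 q2"
      "a = poly p1 z" "b = poly q1 w" "a = poly p2 z" "b' = poly q2 w"
      by (auto simp: \<Gamma>'_def)
    have "poly (q1 - q2) w = 0"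
      by (rule pr_root[OF pq min pr_diff[OF *(1,2)]]) (use * in auto)
    then show "b = b'"
      using * by simp
  qed
qed

lemma minimal_poly_rel:
  obtains p q where "poly_rel \<Gamma> p q" "p \<noteq> 0" "poly p z = 0"
    "\<And>p' q'. poly_rel \<Gamma> p' q' \<Longrightarrow> p' \<noteq> 0 \<Longrightarrow> poly p' z = 0 \<Longrightarrow> Polynomial.degree p \<le> Polynomial.degree p'"
proof -
  obtain r :: "'k poly" where r: "r \<noteq> 0" "poly (map_poly to_ac r) z = 0"
    using alg_closure_algebraic by blast
  let ?P = "\<lambda>p. (\<exists>q. poly_rel \<Gamma> p q) \<and> p \<noteq> 0 \<and> poly p z = 0"
  have "poly_rel \<Gamma> (map_poly to_ac r) (map_poly to_ac r)"
    by (auto simp: poly_rel_def coeff_map_poly ph_const)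
  moreover have "map_poly to_ac r \<noteq> 0"
    using r idom_emb.hom_0_iff[OF idom_emb.map_poly_emb[OF field_emb.axioms[OF to_ac_emb]]] by blast
  ultimately have "?P (map_poly to_ac r)"
    using r by blast
  from ex_has_least_nat[of ?P, OF this, of Polynomial.degree]
  show ?thesis using that by blast
qed

end

text \<open>A maximal partial homomorphism is total: for a missing element, the image of its
  minimal polynomial has a root, which can be chosen as a value.\<close>

lemma partial_hom_maximal:
  assumes "partial_hom \<Gamma>0"
  obtains \<Gamma> where "partial_hom \<Gamma>" "\<Gamma>0 \<subseteq> \<Gamma>" "\<And>z. \<exists>w. (z, w) \<in> \<Gamma>"
proof -
  define \<A> where "\<A> = {\<Gamma>. partial_hom \<Gamma> \<and> \<Gamma>0 \<subseteq> \<Gamma>}"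
  have "\<exists>M\<in>\<A>. \<forall>N\<in>\<A>. M \<subseteq> N \<longrightarrow> N = M"
  proof (rule subset_Zorn_nonempty)
    show "\<A> \<noteq> {}"
      using assms by (auto simp: \<A>_def)
    fix \<C> assume ne: "\<C> \<noteq> {}" and ch: "subset.chain \<A> \<C>"
    have ph: "partial_hom \<Gamma>" "\<Gamma>0 \<subseteq> \<Gamma>" if "\<Gamma> \<in> \<C>" for \<Gamma>
      using that ch by (auto simp: subset.chain_def \<A>_def)
    have common: "\<exists>\<Gamma>\<in>\<C>. u \<in> \<Gamma> \<and> v \<in> \<Gamma>" if "u \<in> \<Union>\<C>" "v \<in> \<Union>\<C>" for u v
      using that ch unfolding subset.chain_def by blast
    have "partial_hom (\<Union>\<C>)"
      unfolding partial_hom_def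
    proof (intro conjI allI impI)
      show "(to_ac c, to_ac c) \<in> \<Union>\<C>" for c
        using ne ph(1) ph_const by blast
      show "(a + a', b + b') \<in> \<Union>\<C>" "(a * a', b * b') \<in> \<Union>\<C>"
        if "(a, b) \<in> \<Union>\<C>" "(a', b') \<in> \<Union>\<C>" for a b a' b'
        using common[OF that] ph(1) ph_add ph_mult by blast+
      show "b = b'" if "(a, b) \<in> \<Union>\<C>" "(a, b') \<in> \<Union>\<C>" for a b b'
        using common[OF that] ph(1) ph_unique by blast
    qed
    then show "\<Union>\<C> \<in> \<A>"
      using ne ph(2) by (auto simp: \<A>_def)
  qed
  then obtain M where M: "partial_hom M" "\<Gamma>0 \<subseteq> M" and max: "\<And>N. partial_hom N \<Longrightarrow> \<Gamma>0 \<subseteq> N \<Longrightarrow> M \<subseteq> N \<Longrightarrow> N = M"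
    by (auto simp: \<A>_def)
  have "\<exists>w. (z, w) \<in> M" for z
  proof -
    obtain p q where pq: "poly_rel M p q" "p \<noteq> 0" "poly p z = 0"
      and min: "\<And>p' q'. poly_rel M p' q' \<Longrightarrow> p' \<noteq> 0 \<Longrightarrow> poly p' z = 0 \<Longrightarrow> Polynomial.degree p \<le> Polynomial.degree p'"
      using minimal_poly_rel[OF M(1), of z] by blast
    have "Polynomial.degree p > 0"
      using pq(2,3) by (metis degree_eq_zeroE gr0I pCons_eq_0_iff poly_const_conv)
    then obtain w where w: "poly q w = 0"
      using alg_closed_imp_poly_has_root[of q] pr_degree[OF M(1) pq(1)] by auto
    obtain N where N: "partial_hom N" "M \<subseteq> N" "(z, w) \<in> N"
      using partial_hom_extend[OF M(1) pq w] min by blast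
    then show ?thesis
      using max[of N] M(2) by blast
  qed
  with that M show ?thesis by blast
qed

lemma absolute_galois_groupI:
  fixes \<sigma> :: "'k::field alg_closure \<Rightarrow> 'k alg_closure"
  assumes "\<And>a b. \<sigma> (a + b) = \<sigma> a + \<sigma> b" "\<And>a b. \<sigma> (a * b) = \<sigma> a * \<sigma> b" "\<And>c. \<sigma> (to_ac c) = to_ac c" "bij \<sigma>"
  shows "\<sigma> \<in> absolute_galois_group"
proof -
  have "\<sigma> 1 = 1"
    using assms(3)[of 1] by simp
  then show ?thesis
    using assms by (simp add: absolute_galois_group_def ring_iso_def ring_hom_def ring_of_type_algebra_def)
qed

lemma galois_emb: assumes "\<sigma> \<in> absolute_galois_group" shows "field_emb \<sigma>"
proof
  have hom: "\<sigma> (a + b) = \<sigma> a + \<sigma> b" "\<sigma> (a * b) = \<sigma> a * \<sigma> b" "\<sigma> 1 = 1" "inj \<sigma>" for a b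
    using assms by (auto simp: absolute_galois_group_def ring_iso_def ring_hom_def
        ring_of_type_algebra_def bij_betw_def)
  then show "\<sigma> (a + b) = \<sigma> a + \<sigma> b" "\<sigma> (a * b) = \<sigma> a * \<sigma> b" "\<sigma> 1 = 1" for a b
    by simp_all
  have "\<sigma> 0 = 0"
    using hom(1)[of 0 0] by (metis add_0 add_cancel_right_right)
  then show "a = 0" if "\<sigma> a = 0" for a
    using that hom(4) by (metis injD)
qed

lemma galois_fix: "\<sigma> \<in> absolute_galois_group \<Longrightarrow> \<sigma> (to_ac c) = to_ac c"
  by (simp add: absolute_galois_group_def)

lemma galois_bij: "\<sigma> \<in> absolute_galois_group \<Longrightarrow> bij \<sigma>"
  by (simp add: absolute_galois_group_def ring_iso_def ring_of_type_algebra_def)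

lemma galois_comp:
  assumes "\<sigma> \<in> absolute_galois_group" "\<tau> \<in> absolute_galois_group"
  shows "\<sigma> \<circ> \<tau> \<in> absolute_galois_group"
proof -
  interpret \<sigma>: field_emb \<sigma> by (rule galois_emb) fact
  interpret \<tau>: field_emb \<tau> by (rule galois_emb) fact
  show ?thesis
    using assms by (intro absolute_galois_groupI)
      (auto simp: \<sigma>.hom_add \<tau>.hom_add \<sigma>.hom_mult \<tau>.hom_mult galois_fix intro: bij_comp galois_bij)
qed

lemma galois_inv:
  assumes "\<sigma> \<in> absolute_galois_group"
  shows "inv_into UNIV \<sigma> \<in> absolute_galois_group"
proof -
  interpret \<sigma>: field_emb \<sigma> by (rule galois_emb) fact
  have bij: "bij \<sigma>" using assms by (rule galois_bij)
  have inv: "\<sigma> (inv_into UNIV \<sigma> a) = a" "inv_into UNIV \<sigma> (\<sigma> a) = a" for a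
    using bij by (simp_all add: bij_is_surj bij_is_inj surj_f_inv_f)
  show ?thesis
  proof (intro absolute_galois_groupI)
    show "inv_into UNIV \<sigma> (a + b) = inv_into UNIV \<sigma> a + inv_into UNIV \<sigma> b" for a b
      by (metis inv \<sigma>.hom_add)
    show "inv_into UNIV \<sigma> (a * b) = inv_into UNIV \<sigma> a * inv_into UNIV \<sigma> b" for a b
      by (metis inv \<sigma>.hom_mult)
    show "inv_into UNIV \<sigma> (to_ac c) = to_ac c" for c
      by (metis inv galois_fix[OF assms])
    show "bij (inv_into UNIV \<sigma>)"
      using bij by (rule bij_imp_bij_inv)
  qed
qed

lemma galois_id: "(\<lambda>a. a) \<in> absolute_galois_group"
  by (rule absolute_galois_groupI) (auto simp: bij_def inj_def)

text \<open>The extension is surjective because it permutes the finitely many roots of every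
  polynomial over the base field.\<close>

lemma partial_hom_galois:
  assumes "partial_hom \<Gamma>0"
  obtains \<sigma> where "\<sigma> \<in> absolute_galois_group" "\<And>a b. (a, b) \<in> \<Gamma>0 \<Longrightarrow> \<sigma> a = b"
proof -
  obtain \<Gamma> where \<Gamma>: "partial_hom \<Gamma>" "\<Gamma>0 \<subseteq> \<Gamma>" "\<And>z. \<exists>w. (z, w) \<in> \<Gamma>"
    using partial_hom_maximal[OF assms] by blast
  define \<sigma> where "\<sigma> z = (THE w. (z, w) \<in> \<Gamma>)" for z
  have \<sigma>: "(z, w) \<in> \<Gamma> \<longleftrightarrow> \<sigma> z = w" for z w
    unfolding \<sigma>_def using \<Gamma>(3)[of z] ph_unique[OF \<Gamma>(1)] by (metis the_equality)
  have graph: "(a, \<sigma> a) \<in> \<Gamma>" for a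
    by (simp add: \<sigma>)
  have add: "\<sigma> (a + b) = \<sigma> a + \<sigma> b" and mult: "\<sigma> (a * b) = \<sigma> a * \<sigma> b" for a b
    using ph_add[OF \<Gamma>(1) graph graph, of a b] ph_mult[OF \<Gamma>(1) graph graph, of a b] unfolding \<sigma>
    by simp_all
  have fixes_k: "\<sigma> (to_ac c) = to_ac c" for c
    using ph_const[OF \<Gamma>(1), of c] unfolding \<sigma> .
  have zero: "\<sigma> a = 0 \<Longrightarrow> a = 0" for a
    using ph_inj[OF \<Gamma>(1), of a] by (simp add: \<sigma>)
  interpret \<sigma>: idom_emb \<sigma>
    using fixes_k[of 1] by unfold_locales (auto simp: add mult zero)
  have "inj \<sigma>"
    by (rule injI) (simp add: \<sigma>.hom_eq_iff)
  moreover have "surj \<sigma>"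
  proof -
    have "w \<in> range \<sigma>" for w
    proof -
      obtain p where p: "p \<noteq> 0" "poly (map_poly to_ac p) w = 0"
        using alg_closure_algebraic by blast
      define R where "R = {x. poly (map_poly to_ac p) x = 0}"
      have "map_poly to_ac p \<noteq> 0"
        using p idom_emb.hom_0_iff[OF idom_emb.map_poly_emb[OF field_emb.axioms[OF to_ac_emb]]] by blast
      then have "finite R"
        unfolding R_def by (rule poly_roots_finite)
      moreover have "\<sigma> ` R \<subseteq> R"
      proof -
        have "map_poly \<sigma> (map_poly to_ac p) = map_poly to_ac p"
          by (intro poly_eqI) (simp add: \<sigma>.coeff_map coeff_map_poly fixes_k)
        then have "poly (map_poly to_ac p) (\<sigma> x) = \<sigma> (poly (map_poly to_ac p) x)" for x
          by (metis \<sigma>.poly_map)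
        then show ?thesis
          by (auto simp: R_def \<sigma>.hom_zero)
      qed
      moreover have "inj_on \<sigma> R"
        using \<open>inj \<sigma>\<close> by (rule inj_on_subset) simp
      ultimately have "\<sigma> ` R = R"
        by (rule endo_inj_surj)
      moreover have "w \<in> R"
        using p by (simp add: R_def)
      ultimately show ?thesis by blast
    qed
    then show ?thesis by blast
  qed
  ultimately have "\<sigma> \<in> absolute_galois_group"
    by (intro absolute_galois_groupI add mult fixes_k) (simp add: bij_def)
  moreover have "\<And>a b. (a, b) \<in> \<Gamma>0 \<Longrightarrow> \<sigma> a = b"
    using \<Gamma>(2) \<sigma> by blast
  ultimately show ?thesis
    using that by blast
qed

text \<open>In characteristic zero, the minimal polynomial of \<open>a\<close> over
  \<open>F\<close> is separable. It has degree at least two, so it has a root \<open>b\<close>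
  different from \<open>a\<close>, and some automorphism over \<open>F\<close> maps
  \<open>a\<close> to \<open>b\<close>.\<close>

theorem galois_moves:
  fixes F :: "'k::field_char_0 alg_closure set"
  assumes F: "range to_ac \<subseteq> F" "\<And>a b. a \<in> F \<Longrightarrow> b \<in> F \<Longrightarrow> a + b \<in> F"
      "\<And>a b. a \<in> F \<Longrightarrow> b \<in> F \<Longrightarrow> a * b \<in> F" "\<And>a. a \<in> F \<Longrightarrow> inverse a \<in> F"
    and a: "a \<notin> F"
  obtains \<sigma> where "\<sigma> \<in> absolute_galois_group" "\<And>x. x \<in> F \<Longrightarrow> \<sigma> x = x" "\<sigma> a \<noteq> a"
proof -
  define \<Gamma> where "\<Gamma> = Id_on F"
  have \<Gamma>: "partial_hom \<Gamma>"
    using F by (auto simp: partial_hom_def \<Gamma>_def)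
  obtain p q where pq: "poly_rel \<Gamma> p q" "p \<noteq> 0" "poly p a = 0"
    and min: "\<And>p' q'. poly_rel \<Gamma> p' q' \<Longrightarrow> p' \<noteq> 0 \<Longrightarrow> poly p' a = 0 \<Longrightarrow> Polynomial.degree p \<le> Polynomial.degree p'"
    using minimal_poly_rel[OF \<Gamma>, of a] by blast
  have rel: "poly_rel \<Gamma> r r' \<longleftrightarrow> r = r' \<and> (\<forall>i. Polynomial.coeff r i \<in> F)" for r r'
    by (auto simp: poly_rel_def \<Gamma>_def Id_on_def poly_eq_iff)
  have q: "q = p" and coeffs: "Polynomial.coeff p i \<in> F" for i
    using pq(1) by (auto simp: rel)
  have deg0: "Polynomial.degree p \<noteq> 0"
    using pq(2,3) by (metis degree_eq_zeroE pCons_eq_0_iff poly_const_conv)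
  have pd: "poly (pderiv p) a \<noteq> 0"
  proof
    assume *: "poly (pderiv p) a = 0"
    have "Polynomial.coeff (pderiv p) i \<in> F" for i
    proof -
      have "of_nat (Suc i) = to_ac (of_nat (Suc i))"
        by (simp only: to_ac_of_nat)
      then have "of_nat (Suc i) \<in> F"
        using F(1) by blast
      then show ?thesis
        unfolding coeff_pderiv by (intro F coeffs)
    qed
    then have "poly_rel \<Gamma> (pderiv p) (pderiv p)"
      by (simp add: rel)
    moreover have "pderiv p \<noteq> 0"
      using deg0 by (simp add: pderiv_eq_0_iff)
    ultimately have "Polynomial.degree p \<le> Polynomial.degree (pderiv p)"
      using min * by blast
    then show False
      using deg0 by (simp add: degree_pderiv)
  qed
  obtain g where g: "p = [:- a, 1:] * g"
    using pq(3) by (auto simp: poly_eq_0_iff_dvd elim: dvdE)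
  have "poly (pderiv p) a = poly g a"
    unfolding g pderiv_mult poly_add poly_mult by (simp add: pderiv_pCons)
  then have ga: "poly g a \<noteq> 0"
    using pd by simp
  have "Polynomial.degree g \<noteq> 0"
  proof
    assume "Polynomial.degree g = 0"
    then obtain c where c: "g = [:c:]"
      by (elim degree_eq_zeroE)
    have "p = [:- (a * c), c:]"
      by (simp add: g c)
    then have "- (a * c) \<in> F" "c \<in> F"
      using coeffs[of 0] coeffs[of 1] by simp_all
    moreover have "to_ac (- 1) \<in> F"
      using F(1) by blast
    ultimately have "(to_ac (- 1) * - (a * c)) * inverse c \<in> F"
      by (intro F)
    moreover have "c \<noteq> 0"
      using ga c by auto
    ultimately show False
      using a by (simp add: mult.assoc)
  qed
  then obtain b where b: "poly g b = 0"
    using alg_closed_imp_poly_has_root[of g] by blast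
  then have "b \<noteq> a"
    using ga by auto
  have "poly q b = 0"
    by (simp add: q g b del: mult_pCons_left)
  then obtain \<Gamma>' where \<Gamma>': "partial_hom \<Gamma>'" "\<Gamma> \<subseteq> \<Gamma>'" "(a, b) \<in> \<Gamma>'"
    using partial_hom_extend[OF \<Gamma> pq] min by blast
  obtain \<sigma> where \<sigma>: "\<sigma> \<in> absolute_galois_group" "\<And>a b. (a, b) \<in> \<Gamma>' \<Longrightarrow> \<sigma> a = b"
    using partial_hom_galois[OF \<Gamma>'(1)] by blast
  show ?thesis
    using that[OF \<sigma>(1)] \<sigma>(2) \<Gamma>' \<open>b \<noteq> a\<close> by (force simp: \<Gamma>_def)
qed

corollary galois_fixed_field:
  fixes a :: "'k::field_char_0 alg_closure"
  assumes "\<And>\<sigma>. \<sigma> \<in> absolute_galois_group \<Longrightarrow> \<sigma> a = a"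
  shows "a \<in> range to_ac"
proof (rule ccontr)
  assume a: "a \<notin> range to_ac"
  have closed: "x + y \<in> range to_ac" "x * y \<in> range to_ac" "inverse x \<in> range to_ac"
    if "x \<in> range to_ac" "y \<in> range to_ac" for x y :: "'k alg_closure"
    using that by (auto simp flip: to_ac_add to_ac_mult to_ac_inverse)
  obtain \<sigma> where "\<sigma> \<in> absolute_galois_group" "\<sigma> a \<noteq> a"
    using galois_moves[OF subset_refl closed(1) closed(2) closed(3) a] by blast
  then show False
    using assms by blast
qed

lemma adjoin_closed:
  "range to_ac \<subseteq> adjoin \<theta>" "\<theta> \<in> adjoin \<theta>"
  "a \<in> adjoin \<theta> \<Longrightarrow> b \<in> adjoin \<theta> \<Longrightarrow> a + b \<in> adjoin \<theta>"
  "a \<in> adjoin \<theta> \<Longrightarrow> b \<in> adjoin \<theta> \<Longrightarrow> a * b \<in> adjoin \<theta>"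
  "a \<in> adjoin \<theta> \<Longrightarrow> inverse a \<in> adjoin \<theta>"
proof -
  let ?R = "ring_of_type_algebra :: 'a alg_closure ring"
  interpret R: field ?R
    by (rule field_from_type_algebra)
  show "range to_ac \<subseteq> adjoin \<theta>" "\<theta> \<in> adjoin \<theta>"
    by (auto simp: adjoin_def intro: generate_field.incl)
  show "a \<in> adjoin \<theta> \<Longrightarrow> b \<in> adjoin \<theta> \<Longrightarrow> a + b \<in> adjoin \<theta>"
    using generate_field.eng_add[of a ?R _ b] by (simp add: adjoin_def ring_of_type_algebra_def)
  show "a \<in> adjoin \<theta> \<Longrightarrow> b \<in> adjoin \<theta> \<Longrightarrow> a * b \<in> adjoin \<theta>"
    using generate_field.eng_mult[of a ?R _ b] by (simp add: adjoin_def ring_of_type_algebra_def)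
  show "inverse a \<in> adjoin \<theta>" if "a \<in> adjoin \<theta>"
  proof (cases "a = 0")
    case False
    have "inv\<^bsub>?R\<^esub> a = inverse a"
      by (rule R.comm_inv_char) (use False in \<open>auto simp: ring_of_type_algebra_def\<close>)
    then show ?thesis
      using generate_field.m_inv[of a ?R] that False
      by (simp add: adjoin_def ring_of_type_algebra_def)
  qed (use that in simp)
qed

lemma galois_fixes_adjoin:
  assumes \<sigma>: "\<sigma> \<in> absolute_galois_group" "\<sigma> \<theta> = \<theta>" and "a \<in> adjoin \<theta>"
  shows "\<sigma> a = a"
proof -
  let ?R = "ring_of_type_algebra :: 'a alg_closure ring"
  interpret R: field ?R
    by (rule field_from_type_algebra)
  interpret \<sigma>: field_emb \<sigma> by (rule galois_emb) fact
  show ?thesis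
    using \<open>a \<in> adjoin \<theta>\<close> unfolding adjoin_def
  proof (induction rule: generate_field.induct)
    case one
    then show ?case by (simp add: ring_of_type_algebra_def \<sigma>.hom_one)
  next
    case (incl h)
    then show ?case using \<sigma> by (auto simp: galois_fix)
  next
    case (a_inv h)
    have "\<ominus>\<^bsub>?R\<^esub> h = - h"
      by (rule R.minus_equality) (auto simp: ring_of_type_algebra_def)
    then show ?case using a_inv by (simp add: \<sigma>.hom_minus)
  next
    case (m_inv h)
    have "inv\<^bsub>?R\<^esub> h = inverse h"
      by (rule R.comm_inv_char) (use m_inv in \<open>auto simp: ring_of_type_algebra_def\<close>)
    then show ?case using m_inv by (simp add: \<sigma>.hom_inverse)
  next
    case (eng_add h1 h2)
    then show ?case by (simp add: ring_of_type_algebra_def \<sigma>.hom_add)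
  next
    case (eng_mult h1 h2)
    then show ?case by (simp add: ring_of_type_algebra_def \<sigma>.hom_mult)
  qed
qed

section \<open>Ranks of abelian groups\<close>

text \<open>Gaussian elimination without divisions: use one vector to clear a coordinate of the
  others.\<close>

lemma int_dependence:
  fixes A :: "'s \<Rightarrow> 'i \<Rightarrow> int"
  assumes "finite I" "finite S" "card I < card S"
  shows "\<exists>n. (\<exists>s\<in>S. n s \<noteq> 0) \<and> (\<forall>i\<in>I. (\<Sum>s\<in>S. n s * A s i) = 0)"
  using assms
proof (induction I arbitrary: S A rule: finite_induct)
  case empty
  then have "S \<noteq> {}" by auto
  then show ?case by (intro exI[of _ "\<lambda>_. 1"]) auto
next
  case (insert i0 I)
  show ?case
  proof (cases "\<forall>s\<in>S. A s i0 = 0")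
    case True
    obtain n where "\<exists>s\<in>S. n s \<noteq> 0" "\<forall>i\<in>I. (\<Sum>s\<in>S. n s * A s i) = 0"
      using insert.IH[of S A] insert.prems insert.hyps by auto
    then show ?thesis
      using True by (intro exI[of _ n]) auto
  next
    case False
    then obtain s0 where s0: "s0 \<in> S" "A s0 i0 \<noteq> 0" by blast
    define S' where "S' = S - {s0}"
    have S: "S = insert s0 S'" "s0 \<notin> S'" "finite S'"
      using s0 insert.prems by (auto simp: S'_def)
    define A' where "A' s i = A s0 i0 * A s i - A s i0 * A s0 i" for s i
    have "card I < card S'"
      using insert.prems insert.hyps S by auto
    then obtain n' where n': "\<exists>s\<in>S'. n' s \<noteq> 0" "\<forall>i\<in>I. (\<Sum>s\<in>S'. n' s * A' s i) = 0"
      using insert.IH[of S' A'] S by blast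
    define n where "n s = (if s = s0 then - (\<Sum>s\<in>S'. n' s * A s i0) else A s0 i0 * n' s)" for s
    have sum_n: "(\<Sum>s\<in>S. n s * A s i) = (\<Sum>s\<in>S'. n' s * A' s i)" for i
    proof -
      have "(\<Sum>s\<in>S. n s * A s i) = - (\<Sum>s\<in>S'. n' s * A s i0) * A s0 i + (\<Sum>s\<in>S'. A s0 i0 * n' s * A s i)"
      proof -
        have "(\<Sum>s\<in>S'. n s * A s i) = (\<Sum>s\<in>S'. A s0 i0 * n' s * A s i)"
          using S by (intro sum.cong) (auto simp: n_def)
        then show ?thesis
          using S by (simp add: n_def)
      qed
      also have "\<dots> = (\<Sum>s\<in>S'. n' s * A' s i)"
        by (simp add: A'_def algebra_simps sum_subtractf sum_distrib_left sum_distrib_right)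
      finally show ?thesis .
    qed
    have "(\<Sum>s\<in>S. n s * A s i) = 0" if "i \<in> insert i0 I" for i
    proof (cases "i = i0")
      case True
      then show ?thesis
        unfolding sum_n by (simp add: A'_def)
    next
      case False
      then show ?thesis
        using that n'(2) unfolding sum_n by auto
    qed
    moreover have "\<exists>s\<in>S. n s \<noteq> 0"
      using n'(1) s0 S by (auto simp: n_def)
    ultimately show ?thesis by blast
  qed
qed

definition comb :: "('g, 'm) monoid_scheme \<Rightarrow> ('i \<Rightarrow> 'g) \<Rightarrow> ('i \<Rightarrow> int) \<Rightarrow> 'i set \<Rightarrow> 'g" where
  "comb G P n A = finprod G (\<lambda>a. P a [^]\<^bsub>G\<^esub> n a) A"

context comm_group
begin

lemma comb_closed: "P \<in> A \<rightarrow> carrier G \<Longrightarrow> comb G P n A \<in> carrier G"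
  unfolding comb_def by (rule finprod_closed) auto

lemma comb_cong: "P \<in> A \<rightarrow> carrier G \<Longrightarrow> (\<And>a. a \<in> A \<Longrightarrow> n a = n' a) \<Longrightarrow> comb G P n A = comb G P n' A"
  unfolding comb_def by (rule finprod_cong') auto

lemma comb_add:
  assumes "P \<in> A \<rightarrow> carrier G"
  shows "comb G P (\<lambda>a. n a + n' a) A = comb G P n A \<otimes> comb G P n' A"
proof -
  have "comb G P (\<lambda>a. n a + n' a) A = finprod G (\<lambda>a. P a [^] n a \<otimes> P a [^] n' a) A"
    unfolding comb_def using assms by (intro finprod_cong') (auto simp: int_pow_mult Pi_iff)
  also have "\<dots> = comb G P n A \<otimes> comb G P n' A"
    unfolding comb_def using assms by (intro finprod_multf) auto
  finally show ?thesis .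
qed

lemma comb_mult:
  assumes "P \<in> A \<rightarrow> carrier G"
  shows "comb G P (\<lambda>a. k * n a) A = comb G P n A [^] k"
  using assms
proof (induction A rule: infinite_finite_induct)
  case (insert b A)
  then have "P b \<in> carrier G" "P \<in> A \<rightarrow> carrier G" by auto
  then show ?case
    using insert by (simp add: comb_def int_pow_distrib int_pow_pow mult.commute Pi_def)
qed (simp_all add: comb_def int_pow_one)

lemma comb_single:
  assumes "P \<in> A \<rightarrow> carrier G" "finite A" "b \<in> A"
  shows "comb G P (\<lambda>a. if b = a then 1 else 0) A = P b"
proof -
  have "comb G P (\<lambda>a. if b = a then 1 else 0) A = finprod G (\<lambda>a. if b = a then P a else \<one>) A"
    unfolding comb_def using assms by (intro finprod_cong') (auto simp: Pi_iff)
  then show ?thesis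
    using assms by (simp add: finprod_singleton)
qed

lemma comb_reindex:
  assumes "P \<in> h ` A \<rightarrow> carrier G" "inj_on h A"
  shows "comb G P n (h ` A) = comb G (\<lambda>a. P (h a)) (\<lambda>a. n (h a)) A"
  unfolding comb_def using assms by (subst finprod_reindex) (auto intro!: finprod_cong')

end

lemma comb_hom:
  assumes "comm_group G" "comm_group H" "h \<in> hom G H" "P \<in> A \<rightarrow> carrier G"
  shows "h (comb G P n A) = comb H (\<lambda>a. h (P a)) n A"
proof -
  interpret G: comm_group G by fact
  interpret H: comm_group H by fact
  interpret h: group_hom G H h
    using assms by unfold_locales
  show ?thesis
    using assms(4)
  proof (induction A rule: infinite_finite_induct)
    case (insert b A)
    then have *: "P b \<in> carrier G" "P \<in> A \<rightarrow> carrier G" by auto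
    then have "finprod G (\<lambda>a. P a [^]\<^bsub>G\<^esub> n a) A \<in> carrier G"
      by (intro G.finprod_closed) auto
    then show ?case
      using insert * by (simp add: comb_def Pi_def h.hom_int_pow)
  qed (simp_all add: comb_def)
qed

text \<open>The rank can be read off from a homomorphism to \<open>\<int>\<^sup>I\<close> with
  torsion kernel whose image has finite index: independent elements have independent images, and
  the elements \<open>Q i\<close> show that there are enough of them.\<close>

lemma abelian_rank_eqI:
  fixes \<psi> :: "'g \<Rightarrow> 'i \<Rightarrow> int"
  assumes "comm_group G" and I: "finite I"
    and \<psi>_mult: "\<And>x y i. x \<in> carrier G \<Longrightarrow> y \<in> carrier G \<Longrightarrow> i \<in> I \<Longrightarrow> \<psi> (x \<otimes>\<^bsub>G\<^esub> y) i = \<psi> x i + \<psi> y i"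
    and kernel: "\<And>x. x \<in> carrier G \<Longrightarrow> (\<And>i. i \<in> I \<Longrightarrow> \<psi> x i = 0) \<Longrightarrow> \<exists>d::int. d \<noteq> 0 \<and> x [^]\<^bsub>G\<^esub> d = \<one>\<^bsub>G\<^esub>"
    and Q: "\<And>i. i \<in> I \<Longrightarrow> Q i \<in> carrier G" "c \<noteq> 0"
      "\<And>i j. i \<in> I \<Longrightarrow> j \<in> I \<Longrightarrow> \<psi> (Q i) j = (if i = j then c else 0)"
  shows "abelian_rank G = enat (card I)"
proof -
  interpret comm_group G by fact
  have \<psi>_one: "\<psi> \<one>\<^bsub>G\<^esub> i = 0" if "i \<in> I" for i
    using \<psi>_mult[of "\<one>\<^bsub>G\<^esub>" "\<one>\<^bsub>G\<^esub>" i] that by simp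
  have \<psi>_pow: "\<psi> (x [^]\<^bsub>G\<^esub> k) i = k * \<psi> x i" if x: "x \<in> carrier G" and i: "i \<in> I" for x i and k :: int
  proof (induction k rule: int_induct[of _ 0])
    case base
    then show ?case using \<psi>_one[OF i] by simp
  next
    case (step1 k)
    have "x [^]\<^bsub>G\<^esub> (k + 1) = x [^]\<^bsub>G\<^esub> k \<otimes>\<^bsub>G\<^esub> x"
      using x by (subst int_pow_mult) auto
    then show ?case
      using step1 x i by (simp add: \<psi>_mult algebra_simps)
  next
    case (step2 k)
    have "x [^]\<^bsub>G\<^esub> k = x [^]\<^bsub>G\<^esub> (k - 1) \<otimes>\<^bsub>G\<^esub> x"
      using x int_pow_mult[OF x, of "k - 1" 1] by simp
    then show ?case
      using step2 x i \<psi>_mult[of "x [^]\<^bsub>G\<^esub> (k - 1)" x i] by (simp add: algebra_simps)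
  qed
  have \<psi>_comb: "\<psi> (comb G P n A) i = (\<Sum>a\<in>A. n a * \<psi> (P a) i)"
    if "finite A" "P \<in> A \<rightarrow> carrier G" "i \<in> I" for P :: "'z \<Rightarrow> 'g" and n A i
    using that
  proof (induction A rule: finite_induct)
    case empty
    then show ?case by (simp add: comb_def \<psi>_one)
  next
    case (insert b A)
    then have *: "P b \<in> carrier G" "P \<in> A \<rightarrow> carrier G" by auto
    then have "comb G P n (insert b A) = P b [^]\<^bsub>G\<^esub> n b \<otimes>\<^bsub>G\<^esub> comb G P n A"
      unfolding comb_def using insert by (intro finprod_insert) auto
    then show ?case
      using insert * by (simp add: \<psi>_mult \<psi>_pow comb_closed)
  qed
  have upper: "card S \<le> card I" if S: "int_independent G S" for S
  proof (rule ccontr)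
    assume "\<not> card S \<le> card I"
    then obtain n where n: "\<exists>s\<in>S. n s \<noteq> 0" "\<forall>i\<in>I. (\<Sum>s\<in>S. n s * \<psi> s i) = 0"
      using int_dependence[OF I, of S \<psi>] S by (auto simp: int_independent_def)
    have S': "finite S" "(\<lambda>s. s) \<in> S \<rightarrow> carrier G"
      using S by (auto simp: int_independent_def)
    define x where "x = comb G (\<lambda>s. s) n S"
    have x: "x \<in> carrier G"
      unfolding x_def by (rule comb_closed[OF S'(2)])
    have "\<psi> x i = 0" if "i \<in> I" for i
      unfolding x_def \<psi>_comb[OF S' that] using n(2) that by simp
    then obtain d :: int where d: "d \<noteq> 0" "x [^]\<^bsub>G\<^esub> d = \<one>\<^bsub>G\<^esub>"
      using kernel[OF x] by blast
    then have one: "comb G (\<lambda>s. s) (\<lambda>s. d * n s) S = \<one>\<^bsub>G\<^esub>"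
      using comb_mult[OF S'(2), of d n] by (simp add: x_def)
    have "finprod G (\<lambda>s. s [^]\<^bsub>G\<^esub> m s) S = \<one>\<^bsub>G\<^esub> \<Longrightarrow> \<forall>s\<in>S. m s = 0" for m :: "'g \<Rightarrow> int"
      using S by (simp add: int_independent_def)
    from this[OF one[unfolded comb_def]] have "\<forall>s\<in>S. d * n s = 0" .
    then show False
      using n(1) d(1) by auto
  qed
  have inj: "inj_on Q I"
    using Q by (intro inj_onI) (metis (full_types))
  have lower: "int_independent G (Q ` I)"
    unfolding int_independent_def
  proof (intro conjI allI impI)
    show "finite (Q ` I)" "Q ` I \<subseteq> carrier G"
      using I Q by auto
    fix n :: "'g \<Rightarrow> int"
    assume "finprod G (\<lambda>s. s [^]\<^bsub>G\<^esub> n s) (Q ` I) = \<one>\<^bsub>G\<^esub>"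
    then have one: "comb G (\<lambda>s. s) n (Q ` I) = \<one>\<^bsub>G\<^esub>"
      by (simp add: comb_def)
    show "\<forall>s\<in>Q ` I. n s = 0"
    proof
      fix s assume "s \<in> Q ` I"
      then obtain j where j: "j \<in> I" "s = Q j" by blast
      have "0 = (\<Sum>s\<in>Q ` I. n s * \<psi> s j)"
        using \<psi>_comb[of "Q ` I" "\<lambda>s. s" j n] one \<psi>_one[OF j(1)] I Q j by auto
      also have "\<dots> = (\<Sum>i\<in>I. n (Q i) * \<psi> (Q i) j)"
        by (simp add: sum.reindex[OF inj])
      also have "\<dots> = (\<Sum>i\<in>I. if i = j then n (Q i) * c else 0)"
        using Q(3) j by (intro sum.cong) auto
      also have "\<dots> = n s * c"
        using I j by simp
      finally show "n s = 0"
        using Q(2) by simp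
    qed
  qed
  have card: "card (Q ` I) = card I"
    by (rule card_image[OF inj])
  show ?thesis
    unfolding abelian_rank_def
  proof (rule antisym)
    show "(SUP S\<in>{S. int_independent G S}. enat (card S)) \<le> enat (card I)"
      using upper by (intro SUP_least) auto
    show "enat (card I) \<le> (SUP S\<in>{S. int_independent G S}. enat (card S))"
      using lower card by (intro SUP_upper2[of "Q ` I"]) auto
  qed
qed

section \<open>The group of points over the algebraic closure\<close>

context split_conic
begin

abbreviation GL :: "'a poly fract point monoid" where
  "GL \<equiv> mordell_weil_group fL"

lemma GL_simps: "carrier GL = points fL" "P \<otimes>\<^bsub>GL\<^esub> Q = point_add fL P Q" "\<one>\<^bsub>GL\<^esub> = Infinity"
  by (simp_all add: mordell_weil_group_def)

definition \<Theta> :: "'a set" where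
  "\<Theta> = set_mset roots_D"

definition \<Phi> :: "('a \<Rightarrow> int) \<Rightarrow> 'a poly fract point" where
  "\<Phi> n = comb GL Pt n \<Theta>"

lemma finite_\<Theta>: "finite \<Theta>" and \<Theta>_iff: "a \<in> \<Theta> \<longleftrightarrow> poly D a = 0"
  by (simp_all add: \<Theta>_def set_roots_D)

lemma Pt_carrier: "Pt \<in> \<Theta> \<rightarrow> carrier GL"
  using Pt_points by (auto simp: \<Theta>_def GL_simps)

lemma \<Phi>_points: "\<Phi> n \<in> points fL"
  using comm_group.comb_closed[OF mordell_weil_comm_group Pt_carrier] by (simp add: \<Phi>_def GL_simps)

lemma \<Phi>_cong: "(\<And>a. a \<in> \<Theta> \<Longrightarrow> n a = n' a) \<Longrightarrow> \<Phi> n = \<Phi> n'"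
  unfolding \<Phi>_def by (rule comm_group.comb_cong[OF mordell_weil_comm_group Pt_carrier])

lemma \<Phi>_add: "\<Phi> (\<lambda>a. n a + n' a) = \<Phi> n \<otimes>\<^bsub>GL\<^esub> \<Phi> n'"
  unfolding \<Phi>_def by (rule comm_group.comb_add[OF mordell_weil_comm_group Pt_carrier])

lemma \<Phi>_mult: "\<Phi> (\<lambda>a. k * n a) = \<Phi> n [^]\<^bsub>GL\<^esub> k"
  unfolding \<Phi>_def by (rule comm_group.comb_mult[OF mordell_weil_comm_group Pt_carrier])

lemma class_\<Phi>:
  assumes "set_mset M \<subseteq> \<Theta>"
  shows "same_class (\<Prod>a\<in>#M. gens (Pt a)) (gens (\<Phi> (\<lambda>a. int (count M a))))"
  using assms
proof (induction M)
  case empty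
  have "\<Phi> (\<lambda>a. 0 * 0) = \<Phi> (\<lambda>a. 0) [^]\<^bsub>GL\<^esub> (0::int)"
    by (rule \<Phi>_mult)
  then have "\<Phi> (\<lambda>a. 0) = Infinity"
    by (simp add: GL_simps)
  then show ?case
    by (simp add: same_class_refl)
next
  case (add b M)
  then have b: "b \<in> \<Theta>" by simp
  have "(\<lambda>a. int (count (add_mset b M) a)) = (\<lambda>a. (if b = a then 1 else 0) + int (count M a))"
    by (auto simp: fun_eq_iff)
  then have "\<Phi> (\<lambda>a. int (count (add_mset b M) a))
      = \<Phi> (\<lambda>a. if b = a then 1 else 0) \<otimes>\<^bsub>GL\<^esub> \<Phi> (\<lambda>a. int (count M a))"
    by (simp only: \<Phi>_add)
  also have "\<Phi> (\<lambda>a. if b = a then 1 else 0) = Pt b"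
    unfolding \<Phi>_def by (rule comm_group.comb_single[OF mordell_weil_comm_group Pt_carrier finite_\<Theta> b])
  finally have eq: "\<Phi> (\<lambda>a. int (count (add_mset b M) a)) = point_add fL (Pt b) (\<Phi> (\<lambda>a. int (count M a)))"
    by (simp only: GL_simps)
  have "same_class (gens (Pt b) * (\<Prod>a\<in>#M. gens (Pt a))) (gens (Pt b) * gens (\<Phi> (\<lambda>a. int (count M a))))"
    using add by (intro same_class_mult same_class_refl) auto
  moreover have "same_class (gens (Pt b) * gens (\<Phi> (\<lambda>a. int (count M a))))
      (gens (point_add fL (Pt b) (\<Phi> (\<lambda>a. int (count M a)))))"
    using b Pt_points by (intro point_add_class \<Phi>_points) (simp add: \<Theta>_def)
  ultimately have "same_class (gens (Pt b) * (\<Prod>a\<in>#M. gens (Pt a)))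
      (gens (point_add fL (Pt b) (\<Phi> (\<lambda>a. int (count M a)))))"
    by (rule same_class_trans)
  then show ?case
    by (simp only: eq image_mset_add_mset prod_mset.add_mset)
qed

lemma Infinity_points: "Infinity \<in> points fL"
  by (simp add: points_def)

lemma class_1_iff: "P \<in> points fL \<Longrightarrow> same_class (gens P) 1 \<longleftrightarrow> P = Infinity"
  using gens_class_inj[OF _ Infinity_points, of P] by (auto simp: same_class_refl)

theorem points_are_combinations:
  assumes P: "P \<in> points fL"
  shows "\<exists>n. P = \<Phi> n"
proof -
  interpret G: comm_group GL by (rule mordell_weil_comm_group)
  obtain M where M: "set_mset M \<subseteq> \<Theta>" "same_class (gens P * (\<Prod>a\<in>#M. gens (Pt a))) 1"
    using points_generated[OF P] by (auto simp: \<Theta>_def)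
  define Q where "Q = \<Phi> (\<lambda>a. int (count M a))"
  have Q: "Q \<in> points fL" by (simp add: Q_def \<Phi>_points)
  have "same_class (gens P * (\<Prod>a\<in>#M. gens (Pt a))) (gens P * gens Q)"
    unfolding Q_def by (intro same_class_mult same_class_refl class_\<Phi> M)
  moreover have "same_class (gens P * gens Q) (gens (point_add fL P Q))"
    by (intro point_add_class P Q)
  ultimately have "same_class (gens (point_add fL P Q)) 1"
    using M(2) same_class_sym same_class_trans by blast
  then have "P \<otimes>\<^bsub>GL\<^esub> Q = \<one>\<^bsub>GL\<^esub>"
    using class_1_iff[OF point_add_points[OF P Q]] by (simp add: GL_simps)
  then have "P = inv\<^bsub>GL\<^esub> Q"
    using P Q by (intro G.inv_equality[symmetric]) (simp_all add: GL_simps)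
  also have "\<dots> = Q [^]\<^bsub>GL\<^esub> (- 1 :: int)"
    using Q G.int_pow_neg[of Q 1] by (simp add: GL_simps)
  also have "\<dots> = \<Phi> (\<lambda>a. - 1 * int (count M a))"
    unfolding Q_def by (rule \<Phi>_mult[symmetric])
  finally show ?thesis
    by (rule exI[of _ "\<lambda>a. - 1 * int (count M a)"])
qed

lemma \<Phi>_roots_D: "\<Phi> (\<lambda>a. int (count roots_D a)) = Infinity"
proof -
  have "same_class (\<Prod>a\<in>#roots_D. gens (Pt a)) (gens (\<Phi> (\<lambda>a. int (count roots_D a))))"
    by (rule class_\<Phi>) (simp add: \<Theta>_def)
  from same_class_trans[OF same_class_sym[OF this] same_class_singleton[OF U_neq_0 span_roots_D]]
  show ?thesis
    by (simp only: class_1_iff[OF \<Phi>_points])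
qed

text \<open>Adding a multiple of the known relation makes all coefficients nonnegative, and then
  the relation is one between products of ideals.\<close>

theorem combination_trivial_iff:
  "\<Phi> n = Infinity \<longleftrightarrow> (\<exists>j. \<forall>a\<in>\<Theta>. n a = j * int (count roots_D a))"
proof
  assume "\<exists>j. \<forall>a\<in>\<Theta>. n a = j * int (count roots_D a)"
  then obtain j where j: "\<forall>a\<in>\<Theta>. n a = j * int (count roots_D a)" ..
  interpret G: comm_group GL by (rule mordell_weil_comm_group)
  have "\<Phi> (\<lambda>a. int (count roots_D a)) = \<one>\<^bsub>GL\<^esub>"
    by (simp add: \<Phi>_roots_D GL_simps)
  then have "\<Phi> (\<lambda>a. j * int (count roots_D a)) = \<one>\<^bsub>GL\<^esub>"
    by (simp only: \<Phi>_mult G.int_pow_one)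
  moreover have "\<Phi> n = \<Phi> (\<lambda>a. j * int (count roots_D a))"
    using j by (intro \<Phi>_cong) simp
  ultimately show "\<Phi> n = Infinity"
    by (simp add: GL_simps)
next
  assume n: "\<Phi> n = Infinity"
  interpret G: comm_group GL by (rule mordell_weil_comm_group)
  \<comment> \<open>A bound for all coefficients, so that adding this multiple of the multiplicities makes them nonnegative.\<close>
  define j0 where "j0 = (\<Sum>a\<in>\<Theta>. \<bar>n a\<bar>)"
  define n' where "n' a = n a + j0 * int (count roots_D a)" for a
  have n'0: "n' a \<ge> 0" if "a \<in> \<Theta>" for a
  proof -
    have "\<bar>n a\<bar> \<le> j0"
      unfolding j0_def using that finite_\<Theta> by (intro member_le_sum) auto
    moreover have "1 \<le> int (count roots_D a)"
      using that by (simp add: \<Theta>_def Suc_le_eq)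
    then have "j0 * 1 \<le> j0 * int (count roots_D a)"
      by (intro mult_left_mono) (auto simp: j0_def sum_nonneg)
    ultimately show ?thesis
      by (simp add: n'_def)
  qed
  define M where "M = (\<Sum>a\<in>\<Theta>. replicate_mset (nat (n' a)) a)"
  have count: "count M a = (if a \<in> \<Theta> then nat (n' a) else 0)" for a
    unfolding M_def count_sum using finite_\<Theta> by simp
  then have M: "set_mset M \<subseteq> \<Theta>"
    by (auto simp: set_mset_def split: if_splits)
  have "\<Phi> (\<lambda>a. int (count roots_D a)) = \<one>\<^bsub>GL\<^esub>"
    by (simp add: \<Phi>_roots_D GL_simps)
  then have "\<Phi> (\<lambda>a. j0 * int (count roots_D a)) = \<one>\<^bsub>GL\<^esub>"
    by (simp only: \<Phi>_mult G.int_pow_one)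
  then have "\<Phi> n' = \<one>\<^bsub>GL\<^esub>"
    unfolding n'_def \<Phi>_add using n by (simp add: GL_simps)
  moreover have "\<Phi> n' = \<Phi> (\<lambda>a. int (count M a))"
    using n'0 by (intro \<Phi>_cong) (simp add: count)
  ultimately have "same_class (\<Prod>a\<in>#M. gens (Pt a)) 1"
    using class_\<Phi>[OF M] by (simp add: GL_simps)
  then obtain j where j: "M = repeat_mset j roots_D"
    using relations_between_generators[of M] M by (auto simp: \<Theta>_def)
  have "n a = (int j - j0) * int (count roots_D a)" if "a \<in> \<Theta>" for a
  proof -
    have "int (count M a) = n' a"
      using n'0[OF that] that by (simp add: count)
    then have "n' a = int j * int (count roots_D a)"
      by (simp add: j)
    then show ?thesis
      by (simp add: n'_def algebra_simps)
  qed
  then show "\<exists>j. \<forall>a\<in>\<Theta>. n a = j * int (count roots_D a)"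
    by blast
qed

end

section \<open>Functoriality in the field of constants\<close>

fun pmap :: "('a \<Rightarrow> 'b) \<Rightarrow> 'a point \<Rightarrow> 'b point" where
  "pmap g Infinity = Infinity"
| "pmap g (Affine a b) = Affine (g a) (g b)"

lemma pmap_points:
  assumes "field_emb g"
  shows "pmap g P \<in> points (map_poly g f) \<longleftrightarrow> P \<in> points f"
proof -
  interpret g: field_emb g by fact
  show ?thesis
    by (cases P) (simp_all add: points_def g.poly_map g.hom_eq_iff flip: g.hom_power)
qed

lemma pmap_add:
  assumes "field_emb g"
  shows "pmap g (point_add f P Q) = point_add (map_poly g f) (pmap g P) (pmap g Q)"
proof -
  interpret g: field_emb g by fact
  have opp: "g a = - g b \<longleftrightarrow> a = - b" for a b
    using g.hom_eq_iff[of a "- b"] by (simp add: g.hom_minus)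
  show ?thesis
    by (cases P; cases Q)
      (simp_all add: Let_def opp g.hom_eq_iff g.hom_add g.hom_diff g.hom_minus g.hom_mult g.hom_divide
        g.hom_power g.hom_numeral g.coeff_map g.poly_map flip: g.map_poly_pderiv)
qed

lemma pmap_inj:
  assumes "field_emb g" "pmap g P = pmap g Q"
  shows "P = Q"
proof -
  interpret g: field_emb g by fact
  show ?thesis
    using assms(2) by (cases P; cases Q) (auto simp: g.hom_eq_iff)
qed

lemma pmap_hom:
  assumes "field_emb g"
  shows "pmap g \<in> hom (mordell_weil_group f) (mordell_weil_group (map_poly g f))"
  using pmap_points[OF assms] pmap_add[OF assms] by (auto simp: hom_def mordell_weil_group_def)

text \<open>The addition formulas are rational over the smaller field, so the axioms are inherited
  from the larger one.\<close>

lemma comm_group_descends: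
  assumes g: "field_emb g" and "comm_group (mordell_weil_group (map_poly g f))"
  shows "comm_group (mordell_weil_group f)"
proof -
  interpret G: comm_group "mordell_weil_group (map_poly g f)" by fact
  have carrier: "pmap g P \<in> carrier (mordell_weil_group (map_poly g f))" if "P \<in> points f" for P
    using that pmap_points[OF g] by (simp add: mordell_weil_group_def)
  have mult: "point_add (map_poly g f) P Q = P \<otimes>\<^bsub>mordell_weil_group (map_poly g f)\<^esub> Q" for P Q
    by (simp add: mordell_weil_group_def)
  have closed: "point_add f P Q \<in> points f" if "P \<in> points f" "Q \<in> points f" for P Q
  proof -
    have "pmap g P \<otimes>\<^bsub>mordell_weil_group (map_poly g f)\<^esub> pmap g Q \<in> carrier (mordell_weil_group (map_poly g f))"
      using that by (intro G.m_closed carrier)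
    then have "pmap g (point_add f P Q) \<in> points (map_poly g f)"
      by (simp add: pmap_add[OF g] mordell_weil_group_def)
    then show ?thesis
      by (simp only: pmap_points[OF g])
  qed
  show ?thesis
  proof (rule comm_groupI)
    fix P Q assume P: "P \<in> carrier (mordell_weil_group f)" and Q: "Q \<in> carrier (mordell_weil_group f)"
    then show "P \<otimes>\<^bsub>mordell_weil_group f\<^esub> Q \<in> carrier (mordell_weil_group f)"
      by (simp add: mordell_weil_group_def closed)
    have "pmap g (point_add f P Q) = pmap g (point_add f Q P)"
      unfolding pmap_add[OF g] mult using P Q
      by (intro G.m_comm carrier) (simp_all add: mordell_weil_group_def)
    then show "P \<otimes>\<^bsub>mordell_weil_group f\<^esub> Q = Q \<otimes>\<^bsub>mordell_weil_group f\<^esub> P"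
      using pmap_inj[OF g] by (simp add: mordell_weil_group_def)
    fix R assume R: "R \<in> carrier (mordell_weil_group f)"
    have "pmap g (point_add f (point_add f P Q) R) = pmap g (point_add f P (point_add f Q R))"
      unfolding pmap_add[OF g] mult using P Q R
      by (intro G.m_assoc carrier) (simp_all add: mordell_weil_group_def)
    then show "P \<otimes>\<^bsub>mordell_weil_group f\<^esub> Q \<otimes>\<^bsub>mordell_weil_group f\<^esub> R
        = P \<otimes>\<^bsub>mordell_weil_group f\<^esub> (Q \<otimes>\<^bsub>mordell_weil_group f\<^esub> R)"
      using pmap_inj[OF g] by (simp add: mordell_weil_group_def)
  next
    fix P assume P: "P \<in> carrier (mordell_weil_group f)"
    show "\<exists>Q\<in>carrier (mordell_weil_group f). Q \<otimes>\<^bsub>mordell_weil_group f\<^esub> P = \<one>\<^bsub>mordell_weil_group f\<^esub>"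
    proof (cases P)
      case Infinity
      then show ?thesis
        using P by (intro bexI[of _ P]) (simp_all add: mordell_weil_group_def)
    next
      case (Affine a b)
      then show ?thesis
        using P by (intro bexI[of _ "Affine a (- b)"]) (simp_all add: mordell_weil_group_def points_def)
    qed
  qed (simp_all add: mordell_weil_group_def points_def)
qed

definition fract_map :: "('a::field \<Rightarrow> 'b::field) \<Rightarrow> 'a poly fract \<Rightarrow> 'b poly fract" where
  "fract_map h = fract_lift (\<lambda>p. to_fract (map_poly h p))"

lemma const_T_0: "const_T 0 = 0"
  by (simp add: const_T_def)

context
  fixes h :: "'a::field \<Rightarrow> 'b::field"
  assumes h: "field_emb h"
begin

interpretation field_emb h by (fact h)

lemma coeffwise_emb: "idom_emb (\<lambda>p. to_fract (map_poly h p))"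
  by (rule idom_emb_comp[OF to_fract_emb map_poly_emb])

lemma fract_map_emb: "field_emb (fract_map h)"
  unfolding fract_map_def by (rule fract_lift_emb[OF coeffwise_emb])

lemma fract_map_Fract: "b \<noteq> 0 \<Longrightarrow> fract_map h (Fract a b) = Fract (map_poly h a) (map_poly h b)"
  using fract_lift_Fract[OF coeffwise_emb, of b a] by (simp add: fract_map_def Fract_conv_to_fract)

lemma fract_map_const: "fract_map h (const_T c) = const_T (h c)"
  unfolding fract_map_def const_T_def
  by (simp add: fract_lift_to_fract[OF coeffwise_emb] map_poly_pCons)

lemma fract_map_var: "fract_map h var_T = var_T"
  unfolding fract_map_def var_T_def
  by (simp add: fract_lift_to_fract[OF coeffwise_emb] map_poly_pCons hom_zero hom_one)

lemma fract_map_curve: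
  "map_poly (fract_map h) (curve_poly A B C) = curve_poly (map_poly h A) (map_poly h B) (map_poly h C)"
proof -
  interpret g: field_emb "fract_map h" by (rule fract_map_emb)
  interpret mg: idom_emb "map_poly (fract_map h)" by (rule g.map_poly_emb)
  have "map_poly (fract_map h) (map_poly const_T p) = map_poly const_T (map_poly h p)" for p
    by (simp add: map_poly_map_poly const_T_0 hom_zero g.hom_zero comp_def fract_map_const)
  then show ?thesis
    by (simp add: curve_poly_def mg.hom_add g.map_poly_smult fract_map_var g.hom_power)
qed

end

lemma count_image_mset_inj: "inj g \<Longrightarrow> count (image_mset g M) (g a) = count M a"
  by (induction M) (auto dest: injD)

text \<open>If the denominator is monic of least degree, the representation as a fraction is
  unique, so numerator and denominator are fixed as well.\<close>

lemma fract_map_fixed: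
  fixes q :: "'k::field_char_0 alg_closure poly fract"
  assumes fixed: "\<And>\<sigma>. \<sigma> \<in> absolute_galois_group \<Longrightarrow> fract_map \<sigma> q = q"
  shows "q \<in> range (fract_map to_ac)"
proof -
  let ?P = "\<lambda>b. b \<noteq> 0 \<and> (\<exists>a. q = Fract a b)"
  obtain b0 where "?P b0"
    by (cases q) auto
  from ex_has_least_nat[of ?P, OF this, of Polynomial.degree]
  obtain b1 where b1: "?P b1" and min1: "\<And>b. ?P b \<Longrightarrow> Polynomial.degree b1 \<le> Polynomial.degree b"
    by blast
  then obtain a1 where a1: "q = Fract a1 b1" by blast
  define c where "c = inverse (lead_coeff b1)"
  have c: "c \<noteq> 0" using b1 by (simp add: c_def)
  define a where "a = smult c a1"
  define b where "b = smult c b1"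
  have b: "b \<noteq> 0" "lead_coeff b = 1" "Polynomial.degree b = Polynomial.degree b1"
    using b1 c by (simp_all add: b_def c_def)
  have q: "q = Fract a b"
    using b1 c by (simp add: a1 eq_fract a_def b_def)
  have inv: "map_poly \<sigma> a = a \<and> map_poly \<sigma> b = b" if \<sigma>: "\<sigma> \<in> absolute_galois_group" for \<sigma>
  proof -
    interpret \<sigma>: field_emb \<sigma> by (rule galois_emb[OF \<sigma>])
    interpret m: idom_emb "map_poly \<sigma>" by (rule \<sigma>.map_poly_emb)
    have "Fract (map_poly \<sigma> a) (map_poly \<sigma> b) = Fract a b"
      using fixed[OF \<sigma>] b by (simp add: q fract_map_Fract[OF \<sigma>.field_emb_axioms])
    then have cross: "map_poly \<sigma> a * b = a * map_poly \<sigma> b"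
      using b by (simp add: eq_fract m.hom_0_iff)
    have "b - map_poly \<sigma> b = 0"
    proof (rule ccontr)
      assume nz: "b - map_poly \<sigma> b \<noteq> 0"
      have "(a - map_poly \<sigma> a) * b = a * (b - map_poly \<sigma> b)"
        using cross by (simp add: algebra_simps)
      then have "q = Fract (a - map_poly \<sigma> a) (b - map_poly \<sigma> b)"
        using nz b by (simp add: q eq_fract mult.commute)
      then have le: "Polynomial.degree b \<le> Polynomial.degree (b - map_poly \<sigma> b)"
        using min1[of "b - map_poly \<sigma> b"] nz b by auto
      have "Polynomial.coeff (b - map_poly \<sigma> b) (Polynomial.degree b) = 0"
        using b(2) by (simp add: \<sigma>.coeff_map \<sigma>.hom_one)
      moreover have "Polynomial.degree (b - map_poly \<sigma> b) \<le> Polynomial.degree b"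
        by (rule degree_diff_le) (simp_all add: \<sigma>.degree_map)
      ultimately have "lead_coeff (b - map_poly \<sigma> b) = 0"
        using le by simp
      then show False
        using nz by (simp only: leading_coeff_0_iff)
    qed
    then have "map_poly \<sigma> b = b" by simp
    then show ?thesis
      using cross b by simp
  qed
  have descend: "\<exists>r. p = map_poly to_ac r" if "\<And>\<sigma>. \<sigma> \<in> absolute_galois_group \<Longrightarrow> map_poly \<sigma> p = p" for p :: "'k alg_closure poly"
  proof -
    have "Polynomial.coeff p i \<in> range to_ac" for i
    proof (rule galois_fixed_field)
      fix \<sigma> :: "'k alg_closure \<Rightarrow> 'k alg_closure" assume \<sigma>: "\<sigma> \<in> absolute_galois_group"
      interpret \<sigma>: field_emb \<sigma> by (rule galois_emb[OF \<sigma>])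
      show "\<sigma> (Polynomial.coeff p i) = Polynomial.coeff p i"
        using that[OF \<sigma>] by (metis \<sigma>.coeff_map)
    qed
    then have "p = map_poly to_ac (map_poly of_ac p)"
      by (intro poly_eqI) (simp add: coeff_map_poly to_ac_of_ac)
    then show ?thesis by blast
  qed
  obtain a' b' where "a = map_poly to_ac a'" "b = map_poly to_ac b'"
    using descend[of a] descend[of b] inv by blast
  moreover from this have "b' \<noteq> 0"
    using b by auto
  ultimately have "q = fract_map to_ac (Fract a' b')"
    by (simp add: q fract_map_Fract[OF to_ac_emb])
  then show ?thesis by blast
qed

text \<open>A generator of the ideal of \<open>f\<close> and \<open>f'\<close> has no root in the
  algebraic closure, where it would be a singular point. The identity remains valid after every
  extension of the field.\<close>

lemma elliptic_curve_bezout: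
  fixes f :: "'l::field poly"
  assumes "elliptic_curve f"
  shows "\<exists>u v. u * f + v * pderiv f = 1"
proof -
  let ?P = "\<lambda>g. g \<noteq> 0 \<and> (\<exists>u v. g = u * f + v * pderiv f)"
  have f0: "f \<noteq> 0"
    using assms by (auto simp: elliptic_curve_def)
  then have "?P f"
    by (intro conjI exI[of _ 1] exI[of _ 0]) simp_all
  from ex_has_least_nat[of ?P, OF this, of Polynomial.degree]
  obtain g where g: "?P g" and min: "\<And>g'. ?P g' \<Longrightarrow> Polynomial.degree g \<le> Polynomial.degree g'"
    by blast
  then obtain u v where uv: "g = u * f + v * pderiv f" by blast
  have dvd: "g dvd a" if a: "a = u' * f + v' * pderiv f" for a u' v'
  proof -
    have "a mod g = a - (a div g) * g"
      by (simp add: minus_div_mult_eq_mod)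
    also have "\<dots> = (u' - (a div g) * u) * f + (v' - (a div g) * v) * pderiv f"
      unfolding uv by (subst a) (simp add: algebra_simps)
    finally have eq: "a mod g = (u' - (a div g) * u) * f + (v' - (a div g) * v) * pderiv f" .
    have "a mod g = 0"
    proof (rule ccontr)
      assume nz: "a mod g \<noteq> 0"
      then have "Polynomial.degree (a mod g) < Polynomial.degree g"
        using degree_mod_less'[of g a] g by auto
      moreover have "Polynomial.degree g \<le> Polynomial.degree (a mod g)"
        using nz eq by (intro min) blast
      ultimately show False by simp
    qed
    then show ?thesis by (simp add: dvd_eq_mod_eq_0)
  qed
  have "Polynomial.degree g = 0"
  proof (rule ccontr)
    assume deg: "Polynomial.degree g \<noteq> 0"
    interpret ac: field_emb "to_ac :: 'l \<Rightarrow> 'l alg_closure" by (rule to_ac_emb)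
    interpret mac: idom_emb "map_poly (to_ac :: 'l \<Rightarrow> 'l alg_closure)" by (rule ac.map_poly_emb)
    obtain x where x: "poly (map_poly to_ac g) x = 0"
      using alg_closed_imp_poly_has_root[of "map_poly to_ac g"] deg by (auto simp: ac.degree_map)
    have zero: "poly (map_poly to_ac a) x = 0" if "g dvd a" for a
      using that x by (auto simp: mac.hom_mult elim!: dvdE)
    have "g dvd f" "g dvd pderiv f"
      using dvd[of f 1 0] dvd[of "pderiv f" 0 1] by simp_all
    then have "poly (map_poly to_ac f) x = 0" "poly (pderiv (map_poly to_ac f)) x = 0"
      using zero by (simp_all flip: ac.map_poly_pderiv)
    then have "0 ^ 2 = poly (map_poly to_ac f) x \<and> 2 * 0 = (0 :: 'l alg_closure) \<and> poly (pderiv (map_poly to_ac f)) x = 0"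
      by simp
    then show False
      using assms unfolding elliptic_curve_def by blast
  qed
  then obtain c where c: "g = [:c:]" by (elim degree_eq_zeroE)
  then have "c \<noteq> 0" using g by auto
  have "smult (inverse c) g = (smult (inverse c) u) * f + (smult (inverse c) v) * pderiv f"
    by (simp add: uv smult_add_right)
  moreover have "smult (inverse c) g = 1"
    using c \<open>c \<noteq> 0\<close> by (simp add: one_pCons)
  ultimately show ?thesis by metis
qed

section \<open>The Galois action on the group of points\<close>

locale conic_curve =
  fixes \<mu> :: "'k::field_char_0" and B C :: "'k poly" and s :: "'k alg_closure"
  assumes \<mu>: "\<mu> \<noteq> 0" and s_square: "s ^ 2 = to_ac \<mu>"
    and degree_B0: "Polynomial.degree B \<le> 2" and degree_C0: "Polynomial.degree C = 3"
    and elliptic: "elliptic_curve (curve_poly [:\<mu>:] B C)"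
begin

abbreviation fk :: "'k poly fract poly" where
  "fk \<equiv> curve_poly [:\<mu>:] B C"

abbreviation jm :: "'k poly fract \<Rightarrow> 'k alg_closure poly fract" where
  "jm \<equiv> fract_map to_ac"

lemma jm_emb: "field_emb jm"
  by (rule fract_map_emb[OF to_ac_emb])

lemma jm_fk: "map_poly jm fk = curve_poly [:s ^ 2:] (map_poly to_ac B) (map_poly to_ac C)"
  using fract_map_curve[OF to_ac_emb, of "[:\<mu>:]" B C]
  by (simp add: s_square idom_emb.map_poly_pCons[OF field_emb.axioms[OF to_ac_emb]])

sublocale split_conic s "map_poly to_ac B" "map_poly to_ac C"
proof
  interpret ac: field_emb "to_ac :: 'k \<Rightarrow> 'k alg_closure" by (rule to_ac_emb)
  show "s \<noteq> 0"
    using s_square \<mu> by auto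
  show "Polynomial.degree (map_poly to_ac B) \<le> 2" "Polynomial.degree (map_poly to_ac C) = 3"
    using degree_B0 degree_C0 by (simp_all add: ac.degree_map)
  fix a
  let ?f = "curve_poly [:s ^ 2:] (map_poly to_ac B) (map_poly to_ac C)"
  assume a: "poly ?f a = 0"
  interpret j: field_emb jm by (rule jm_emb)
  interpret mj: idom_emb "map_poly jm" by (rule j.map_poly_emb)
  obtain u v where "u * fk + v * pderiv fk = 1"
    using elliptic_curve_bezout[OF elliptic] by blast
  then have "map_poly jm (u * fk + v * pderiv fk) = 1"
    by (simp add: mj.hom_one)
  then have "map_poly jm u * ?f + map_poly jm v * pderiv ?f = 1"
    by (simp only: mj.hom_add mj.hom_mult j.map_poly_pderiv jm_fk)
  then have "poly (map_poly jm u * ?f + map_poly jm v * pderiv ?f) a = 1"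
    by simp
  then show "poly (pderiv ?f) a \<noteq> 0"
    using a by auto
qed

abbreviation Gk :: "'k poly fract point monoid" where
  "Gk \<equiv> mordell_weil_group fk"

lemma Gk_simps: "carrier Gk = points fk" "P \<otimes>\<^bsub>Gk\<^esub> Q = point_add fk P Q" "\<one>\<^bsub>Gk\<^esub> = Infinity"
  by (simp_all add: mordell_weil_group_def)

lemma Gk_comm_group: "comm_group Gk"
  using comm_group_descends[OF jm_emb, of fk] mordell_weil_comm_group by (simp only: jm_fk)

lemma pmap_jm_hom: "pmap jm \<in> hom Gk GL"
  using pmap_hom[OF jm_emb, of fk] by (simp only: jm_fk)

lemma pmap_jm_points: "pmap jm P \<in> points fL \<longleftrightarrow> P \<in> points fk"
  using pmap_points[OF jm_emb, of P fk] by (simp only: jm_fk)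

text \<open>Only \<open>s\<^sup>2\<close> enters the definition of \<open>D\<close>, so
  \<open>D\<close> has coefficients in \<open>k\<close>.\<close>

definition D0 :: "'k poly" where
  "D0 = C - smult (1 / (4 * \<mu>)) (B ^ 2)"

lemma D_D0: "D = map_poly to_ac D0"
proof -
  interpret ac: field_emb "to_ac :: 'k \<Rightarrow> 'k alg_closure" by (rule to_ac_emb)
  interpret mac: idom_emb "map_poly (to_ac :: 'k \<Rightarrow> 'k alg_closure)" by (rule ac.map_poly_emb)
  show ?thesis
    by (simp add: D_def D0_def mac.hom_diff ac.map_poly_smult mac.hom_power s_square)
qed

context
  fixes \<sigma> :: "'k alg_closure \<Rightarrow> 'k alg_closure"
  assumes \<sigma>: "\<sigma> \<in> absolute_galois_group"
begin

interpretation \<sigma>: field_emb \<sigma> by (rule galois_emb[OF \<sigma>])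

lemma galois_map_base: "map_poly \<sigma> (map_poly to_ac p) = map_poly to_ac p"
  by (intro poly_eqI) (simp add: \<sigma>.coeff_map coeff_map_poly galois_fix[OF \<sigma>])

lemma galois_\<Theta>: "\<sigma> a \<in> \<Theta> \<longleftrightarrow> a \<in> \<Theta>"
  using \<sigma>.poly_map[of D a] galois_map_base[of D0] by (simp add: \<Theta>_iff D_D0 \<sigma>.hom_0_iff)

lemma galois_image_\<Theta>: "\<sigma> ` \<Theta> = \<Theta>" and galois_inj: "inj \<sigma>"
proof -
  show inj: "inj \<sigma>" using galois_bij[OF \<sigma>] by (rule bij_is_inj)
  show "\<sigma> ` \<Theta> = \<Theta>"
    by (rule endo_inj_surj[OF finite_\<Theta>]) (auto simp: galois_\<Theta> intro: inj_on_subset[OF inj])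
qed

lemma galois_bij_\<Theta>: "bij_betw \<sigma> \<Theta> \<Theta>"
  using galois_image_\<Theta> galois_inj by (auto simp: bij_betw_def intro: inj_on_subset)

lemma galois_count: "count roots_D (\<sigma> a) = count roots_D a"
proof -
  interpret m: idom_emb "map_poly \<sigma>" by (rule \<sigma>.map_poly_emb)
  have "D = map_poly \<sigma> D"
    by (simp add: D_D0 galois_map_base)
  also have "\<dots> = map_poly \<sigma> (smult (lead_coeff D) (\<Prod>a\<in>#roots_D. [:- a, 1:]))"
    by (rule arg_cong[OF D_factor])
  also have "\<dots> = smult (\<sigma> (lead_coeff D)) (\<Prod>a\<in>#image_mset \<sigma> roots_D. [:- a, 1:])"
    by (simp add: \<sigma>.map_poly_smult m.hom_prod_mset multiset.map_comp comp_def
        \<sigma>.map_poly_pCons \<sigma>.hom_minus \<sigma>.hom_one \<sigma>.hom_zero)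
  finally have "proots D = proots (smult (\<sigma> (lead_coeff D)) (\<Prod>a\<in>#image_mset \<sigma> roots_D. [:- a, 1:]))"
    by (rule arg_cong)
  also have "\<dots> = image_mset \<sigma> roots_D"
    using D_neq_0 by (simp only: proots_smult \<sigma>.hom_0_iff leading_coeff_0_iff proots_prod_linear not_False_eq_True)
  finally have "roots_D = image_mset \<sigma> roots_D"
    by (simp only: roots_D_def)
  then have "count roots_D (\<sigma> a) = count (image_mset \<sigma> roots_D) (\<sigma> a)"
    by (rule arg_cong)
  then show ?thesis
    by (simp add: count_image_mset_inj[OF galois_inj])
qed

lemma galois_s: "\<sigma> s = s \<or> \<sigma> s = - s"
proof -
  have "\<sigma> s ^ 2 = s ^ 2"
    using galois_fix[OF \<sigma>] by (simp add: s_square flip: \<sigma>.hom_power)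
  then show ?thesis
    by (simp add: power2_eq_iff)
qed

end

text \<open>The quadratic character of the extension of \<open>k\<close> by
  \<open>s\<close>.\<close>

definition \<chi> :: "('k alg_closure \<Rightarrow> 'k alg_closure) \<Rightarrow> int" where
  "\<chi> \<sigma> = (if \<sigma> s = s then 1 else - 1)"

lemma s_neq_minus: "- s \<noteq> s"
  using s_neq_0 by (metis add_eq_0_iff2 mult_2 mult_eq_0_iff zero_neq_numeral)

lemma \<chi>_comp:
  assumes "\<sigma> \<in> absolute_galois_group" "\<tau> \<in> absolute_galois_group"
  shows "\<chi> (\<lambda>a. \<sigma> (\<tau> a)) = \<chi> \<sigma> * \<chi> \<tau>"
proof -
  interpret \<sigma>: field_emb \<sigma> by (rule galois_emb) fact
  show ?thesis
    using galois_s[OF assms(1)] galois_s[OF assms(2)] s_neq_minus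
    by (auto simp: \<chi>_def \<sigma>.hom_minus)
qed

text \<open>The expression \<open>w = s T + B / (2 s)\<close> changes its sign with
  \<open>s\<close>.\<close>

lemma pmap_galois_Pt:
  assumes \<sigma>: "\<sigma> \<in> absolute_galois_group" and a: "a \<in> \<Theta>"
  shows "pmap (fract_map \<sigma>) (Pt a) = Pt (\<sigma> a) [^]\<^bsub>GL\<^esub> \<chi> \<sigma>"
proof -
  interpret \<sigma>: field_emb \<sigma> by (rule galois_emb[OF \<sigma>])
  interpret g: field_emb "fract_map \<sigma>" by (rule fract_map_emb[OF \<sigma>.field_emb_axioms])
  interpret G: comm_group GL by (rule mordell_weil_comm_group)
  have Pt': "Pt (\<sigma> a) \<in> carrier GL"
    using Pt_carrier a galois_\<Theta>[OF \<sigma>] by auto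
  have W: "poly W (const_T b) = const_T (poly (map_poly to_ac B) b / (2 * s)) + const_T s * var_T" for b
  proof -
    have "poly W (const_T b) = const_T (poly (smult (1 / (2 * s)) (map_poly to_ac B)) b) + const_T s * var_T"
      by (simp only: W_def poly_add ct.poly_map) simp
    then show ?thesis by simp
  qed
  have Ba: "\<sigma> (poly (map_poly to_ac B) a) = poly (map_poly to_ac B) (\<sigma> a)"
    using \<sigma>.poly_map[of "map_poly to_ac B" a] by (simp add: galois_map_base[OF \<sigma>])
  have eq: "fract_map \<sigma> (poly W (const_T a))
      = const_T (poly (map_poly to_ac B) (\<sigma> a) / (2 * \<sigma> s)) + const_T (\<sigma> s) * var_T"
    by (simp only: W g.hom_add g.hom_mult fract_map_const[OF \<sigma>.field_emb_axioms]
        fract_map_var[OF \<sigma>.field_emb_axioms] \<sigma>.hom_divide \<sigma>.hom_mult \<sigma>.hom_numeral Ba)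
  from galois_s[OF \<sigma>] show ?thesis
  proof (elim disjE)
    assume "\<sigma> s = s"
    then have "pmap (fract_map \<sigma>) (Pt a) = Pt (\<sigma> a)"
      by (simp only: Pt_def pmap.simps eq fract_map_const[OF \<sigma>.field_emb_axioms] \<open>\<sigma> s = s\<close>)
        (simp only: W)
    then show ?thesis
      using \<open>\<sigma> s = s\<close> Pt' by (simp add: \<chi>_def)
  next
    assume s: "\<sigma> s = - s"
    have "fract_map \<sigma> (poly W (const_T a)) = - poly W (const_T (\<sigma> a))"
      unfolding eq unfolding W s by (simp add: ct.hom_minus)
    then have "pmap (fract_map \<sigma>) (Pt a) = neg (Pt (\<sigma> a))"
      by (simp add: Pt_def fract_map_const[OF \<sigma>.field_emb_axioms])
    moreover have "neg (Pt (\<sigma> a)) = inv\<^bsub>GL\<^esub> (Pt (\<sigma> a))"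
      using Pt' neg_points by (intro G.inv_equality[symmetric]) (simp_all add: GL_simps point_add_neg)
    moreover have "inv\<^bsub>GL\<^esub> (Pt (\<sigma> a)) = Pt (\<sigma> a) [^]\<^bsub>GL\<^esub> (- 1 :: int)"
      using Pt' G.int_pow_neg[of "Pt (\<sigma> a)" 1] by simp
    ultimately show ?thesis
      using s s_neq_minus by (simp add: \<chi>_def)
  qed
qed

lemma pmap_galois_\<Phi>:
  assumes \<sigma>: "\<sigma> \<in> absolute_galois_group" and n: "\<And>a. a \<in> \<Theta> \<Longrightarrow> n' (\<sigma> a) = \<chi> \<sigma> * n a"
  shows "pmap (fract_map \<sigma>) (\<Phi> n) = \<Phi> n'"
proof -
  interpret \<sigma>: field_emb \<sigma> by (rule galois_emb[OF \<sigma>])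
  interpret G: comm_group GL by (rule mordell_weil_comm_group)
  have "map_poly (fract_map \<sigma>) fL = fL"
  proof -
    have "\<sigma> (s ^ 2) = s ^ 2"
      by (simp add: s_square galois_fix[OF \<sigma>])
    then show ?thesis
      by (simp add: fract_map_curve[OF \<sigma>.field_emb_axioms] galois_map_base[OF \<sigma>] \<sigma>.map_poly_pCons)
  qed
  then have hom: "pmap (fract_map \<sigma>) \<in> hom GL GL"
    using pmap_hom[OF fract_map_emb[OF \<sigma>.field_emb_axioms], of fL] by simp
  have Pt\<sigma>: "Pt (\<sigma> a) \<in> carrier GL" if "a \<in> \<Theta>" for a
    using that Pt_carrier galois_\<Theta>[OF \<sigma>] by auto
  have "pmap (fract_map \<sigma>) (\<Phi> n) = comb GL (\<lambda>a. pmap (fract_map \<sigma>) (Pt a)) n \<Theta>"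
    unfolding \<Phi>_def by (rule comb_hom[OF mordell_weil_comm_group mordell_weil_comm_group hom Pt_carrier])
  also have "\<dots> = comb GL (\<lambda>a. Pt (\<sigma> a)) (\<lambda>a. n' (\<sigma> a)) \<Theta>"
    unfolding comb_def using Pt\<sigma>
    by (intro G.finprod_cong') (auto simp: pmap_galois_Pt[OF \<sigma>] G.int_pow_pow n)
  also have "\<dots> = comb GL Pt n' (\<sigma> ` \<Theta>)"
    using Pt_carrier galois_inj[OF \<sigma>] galois_image_\<Theta>[OF \<sigma>]
    by (intro G.comb_reindex[symmetric]) (auto intro: inj_on_subset)
  also have "\<dots> = \<Phi> n'"
    by (simp add: \<Phi>_def galois_image_\<Theta>[OF \<sigma>])
  finally show ?thesis .
qed

text \<open>The combination is fixed by all automorphisms, so its coordinates are rational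
  functions over \<open>k\<close>.\<close>

lemma equivariant_descends:
  assumes n: "\<And>\<sigma> a. \<sigma> \<in> absolute_galois_group \<Longrightarrow> a \<in> \<Theta> \<Longrightarrow> n (\<sigma> a) = \<chi> \<sigma> * n a"
  shows "\<exists>Q\<in>points fk. pmap jm Q = \<Phi> n"
proof -
  have fixed: "pmap (fract_map \<sigma>) (\<Phi> n) = \<Phi> n" if "\<sigma> \<in> absolute_galois_group" for \<sigma>
    using that n by (intro pmap_galois_\<Phi>) auto
  have "\<exists>Q. pmap jm Q = \<Phi> n"
  proof (cases "\<Phi> n")
    case Infinity
    then show ?thesis by (intro exI[of _ Infinity]) simp
  next
    case (Affine x y)
    have "x \<in> range jm" "y \<in> range jm"
      using fixed by (auto simp: Affine intro!: fract_map_fixed)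
    then show ?thesis
      unfolding Affine by (metis pmap.simps(2) rangeE)
  qed
  then show ?thesis
    using \<Phi>_points pmap_jm_points by metis
qed

end

section \<open>The rank\<close>

context conic_curve
begin

definition coef_vec :: "'k poly fract point \<Rightarrow> 'k alg_closure \<Rightarrow> int" where
  "coef_vec P = (SOME n. pmap jm P = \<Phi> n)"

definition deg_D :: int where
  "deg_D = (\<Sum>a\<in>\<Theta>. int (count roots_D a))"

text \<open>The coefficients of a point are unique up to multiples of the vector of multiplicities
  of the roots. Scaling by the degree of \<open>D\<close> and subtracting the multiple of this
  vector that makes the total zero gives well-defined integers, on which Galois equivariance holds
  exactly.\<close>

definition \<psi> :: "'k poly fract point \<Rightarrow> 'k alg_closure \<Rightarrow> int" where
  "\<psi> P a = deg_D * coef_vec P a - (\<Sum>b\<in>\<Theta>. coef_vec P b) * int (count roots_D a)"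

lemma coef_vec: assumes "P \<in> points fk" shows "pmap jm P = \<Phi> (coef_vec P)"
proof -
  have "pmap jm P \<in> points fL"
    using assms by (simp only: pmap_jm_points)
  then obtain n where "pmap jm P = \<Phi> n"
    using points_are_combinations by blast
  then show ?thesis
    unfolding coef_vec_def by (rule someI[of "\<lambda>n. pmap jm P = \<Phi> n"])
qed

lemma \<Theta>_nonempty: "\<Theta> \<noteq> {}"
proof -
  have "Polynomial.degree D > 0"
    using degree_D by simp
  then obtain a where "poly D a = 0"
    using alg_closed_imp_poly_has_root by blast
  then show ?thesis
    using \<Theta>_iff by blast
qed

lemma count_pos: "a \<in> \<Theta> \<Longrightarrow> count roots_D a > 0"
  by (simp add: \<Theta>_def)

lemma deg_D_pos: "deg_D > 0"
  unfolding deg_D_def using finite_\<Theta> \<Theta>_nonempty count_pos by (intro sum_pos) auto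

lemma \<psi>_eq:
  assumes P: "P \<in> points fk" "pmap jm P = \<Phi> n" and a: "a \<in> \<Theta>"
  shows "\<psi> P a = deg_D * n a - (\<Sum>b\<in>\<Theta>. n b) * int (count roots_D a)"
proof -
  interpret G: comm_group GL by (rule mordell_weil_comm_group)
  have "\<Phi> (\<lambda>b. n b + - 1 * coef_vec P b) = \<Phi> n \<otimes>\<^bsub>GL\<^esub> \<Phi> (coef_vec P) [^]\<^bsub>GL\<^esub> (- 1 :: int)"
    by (simp only: \<Phi>_add \<Phi>_mult)
  also have "\<Phi> (coef_vec P) = \<Phi> n"
    using coef_vec[OF P(1)] P(2) by simp
  also have "\<Phi> n \<otimes>\<^bsub>GL\<^esub> \<Phi> n [^]\<^bsub>GL\<^esub> (- 1 :: int) = \<one>\<^bsub>GL\<^esub>"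
    using \<Phi>_points[of n] G.int_pow_neg[of "\<Phi> n" 1] by (simp add: GL_simps(1) G.r_inv)
  finally obtain j where j: "\<And>b. b \<in> \<Theta> \<Longrightarrow> n b + - 1 * coef_vec P b = j * int (count roots_D b)"
    using combination_trivial_iff[of "\<lambda>b. n b + - 1 * coef_vec P b"] by (auto simp: GL_simps)
  then have nb: "n b = coef_vec P b + j * int (count roots_D b)" if "b \<in> \<Theta>" for b
    using that by (simp add: algebra_simps)
  have "(\<Sum>b\<in>\<Theta>. n b) = (\<Sum>b\<in>\<Theta>. coef_vec P b) + j * deg_D"
    by (simp add: nb deg_D_def sum.distrib sum_distrib_left)
  then show ?thesis
    using a by (simp add: \<psi>_def nb algebra_simps)
qed

lemma \<psi>_add:
  assumes "P \<in> points fk" "Q \<in> points fk" "a \<in> \<Theta>"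
  shows "\<psi> (P \<otimes>\<^bsub>Gk\<^esub> Q) a = \<psi> P a + \<psi> Q a"
proof -
  interpret G: comm_group Gk by (rule Gk_comm_group)
  have PQ: "P \<otimes>\<^bsub>Gk\<^esub> Q \<in> points fk"
    using assms G.m_closed by (simp add: Gk_simps(1))
  have "pmap jm (P \<otimes>\<^bsub>Gk\<^esub> Q) = pmap jm P \<otimes>\<^bsub>GL\<^esub> pmap jm Q"
    using pmap_jm_hom assms by (auto simp: hom_def Gk_simps(1))
  also have "\<dots> = \<Phi> (\<lambda>a. coef_vec P a + coef_vec Q a)"
    using assms by (simp add: coef_vec \<Phi>_add)
  finally have "pmap jm (P \<otimes>\<^bsub>Gk\<^esub> Q) = \<Phi> (\<lambda>a. coef_vec P a + coef_vec Q a)" .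
  from \<psi>_eq[OF PQ this assms(3)] show ?thesis
    by (simp only:) (simp add: \<psi>_def sum.distrib algebra_simps)
qed

lemma \<psi>_equivariant:
  assumes P: "P \<in> points fk" and \<sigma>: "\<sigma> \<in> absolute_galois_group" and a: "a \<in> \<Theta>"
  shows "\<psi> P (\<sigma> a) = \<chi> \<sigma> * \<psi> P a"
proof -
  define n' where "n' b = \<chi> \<sigma> * coef_vec P (inv_into UNIV \<sigma> b)" for b
  have n': "n' (\<sigma> b) = \<chi> \<sigma> * coef_vec P b" for b
    using galois_inj[OF \<sigma>] by (simp add: n'_def inv_f_f)
  have "pmap (fract_map \<sigma>) (pmap jm P) = \<Phi> n'"
    unfolding coef_vec[OF P] using n' by (intro pmap_galois_\<Phi>[OF \<sigma>]) auto
  moreover have "fract_map \<sigma> (jm q) = jm q" for q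
  proof (cases q)
    case (Fract u v)
    interpret mac: idom_emb "map_poly (to_ac :: 'k \<Rightarrow> 'k alg_closure)"
      by (rule idom_emb.map_poly_emb[OF field_emb.axioms[OF to_ac_emb]])
    show ?thesis
      using Fract by (simp add: fract_map_Fract[OF to_ac_emb] fract_map_Fract[OF galois_emb[OF \<sigma>]]
          mac.hom_0_iff galois_map_base[OF \<sigma>])
  qed
  then have "pmap (fract_map \<sigma>) (pmap jm P) = pmap jm P"
    by (cases P) simp_all
  ultimately have jP: "pmap jm P = \<Phi> n'"
    by simp
  have "(\<Sum>b\<in>\<Theta>. n' b) = (\<Sum>b\<in>\<Theta>. n' (\<sigma> b))"
    by (rule sum.reindex_bij_betw[OF galois_bij_\<Theta>[OF \<sigma>], symmetric])
  also have "\<dots> = \<chi> \<sigma> * (\<Sum>b\<in>\<Theta>. coef_vec P b)"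
    by (simp add: n' sum_distrib_left)
  finally have "\<psi> P (\<sigma> a) = deg_D * (\<chi> \<sigma> * coef_vec P a) - \<chi> \<sigma> * (\<Sum>b\<in>\<Theta>. coef_vec P b) * int (count roots_D a)"
    using \<psi>_eq[OF P jP, of "\<sigma> a"] a galois_\<Theta>[OF \<sigma>] by (simp add: n' galois_count[OF \<sigma>])
  then show ?thesis
    by (simp add: \<psi>_def algebra_simps)
qed

lemma \<psi>_sum: "(\<Sum>a\<in>\<Theta>. \<psi> P a) = 0"
  by (simp only: \<psi>_def sum_subtractf flip: sum_distrib_left) (simp add: deg_D_def)

lemma \<psi>_kernel:
  assumes P: "P \<in> points fk" and zero: "\<And>a. a \<in> \<Theta> \<Longrightarrow> \<psi> P a = 0"
  shows "P [^]\<^bsub>Gk\<^esub> deg_D = \<one>\<^bsub>Gk\<^esub>"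
proof -
  have "\<forall>a\<in>\<Theta>. deg_D * coef_vec P a = (\<Sum>b\<in>\<Theta>. coef_vec P b) * int (count roots_D a)"
    using zero by (simp add: \<psi>_def)
  then have "\<Phi> (\<lambda>a. deg_D * coef_vec P a) = Infinity"
    using combination_trivial_iff by blast
  then have "pmap jm P [^]\<^bsub>GL\<^esub> deg_D = Infinity"
    by (simp add: coef_vec[OF P] flip: \<Phi>_mult)
  moreover have "pmap jm (P [^]\<^bsub>Gk\<^esub> deg_D) = pmap jm P [^]\<^bsub>GL\<^esub> deg_D"
    using P by (intro hom_int_pow[OF pmap_jm_hom])
      (simp_all add: Gk_simps(1) comm_group.axioms(2)[OF Gk_comm_group] comm_group.axioms(2)[OF mordell_weil_comm_group])
  ultimately have "pmap jm (P [^]\<^bsub>Gk\<^esub> deg_D) = pmap jm Infinity"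
    by simp
  then show ?thesis
    using pmap_inj[OF jm_emb] by (simp only: Gk_simps)
qed

definition good :: "'k alg_closure set" where
  "good = {a \<in> \<Theta>. s \<in> adjoin a}"

text \<open>Some automorphism fixes \<open>a\<close> and negates \<open>s\<close>, so the value is
  its own negative.\<close>

lemma \<psi>_bad:
  assumes P: "P \<in> points fk" and a: "a \<in> \<Theta>" "a \<notin> good"
  shows "\<psi> P a = 0"
proof -
  have "s \<notin> adjoin a"
    using a by (simp add: good_def)
  then obtain \<sigma> where \<sigma>: "\<sigma> \<in> absolute_galois_group" "\<And>x. x \<in> adjoin a \<Longrightarrow> \<sigma> x = x" "\<sigma> s \<noteq> s"
    using galois_moves[OF adjoin_closed(1) adjoin_closed(3) adjoin_closed(4) adjoin_closed(5), of a s] by blast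
  have "\<sigma> a = a"
    by (rule \<sigma>(2)[OF adjoin_closed(2)])
  then show ?thesis
    using \<psi>_equivariant[OF P \<sigma>(1) a(1)] \<sigma>(3) by (simp add: \<chi>_def)
qed

lemma delta_elements_eq: "delta_elements [:\<mu>:] B C = good"
proof -
  interpret ac: field_emb "to_ac :: 'k \<Rightarrow> 'k alg_closure" by (rule to_ac_emb)
  interpret mac: idom_emb "map_poly (to_ac :: 'k \<Rightarrow> 'k alg_closure)" by (rule ac.map_poly_emb)
  have disc: "poly (map_poly to_ac (conic_disc [:\<mu>:] B C)) a = - (4 * s ^ 2) * poly D a" for a
  proof -
    have "map_poly to_ac (conic_disc [:\<mu>:] B C) = map_poly to_ac B ^ 2 - 4 * [:s ^ 2:] * map_poly to_ac C"
      by (simp only: conic_disc_def mac.hom_diff mac.hom_power mac.hom_mult mac.hom_numeral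
          ac.map_poly_pCons s_square) simp
    then have "poly (map_poly to_ac (conic_disc [:\<mu>:] B C)) a
        = poly (map_poly to_ac B) a ^ 2 - 4 * s ^ 2 * poly (map_poly to_ac C) a"
      by (simp only:) simp
    moreover have "poly D a = poly (map_poly to_ac C) a - poly (map_poly to_ac B) a ^ 2 / (4 * s ^ 2)"
      by (simp add: D_def)
    ultimately show ?thesis
      using s_neq_0 by (simp only:) (simp add: right_diff_distrib)
  qed
  have "nonzero_square_in (adjoin a) (to_ac \<mu>) \<longleftrightarrow> s \<in> adjoin a" for a
  proof
    assume "nonzero_square_in (adjoin a) (to_ac \<mu>)"
    then obtain t where t: "t \<in> adjoin a" "to_ac \<mu> = t ^ 2"
      by (auto simp: nonzero_square_in_def)
    then have "s = t \<or> s = to_ac (- 1) * t"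
      using s_square by (simp add: power2_eq_iff)
    moreover have "to_ac (- 1) \<in> adjoin a"
      using adjoin_closed(1) by blast
    ultimately show "s \<in> adjoin a"
      using t adjoin_closed(4) by blast
  next
    assume "s \<in> adjoin a"
    then show "nonzero_square_in (adjoin a) (to_ac \<mu>)"
      using \<mu> s_square by (auto simp: nonzero_square_in_def intro!: bexI[of _ s])
  qed
  then show ?thesis
    using \<mu> s_neq_0 unfolding delta_elements_def good_def disc
    by (auto simp: \<Theta>_iff ac.map_poly_pCons)
qed

lemma galois_orbit_self: "a \<in> galois_orbit a"
  using galois_id unfolding galois_orbit_def by fastforce

lemma galois_orbit_memD: "b \<in> galois_orbit a \<Longrightarrow> \<exists>\<sigma>\<in>absolute_galois_group. b = \<sigma> a"
  by (auto simp: galois_orbit_def)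

lemma galois_orbit_image:
  fixes \<sigma> :: "'k alg_closure \<Rightarrow> 'k alg_closure"
  shows "\<sigma> \<in> absolute_galois_group \<Longrightarrow> \<sigma> a \<in> galois_orbit b \<longleftrightarrow> a \<in> galois_orbit b"
proof
  assume \<sigma>: "\<sigma> \<in> absolute_galois_group"
  show "\<sigma> a \<in> galois_orbit b" if ab: "a \<in> galois_orbit b"
  proof -
    obtain \<tau> where \<tau>: "\<tau> \<in> absolute_galois_group" "a = \<tau> b"
      using galois_orbit_memD[OF ab] by blast
    have "(\<sigma> \<circ> \<tau>) b \<in> galois_orbit b"
      unfolding galois_orbit_def using galois_comp[OF \<sigma> \<tau>(1)] by blast
    then show ?thesis
      by (simp add: \<tau>(2))
  qed
  show "a \<in> galois_orbit b" if ab: "\<sigma> a \<in> galois_orbit b"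
  proof -
    obtain \<tau> where \<tau>: "\<tau> \<in> absolute_galois_group" "\<sigma> a = \<tau> b"
      using galois_orbit_memD[OF ab] by blast
    then have a: "a = (inv_into UNIV \<sigma> \<circ> \<tau>) b"
      using galois_inj[OF \<sigma>] by (metis comp_apply inv_f_f)
    show ?thesis
      unfolding a galois_orbit_def using galois_comp[OF galois_inv[OF \<sigma>] \<tau>(1)] by blast
  qed
qed

lemma galois_orbit_eq:
  fixes a :: "'k alg_closure"
  assumes "a \<in> galois_orbit b"
  shows "galois_orbit a = galois_orbit b"
proof -
  obtain \<sigma> where \<sigma>: "\<sigma> \<in> absolute_galois_group" "a = \<sigma> b"
    using galois_orbit_memD[OF assms] by blast
  have "\<sigma> b \<in> galois_orbit a"
    by (simp add: galois_orbit_self flip: \<sigma>(2))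
  then have b: "b \<in> galois_orbit a"
    by (simp only: galois_orbit_image[OF \<sigma>(1)])
  have "galois_orbit c \<subseteq> galois_orbit d" if "c \<in> galois_orbit d" for c d :: "'k alg_closure"
    using that galois_orbit_memD[of _ c] galois_orbit_image by blast
  then show ?thesis
    using assms b by blast
qed

definition orbits :: "'k alg_closure set set" where
  "orbits = galois_orbit ` good"

definition orbit_rep :: "'k alg_closure set \<Rightarrow> 'k alg_closure" where
  "orbit_rep c = (SOME a. a \<in> good \<and> galois_orbit a = c)"

lemma finite_orbits: "finite orbits"
  unfolding orbits_def good_def using finite_\<Theta> by simp

lemma orbit_rep: "c \<in> orbits \<Longrightarrow> orbit_rep c \<in> good \<and> galois_orbit (orbit_rep c) = c"
  unfolding orbit_rep_def by (rule someI_ex) (auto simp: orbits_def)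

lemma orbit_rep_mem: "c \<in> orbits \<Longrightarrow> orbit_rep c \<in> c"
  using orbit_rep galois_orbit_self by metis

lemma orbit_rep_\<Theta>: "c \<in> orbits \<Longrightarrow> orbit_rep c \<in> \<Theta>"
  using orbit_rep by (auto simp: good_def)

lemma orbit_subset: "c \<in> orbits \<Longrightarrow> c \<subseteq> \<Theta>"
proof
  fix b assume c: "c \<in> orbits" and "b \<in> c"
  then have "b \<in> galois_orbit (orbit_rep c)"
    using orbit_rep[OF c] by simp
  from galois_orbit_memD[OF this] obtain \<sigma> where "\<sigma> \<in> absolute_galois_group" "b = \<sigma> (orbit_rep c)"
    by blast
  then show "b \<in> \<Theta>"
    using orbit_rep_\<Theta>[OF c] galois_\<Theta> by blast
qed

lemma orbits_disjoint: "c \<in> orbits \<Longrightarrow> c' \<in> orbits \<Longrightarrow> b \<in> c \<Longrightarrow> b \<in> c' \<Longrightarrow> c = c'"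
  using orbit_rep galois_orbit_eq by metis

lemma orbit_image: "c \<in> orbits \<Longrightarrow> \<sigma> \<in> absolute_galois_group \<Longrightarrow> \<sigma> b \<in> c \<longleftrightarrow> b \<in> c"
  using orbit_rep galois_orbit_image by metis

lemma delta_eq: "delta [:\<mu>:] B C = card orbits"
  by (simp add: delta_def delta_elements_eq orbits_def)

lemma \<psi>_on_orbit:
  assumes P: "P \<in> points fk" and c: "c \<in> orbits" "b \<in> c"
  shows "\<exists>\<sigma>\<in>absolute_galois_group. b = \<sigma> (orbit_rep c) \<and> \<psi> P b = \<chi> \<sigma> * \<psi> P (orbit_rep c)"
proof -
  have "b \<in> galois_orbit (orbit_rep c)"
    using orbit_rep[OF c(1)] c(2) by simp
  from galois_orbit_memD[OF this] show ?thesis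
    using \<psi>_equivariant[OF P _ orbit_rep_\<Theta>[OF c(1)]] by blast
qed

lemma \<psi>_zero:
  assumes P: "P \<in> points fk" and zero: "\<And>c. c \<in> orbits \<Longrightarrow> \<psi> P (orbit_rep c) = 0" and a: "a \<in> \<Theta>"
  shows "\<psi> P a = 0"
proof (cases "a \<in> good")
  case True
  then have "galois_orbit a \<in> orbits"
    by (simp add: orbits_def)
  then show ?thesis
    using \<psi>_on_orbit[OF P _ galois_orbit_self, of a] zero by auto
qed (rule \<psi>_bad[OF P a])

text \<open>The points over the roots in an orbit have to be added with signs to give a rational
  point. An automorphism that fixes the representative also fixes \<open>s\<close>, which lies in
  the field generated by the representative; so the sign depends only on the root.\<close>

definition sgn_orbit :: "'k alg_closure set \<Rightarrow> 'k alg_closure \<Rightarrow> int" where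
  "sgn_orbit c b = \<chi> (SOME \<sigma>. \<sigma> \<in> absolute_galois_group \<and> \<sigma> (orbit_rep c) = b)"

lemma sgn_orbit:
  assumes c: "c \<in> orbits" and \<tau>: "\<tau> \<in> absolute_galois_group"
  shows "sgn_orbit c (\<tau> (orbit_rep c)) = \<chi> \<tau>"
proof -
  define \<sigma> where "\<sigma> = (SOME \<sigma>. \<sigma> \<in> absolute_galois_group \<and> \<sigma> (orbit_rep c) = \<tau> (orbit_rep c))"
  have \<sigma>: "\<sigma> \<in> absolute_galois_group" "\<sigma> (orbit_rep c) = \<tau> (orbit_rep c)"
    unfolding \<sigma>_def using someI[of "\<lambda>\<sigma>. \<sigma> \<in> absolute_galois_group \<and> \<sigma> (orbit_rep c) = \<tau> (orbit_rep c)" \<tau>] \<tau> by auto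
  have "(inv_into UNIV \<sigma> \<circ> \<tau>) (orbit_rep c) = orbit_rep c"
    using galois_inj[OF \<sigma>(1)] by (simp flip: \<sigma>(2) add: inv_f_f)
  moreover have "s \<in> adjoin (orbit_rep c)"
    using orbit_rep[OF c] by (simp add: good_def)
  ultimately have "(inv_into UNIV \<sigma> \<circ> \<tau>) s = s"
    using galois_fixes_adjoin galois_comp[OF galois_inv[OF \<sigma>(1)] \<tau>] by blast
  then have "\<tau> s = \<sigma> s"
    using galois_bij[OF \<sigma>(1)] by (metis bij_inv_eq_iff comp_apply)
  then show ?thesis
    by (simp add: sgn_orbit_def \<chi>_def flip: \<sigma>_def)
qed

definition orbit_sum :: "'k alg_closure set \<Rightarrow> 'k alg_closure \<Rightarrow> int" where
  "orbit_sum c b = (if b \<in> c then sgn_orbit c b else 0)"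

lemma orbit_sum_equivariant:
  assumes c: "c \<in> orbits" and \<tau>: "\<tau> \<in> absolute_galois_group"
  shows "orbit_sum c (\<tau> b) = \<chi> \<tau> * orbit_sum c b"
proof (cases "b \<in> c")
  case True
  then have "b \<in> galois_orbit (orbit_rep c)"
    using orbit_rep[OF c] by simp
  from galois_orbit_memD[OF this] obtain \<sigma> where \<sigma>: "\<sigma> \<in> absolute_galois_group" "b = \<sigma> (orbit_rep c)"
    by blast
  have "sgn_orbit c (\<tau> b) = \<chi> (\<tau> \<circ> \<sigma>)"
    using sgn_orbit[OF c galois_comp[OF \<tau> \<sigma>(1)]] by (simp add: \<sigma>(2))
  also have "\<dots> = \<chi> \<tau> * \<chi> \<sigma>"
    using \<chi>_comp[OF \<tau> \<sigma>(1)] by (simp add: comp_def)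
  also have "\<chi> \<sigma> = sgn_orbit c b"
    using sgn_orbit[OF c \<sigma>(1)] by (simp add: \<sigma>(2))
  finally show ?thesis
    using True orbit_image[OF c \<tau>] by (simp add: orbit_sum_def)
qed (simp add: orbit_sum_def orbit_image[OF c \<tau>])

lemma orbit_sum_orbit_rep: "c \<in> orbits \<Longrightarrow> c' \<in> orbits \<Longrightarrow> orbit_sum c (orbit_rep c') = (if c = c' then 1 else 0)"
  using sgn_orbit[OF _ galois_id, of c] orbit_rep_mem orbits_disjoint by (auto simp: orbit_sum_def \<chi>_def)

lemma torsion_if_\<psi>_zero:
  assumes P: "P \<in> points fk" and zero: "\<And>c. c \<in> orbits \<Longrightarrow> \<psi> P (orbit_rep c) = 0"
  shows "\<exists>d::int. d \<noteq> 0 \<and> P [^]\<^bsub>Gk\<^esub> d = \<one>\<^bsub>Gk\<^esub>"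
proof (intro exI conjI)
  show "P [^]\<^bsub>Gk\<^esub> deg_D = \<one>\<^bsub>Gk\<^esub>"
    by (rule \<psi>_kernel[OF P \<psi>_zero[OF P zero]])
  show "deg_D \<noteq> 0"
    using deg_D_pos by simp
qed

text \<open>Some automorphism negates \<open>s\<close> and hence the total of every signed orbit,
  so all these totals vanish and every orbit contributes one dimension.\<close>

lemma rank_nonsquare:
  assumes "s \<notin> range to_ac"
  shows "abelian_rank Gk = enat (card orbits)"
proof -
  obtain \<tau> where \<tau>: "\<tau> \<in> absolute_galois_group" "\<tau> s \<noteq> s"
    using galois_fixed_field[of s] assms by blast
  have sum0: "(\<Sum>b\<in>\<Theta>. orbit_sum c b) = 0" if "c \<in> orbits" for c
  proof -
    have "(\<Sum>b\<in>\<Theta>. orbit_sum c b) = (\<Sum>b\<in>\<Theta>. orbit_sum c (\<tau> b))"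
      by (rule sum.reindex_bij_betw[OF galois_bij_\<Theta>[OF \<tau>(1)], symmetric])
    also have "\<dots> = - (\<Sum>b\<in>\<Theta>. orbit_sum c b)"
      using \<tau>(2) by (simp add: orbit_sum_equivariant[OF that \<tau>(1)] \<chi>_def sum_negf)
    finally show ?thesis by simp
  qed
  have "\<exists>Q\<in>points fk. pmap jm Q = \<Phi> (orbit_sum c)" if "c \<in> orbits" for c
    using orbit_sum_equivariant[OF that] by (intro equivariant_descends) auto
  then obtain Q where Q: "\<And>c. c \<in> orbits \<Longrightarrow> Q c \<in> points fk \<and> pmap jm (Q c) = \<Phi> (orbit_sum c)"
    by metis
  show ?thesis
  proof (rule abelian_rank_eqI[OF Gk_comm_group finite_orbits, where \<psi> = "\<lambda>P c. \<psi> P (orbit_rep c)" and Q = Q and c = deg_D])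
    show "\<psi> (Q i) (orbit_rep j) = (if i = j then deg_D else 0)" if "i \<in> orbits" "j \<in> orbits" for i j
      using that Q[OF that(1)] \<psi>_eq[of "Q i" "orbit_sum i" "orbit_rep j"] orbit_rep_\<Theta>[OF that(2)]
      by (simp add: sum0 orbit_sum_orbit_rep)
    show "\<exists>d::int. d \<noteq> 0 \<and> P [^]\<^bsub>Gk\<^esub> d = \<one>\<^bsub>Gk\<^esub>"
      if "P \<in> carrier Gk" "\<And>i. i \<in> orbits \<Longrightarrow> \<psi> P (orbit_rep i) = 0" for P
      using that by (intro torsion_if_\<psi>_zero) (simp_all only: Gk_simps(1))
  qed (use Q deg_D_pos \<psi>_add orbit_rep_\<Theta> in \<open>auto simp: Gk_simps(1)\<close>)
qed

text \<open>Now all signs are trivial and all orbits count. Vanishing of the total is a genuine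
  condition: the value on one orbit \<open>c0\<close> is determined by the others, and the
  differences of orbits and \<open>c0\<close>, weighted by their sizes, give independent
  points.\<close>

lemma rank_square:
  assumes "s \<in> range to_ac"
  shows "orbits \<noteq> {}" and "abelian_rank Gk = enat (card orbits - 1)"
proof -
  have \<chi>1: "\<chi> \<sigma> = 1" if "\<sigma> \<in> absolute_galois_group" for \<sigma>
    using assms galois_fix[OF that] by (auto simp: \<chi>_def)
  have good: "good = \<Theta>"
    using assms adjoin_closed(1) by (auto simp: good_def)
  show ne: "orbits \<noteq> {}"
    using \<Theta>_nonempty by (simp add: orbits_def good)
  then obtain c0 where c0: "c0 \<in> orbits" by blast
  have fin: "finite c" if "c \<in> orbits" for c
    using orbit_subset[OF that] finite_\<Theta> by (rule finite_subset)
  have card0: "card c0 \<noteq> 0"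
    using fin[OF c0] orbit_rep_mem[OF c0] by auto
  \<comment> \<open>The weights balance the two orbits, so that the total is zero.\<close>
  define n where "n c b = (if b \<in> c then int (card c0) else 0) - (if b \<in> c0 then int (card c) else 0)" for c and b :: "'k alg_closure"
  have sum_c: "(\<Sum>b\<in>\<Theta>. if b \<in> c then k else 0) = int (card c) * k" if "c \<in> orbits" for c and k :: int
  proof -
    have "(\<Sum>b\<in>\<Theta>. if b \<in> c then k else 0) = (\<Sum>b\<in>\<Theta> \<inter> c. k)"
      by (rule sum.inter_restrict[OF finite_\<Theta>, symmetric])
    also have "\<Theta> \<inter> c = c"
      using orbit_subset[OF that] by blast
    finally show ?thesis by simp
  qed
  have sum0: "(\<Sum>b\<in>\<Theta>. n c b) = 0" if "c \<in> orbits" for c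
    unfolding n_def sum_subtractf sum_c[OF that] sum_c[OF c0] by simp
  have "\<exists>Q\<in>points fk. pmap jm Q = \<Phi> (n c)" if "c \<in> orbits" for c
    using orbit_image[OF that] orbit_image[OF c0] by (intro equivariant_descends) (simp add: n_def \<chi>1)
  then obtain Q where Q: "\<And>c. c \<in> orbits \<Longrightarrow> Q c \<in> points fk \<and> pmap jm (Q c) = \<Phi> (n c)"
    by metis
  have n_orbit_rep: "n i (orbit_rep j) = (if i = j then int (card c0) else 0)" if "i \<in> orbits - {c0}" "j \<in> orbits - {c0}" for i j
    using that orbit_rep_mem[of j] orbits_disjoint[of i j "orbit_rep j"] orbits_disjoint[of c0 j "orbit_rep j"] c0
    by (auto simp: n_def)
  have zero: "\<psi> P (orbit_rep c0) = 0" if P: "P \<in> points fk" and z: "\<And>i. i \<in> orbits - {c0} \<Longrightarrow> \<psi> P (orbit_rep i) = 0" for P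
  proof -
    have "\<psi> P b = (if b \<in> c0 then \<psi> P (orbit_rep c0) else 0)" if b: "b \<in> \<Theta>" for b
    proof -
      have o: "galois_orbit b \<in> orbits"
        using b by (simp add: orbits_def good)
      obtain \<sigma> where \<sigma>: "\<sigma> \<in> absolute_galois_group" "\<psi> P b = \<chi> \<sigma> * \<psi> P (orbit_rep (galois_orbit b))"
        using \<psi>_on_orbit[OF P o galois_orbit_self] by blast
      show ?thesis
        using \<sigma>(2) \<chi>1[OF \<sigma>(1)] z[of "galois_orbit b"] o orbits_disjoint[OF o c0 galois_orbit_self]
          galois_orbit_self[of b] by auto
    qed
    then have "(\<Sum>b\<in>\<Theta>. \<psi> P b) = (\<Sum>b\<in>\<Theta>. if b \<in> c0 then \<psi> P (orbit_rep c0) else 0)"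
      by (rule sum.cong[OF refl])
    then show ?thesis
      using \<psi>_sum[of P] sum_c[OF c0] card0 by simp
  qed
  have "abelian_rank Gk = enat (card (orbits - {c0}))"
  proof (rule abelian_rank_eqI[OF Gk_comm_group, where \<psi> = "\<lambda>P c. \<psi> P (orbit_rep c)" and Q = Q and c = "deg_D * int (card c0)"])
    show "\<psi> (Q i) (orbit_rep j) = (if i = j then deg_D * int (card c0) else 0)" if "i \<in> orbits - {c0}" "j \<in> orbits - {c0}" for i j
      using that Q[of i] \<psi>_eq[of "Q i" "n i" "orbit_rep j"] orbit_rep_\<Theta>[of j]
      by (simp add: sum0 n_orbit_rep[OF that])
    show "\<exists>d::int. d \<noteq> 0 \<and> P [^]\<^bsub>Gk\<^esub> d = \<one>\<^bsub>Gk\<^esub>"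
      if P: "P \<in> carrier Gk" and z: "\<And>i. i \<in> orbits - {c0} \<Longrightarrow> \<psi> P (orbit_rep i) = 0" for P
    proof -
      have P': "P \<in> points fk" using P by (simp add: Gk_simps(1))
      have "\<psi> P (orbit_rep i) = 0" if "i \<in> orbits" for i
        using zero[OF P' z] z[of i] that by (cases "i = c0") auto
      then show ?thesis
        by (rule torsion_if_\<psi>_zero[OF P'])
    qed
  qed (use Q deg_D_pos card0 \<psi>_add orbit_rep_\<Theta> finite_orbits in \<open>auto simp: Gk_simps(1)\<close>)
  then show "abelian_rank Gk = enat (card orbits - 1)"
    using c0 finite_orbits by simp
qed

end

theorem proposition6p7:
  fixes \<mu> :: "'k::field_char_0" and B C :: "'k poly"
  assumes "number_field TYPE('k)"
    and "\<mu> \<noteq> 0"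
    and "Polynomial.degree B \<le> 2"
    and "Polynomial.degree C = 3"
    and "elliptic_curve (curve_poly [:\<mu>:] B C)"
  shows "\<exists>r::nat. abelian_rank (mordell_weil_group (curve_poly [:\<mu>:] B C)) = enat r \<and>
           int r = (if \<exists>s. \<mu> = s ^ 2 then int (delta [:\<mu>:] B C) - 1
                    else int (delta [:\<mu>:] B C))"
proof -
  obtain s where s: "s ^ 2 = to_ac \<mu>"
    using nth_root_exists[of 2 "to_ac \<mu>"] by auto
  interpret conic_curve \<mu> B C s
    using assms s by unfold_locales
  have square: "(\<exists>t. \<mu> = t ^ 2) \<longleftrightarrow> s \<in> range to_ac"
  proof
    assume "\<exists>t. \<mu> = t ^ 2"
    then obtain t where "\<mu> = t ^ 2" ..
    then have "s ^ 2 = to_ac t ^ 2"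
      using s by simp
    then have "s = to_ac t \<or> s = to_ac (- t)"
      by (simp add: power2_eq_iff)
    then show "s \<in> range to_ac" by blast
  next
    assume "s \<in> range to_ac"
    then obtain t where "s = to_ac t" by blast
    then have "to_ac \<mu> = to_ac (t ^ 2)"
      using s by simp
    then show "\<exists>t. \<mu> = t ^ 2"
      by (auto simp only: to_ac_eq_iff)
  qed
  show ?thesis
  proof (cases "s \<in> range to_ac")
    case True
    moreover have "card orbits \<noteq> 0"
      using rank_square(1)[OF True] finite_orbits by simp
    ultimately show ?thesis
      using rank_square(2)[OF True] by (simp add: square delta_eq of_nat_diff)
  next
    case False
    then show ?thesis
      using rank_nonsquare by (simp add: square delta_eq)
  qed
qed

end
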